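(* Let $\mathcal{C}$ be a finite category and $\alpha\in Z^2(\mathcal{O}_{\mathcal{C}};\mathbb{F}_p^\times)$. If for every idempotent endomorphism $e$ in $\mathcal{C}$ there is a $\Gamma$-equivariant bijection $\mathcal{S}(k_\alpha G_e)\to \mathcal{W}(k_\alpha \mathcal{O}_{G_e})$, then there exists a $\Gamma$-equivariant bijection $\mathcal{S}(k_\alpha \mathcal{C})\to \mathcal{W}(k_\alpha\mathcal{O}_{\mathcal{C}})$.
   Context: Fix a prime $p$, an algebraic closure $k$ of $\mathbb{F}_p$, and $\Gamma=\mathrm{Gal}(k/\mathbb{F}_p)$. Modules are left modules. A category is finite if its morphism class is a finite set. A finite group is regarded as a category with one object. Twisted category algebras. For a commutative ring $R$ and a finite category $\mathcal{D}$, a 2-cocycle $\alpha\in Z^2(\mathcal{D};R^\times)$ assigns to each pair of morphisms $t,s$ with $t\circ s$ defined an element $\alpha(t,s)\in R^\times$ such that $\alpha(u,t\circ s)\alpha(t,s)=\alpha(u\circ t,s)\alpha(u,t)$ whenever $t\circ s$ and $u\circ t$ are defined. $R_\alpha\mathcal{D}$ is the free $R$-module on $\mathrm{Mor}(\mathcal{D})$ with bilinear multiplication $ts=\alpha(t,s)\,t\circ s$ if $t\circ s$ is defined and $ts=0$ otherwise. For an idempotent endomorphism $e$ of an object $X$ of $\mathcal{D}$, $G_e$ is the group of invertible elements of the monoid $e\circ\mathrm{End}_{\mathcal{D}}(X)\circ e$; restrictions of $\alpha$ are again denoted $\alpha$. Transporter and orbit categories. For a finite category $\mathcal{C}$, the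 objects of the $p$-transporter category $\mathcal{T}_{\mathcal{C}}$ are pairs $(X,P)$ with $X$ an object of $\mathcal{C}$ and $P$ a not necessarily unitary $p$-subgroup of the monoid $\mathrm{End}_{\mathcal{C}}(X)$ (a finite $p$-group under composition, whose unit $1_P$ may be any idempotent of $\mathrm{End}_{\mathcal{C}}(X)$). Morphisms $(X,P)\to(Y,Q)$ are triples $(s,P,Q)$ with $s\in\mathrm{Hom}_{\mathcal{C}}(X,Y)$, $s=s\circ 1_P=1_Q\circ s$ and $s\circ P\subseteq Q\circ s$; composition is induced from $\mathcal{C}$, and the identity of $(X,P)$ is $(1_P,P,P)$. The $p$-orbit category $\mathcal{O}_{\mathcal{C}}$ has the same objects, with $\mathrm{Hom}_{\mathcal{O}_{\mathcal{C}}}((X,P),(Y,Q))=Q\backslash\mathrm{Hom}_{\mathcal{T}_{\mathcal{C}}}((X,P),(Y,Q))/P$ and induced composition. A cocycle $\alpha\in Z^2(\mathcal{O}_{\mathcal{C}};\mathbb{F}_p^\times)$ restricts to $\mathcal{C}$ along the canonical functor $\mathcal{C}\to\mathcal{O}_{\mathcal{C}}$, $X\mapsto(X,\{\mathrm{Id}_X\})$, hence to each $G_e$, and restricts to $\mathcal{O}_{G_e}$ ($e\in\mathrm{End}_{\mathcal{C}}(X)$) along the functor $\mathcal{O}_{G_e}\to\mathcal{O}_{\mathcal{C}}$ sending a $p$-subgroup $P$ of $G_e$ to $(X,P)$. Weights. Idempotent endomorphisms $e\in\mathrm{End}_{\mathcal{D}}(X)$, $f\in\mathrm{End}_{\mathcal{D}}(Y)$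 are isomorphic if there are $s\in f\circ\mathrm{Hom}_{\mathcal{D}}(X,Y)\circ e$ and $t\in e\circ\mathrm{Hom}_{\mathcal{D}}(Y,X)\circ f$ with $t\circ s=e$, $s\circ t=f$. Then $x\mapsto\beta(x)(s\circ x\circ t)$, where $\beta(x)=\alpha(x,t)\alpha(s,x\circ t)\alpha(e,e)^{-1}\alpha(t,s)^{-1}$, induces an algebra isomorphism $\varphi:k_\alpha G_e\to k_\alpha G_f$, independent of $s,t$ up to inner automorphisms. Pairs $(e,T)$, $(f,T')$ with $T$ a $k_\alpha G_e$-module and $T'$ a $k_\alpha G_f$-module are isomorphic if $e,f$ are isomorphic and ${}_\varphi T\cong T'$, where ${}_\varphi T$ is $T$ with structure map precomposed with $\varphi^{-1}$. A weight of $k_\alpha\mathcal{D}$ is a pair $(e,T)$ with $e$ an idempotent endomorphism in $\mathcal{D}$ and $T$ a simple projective $k_\alpha G_e$-module. $\mathcal{W}(k_\alpha\mathcal{D})$ is the set of isomorphism classes of weights, and $\mathcal{S}(A)$ is the set of isomorphism classes of simple $A$-modules. Galois action. If $\alpha$ has values in $\mathbb{F}_p^\times$, then $k_\alpha\mathcal{D}=k\otimes_{\mathbb{F}_p}(\mathbb{F}_p)_\alpha\mathcal{D}$ and $\sigma\in\Gamma$ acts by $x\otimes a\mapsto\sigma(x)\otimes a$. For a module $U$, ${}^\sigma U$ is $U$ with structure map precomposed with $\sigma^{-1}$. This gives actions of $\Gamma$ on $\mathcal{S}(k_\alpha\mathcal{D})$ and, via ${}^\sigma(e,T)=(e,{}^\sigma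 T)$, on $\mathcal{W}(k_\alpha\mathcal{D})$. *)

theory Defs
  imports "HOL-Algebra.Algebraic_Closure_Type"
begin

section \<open>Small categories\<close>

record ('o, 'm) category =
  Obj :: "'o set"
  Mor :: "'m set"
  Dom :: "'m \<Rightarrow> 'o"
  Cod :: "'m \<Rightarrow> 'o"
  Ident :: "'o \<Rightarrow> 'm"
  Comp :: "'m \<Rightarrow> 'm \<Rightarrow> 'm"  \<comment> \<open>\<open>Comp C t s\<close> is "t after s"; irrelevant unless \<open>Dom C t = Cod C s\<close>\<close>

locale category =
  fixes C :: "('o, 'm) category"
  assumes Dom_closed: "s \<in> Mor C \<Longrightarrow> Dom C s \<in> Obj C"
    and Cod_closed: "s \<in> Mor C \<Longrightarrow> Cod C s \<in> Obj C"
    and Ident_Mor: "V \<in> Obj C \<Longrightarrow> Ident C V \<in> Mor C"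
    and Dom_Ident: "V \<in> Obj C \<Longrightarrow> Dom C (Ident C V) = V"
    and Cod_Ident: "V \<in> Obj C \<Longrightarrow> Cod C (Ident C V) = V"
    and Comp_Mor: "\<lbrakk>t \<in> Mor C; s \<in> Mor C; Dom C t = Cod C s\<rbrakk> \<Longrightarrow> Comp C t s \<in> Mor C"
    and Dom_Comp: "\<lbrakk>t \<in> Mor C; s \<in> Mor C; Dom C t = Cod C s\<rbrakk> \<Longrightarrow> Dom C (Comp C t s) = Dom C s"
    and Cod_Comp: "\<lbrakk>t \<in> Mor C; s \<in> Mor C; Dom C t = Cod C s\<rbrakk> \<Longrightarrow> Cod C (Comp C t s) = Cod C t"
    and Comp_Ident: "s \<in> Mor C \<Longrightarrow> Comp C s (Ident C (Dom C s)) = s"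
    and Ident_Comp: "s \<in> Mor C \<Longrightarrow> Comp C (Ident C (Cod C s)) s = s"
    and Comp_assoc: "\<lbrakk>u \<in> Mor C; t \<in> Mor C; s \<in> Mor C; Dom C u = Cod C t; Dom C t = Cod C s\<rbrakk>
      \<Longrightarrow> Comp C (Comp C u t) s = Comp C u (Comp C t s)"

definition finite_category :: "('o, 'm) category \<Rightarrow> bool" where
  "finite_category C \<longleftrightarrow> category C \<and> finite (Mor C)"

definition Hom :: "('o, 'm) category \<Rightarrow> 'o \<Rightarrow> 'o \<Rightarrow> 'm set" where
  "Hom C V W = {s \<in> Mor C. Dom C s = V \<and> Cod C s = W}"

definition idempotent_endo :: "('o, 'm) category \<Rightarrow> 'm \<Rightarrow> bool" where
  "idempotent_endo C e \<longleftrightarrow> e \<in> Hom C (Dom C e) (Dom C e) \<and> Comp C e e = e"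

definition comp_monoid :: "('o, 'm) category \<Rightarrow> 'm set \<Rightarrow> 'm \<Rightarrow> 'm monoid" where
  "comp_monoid C S u = \<lparr>carrier = S, monoid.mult = Comp C, one = u\<rparr>"

definition idem_group :: "('o, 'm) category \<Rightarrow> 'm \<Rightarrow> 'm set" where
  "idem_group C e =
     Units (comp_monoid C ((\<lambda>s. Comp C (Comp C e s) e) ` Hom C (Dom C e) (Dom C e)) e)"

text \<open>The group \<open>G_e\<close> as a category with one object. Taking the domain of \<open>e\<close> as that object
  makes its transporter and orbit categories literally contained in those of \<open>C\<close>:
  the functor \<open>P \<mapsto> (V, P)\<close> is an inclusion on objects and morphisms, and
  restricting a cocycle along it leaves the function unchanged.\<close>

definition idem_group_cat :: "('o, 'm) category \<Rightarrow> 'm \<Rightarrow> ('o, 'm) category" where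
  "idem_group_cat C e = C\<lparr>Obj := {Dom C e}, Mor := idem_group C e, Ident := (\<lambda>_. e)\<rparr>"


section \<open>Transporter and orbit categories\<close>

definition p_subgroup :: "nat \<Rightarrow> ('o, 'm) category \<Rightarrow> 'o \<Rightarrow> 'm set \<Rightarrow> bool" where
  "p_subgroup p C V P \<longleftrightarrow> P \<subseteq> Hom C V V \<and> (\<exists>u. group (comp_monoid C P u)) \<and> (\<exists>n. card P = p ^ n)"

definition unit_of :: "('o, 'm) category \<Rightarrow> 'm set \<Rightarrow> 'm" where
  "unit_of C P = (THE u. group (comp_monoid C P u))"

text \<open>The morphism \<open>(s, P, Q) : (V, P) \<rightarrow> (W, Q)\<close> is stored with its full source and target, as
  \<open>(s, (V, P), (W, Q))\<close>.\<close>

definition transporter_cat ::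
  "nat \<Rightarrow> ('o, 'm) category \<Rightarrow> ('o \<times> 'm set, 'm \<times> ('o \<times> 'm set) \<times> ('o \<times> 'm set)) category" where
  "transporter_cat p C =
    \<lparr>Obj = {(V, P). V \<in> Obj C \<and> p_subgroup p C V P},
     Mor = {(s, (V, P), (W, Q)). V \<in> Obj C \<and> p_subgroup p C V P \<and> W \<in> Obj C \<and> p_subgroup p C W Q \<and>
              s \<in> Hom C V W \<and> s = Comp C s (unit_of C P) \<and> s = Comp C (unit_of C Q) s \<and>
              (\<lambda>x. Comp C s x) ` P \<subseteq> (\<lambda>y. Comp C y s) ` Q},
     Dom = (\<lambda>(s, a, b). a),
     Cod = (\<lambda>(s, a, b). b),
     Ident = (\<lambda>(V, P). (unit_of C P, (V, P), (V, P))),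
     Comp = (\<lambda>(t, b', c) (s, a, b). (Comp C t s, a, c))\<rparr>"

text \<open>The orbit of \<open>s\<close> in the quotient of \<open>Hom((V, P), (W, Q))\<close> by the left action of \<open>Q\<close> and the
  right action of \<open>P\<close>.\<close>

definition orbit :: "('o, 'm) category \<Rightarrow> 'm set \<Rightarrow> 'm set \<Rightarrow> 'm \<Rightarrow> 'm set" where
  "orbit C P Q s = {Comp C (Comp C y s) x | x y. x \<in> P \<and> y \<in> Q}"

fun orbit_of :: "('o, 'm) category \<Rightarrow> 'm \<times> ('o \<times> 'm set) \<times> ('o \<times> 'm set)
    \<Rightarrow> 'm set \<times> ('o \<times> 'm set) \<times> ('o \<times> 'm set)" where
  "orbit_of C (s, (V, P), (W, Q)) = (orbit C P Q s, (V, P), (W, Q))"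

text \<open>The induced composition is the elementwise product of orbits, which is again an orbit
  (as for the multiplication of cosets in a factor group).\<close>

definition orbit_cat ::
  "nat \<Rightarrow> ('o, 'm) category \<Rightarrow> ('o \<times> 'm set, 'm set \<times> ('o \<times> 'm set) \<times> ('o \<times> 'm set)) category" where
  "orbit_cat p C =
    \<lparr>Obj = Obj (transporter_cat p C),
     Mor = orbit_of C ` Mor (transporter_cat p C),
     Dom = (\<lambda>(S, a, b). a),
     Cod = (\<lambda>(S, a, b). b),
     Ident = (\<lambda>a. orbit_of C (Ident (transporter_cat p C) a)),
     Comp = (\<lambda>(T, b', c) (S, a, b). ({Comp C t s | t s. t \<in> T \<and> s \<in> S}, a, c))\<rparr>"

text \<open>The canonical functor from \<open>C\<close> to its orbit category, on morphisms; the orbit of \<open>s\<close> under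
  two trivial groups of identities is \<open>{s}\<close>.\<close>

definition to_orbit ::
  "('o, 'm) category \<Rightarrow> 'm \<Rightarrow> 'm set \<times> ('o \<times> 'm set) \<times> ('o \<times> 'm set)" where
  "to_orbit C s = orbit_of C
     (s, (Dom C s, {Ident C (Dom C s)}), (Cod C s, {Ident C (Cod C s)}))"

definition restrict_cocycle :: "('m \<Rightarrow> 'n) \<Rightarrow> ('n \<Rightarrow> 'n \<Rightarrow> 'k) \<Rightarrow> 'm \<Rightarrow> 'm \<Rightarrow> 'k" where
  "restrict_cocycle F \<alpha> t s = \<alpha> (F t) (F s)"


section \<open>Twisted category algebras\<close>

text \<open>The 2-cocycles of \<open>D\<close> with values in a group \<open>H\<close> of units. Values on non-composable pairs
  are unconstrained and never used.\<close>

definition cocycles2 :: "('o, 'm) category \<Rightarrow> 'k::field set \<Rightarrow> ('m \<Rightarrow> 'm \<Rightarrow> 'k) set" where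
  "cocycles2 D H = {\<alpha>.
     (\<forall>t\<in>Mor D. \<forall>s\<in>Mor D. Dom D t = Cod D s \<longrightarrow> \<alpha> t s \<in> H) \<and>
     (\<forall>u\<in>Mor D. \<forall>t\<in>Mor D. \<forall>s\<in>Mor D. Dom D t = Cod D s \<longrightarrow> Dom D u = Cod D t \<longrightarrow>
        \<alpha> u (Comp D t s) * \<alpha> t s = \<alpha> (Comp D u t) s * \<alpha> u t)}"

text \<open>Elements are coefficient functions vanishing off \<open>Mor D\<close>. The unit element is
  the sum over all objects of \<open>\<alpha>(Id, Id)\<^sup>-\<^sup>1 Id\<close>, as \<open>\<alpha>\<close> is not assumed normalised.\<close>

definition twisted_algebra ::
  "('o, 'm) category \<Rightarrow> ('m \<Rightarrow> 'm \<Rightarrow> 'k::field) \<Rightarrow> ('m \<Rightarrow> 'k) ring" where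
  "twisted_algebra D \<alpha> =
    \<lparr>carrier = {a. \<forall>u. u \<notin> Mor D \<longrightarrow> a u = 0},
     monoid.mult = (\<lambda>a b u.
       \<Sum>(t, s) \<in> {(t, s). t \<in> Mor D \<and> s \<in> Mor D \<and> Dom D t = Cod D s \<and> Comp D t s = u}.
         \<alpha> t s * a t * b s),
     one = (\<lambda>u. if u \<in> Ident D ` Obj D then inverse (\<alpha> u u) else 0),
     ring.zero = (\<lambda>u. 0),
     add = (\<lambda>a b u. a u + b u)\<rparr>"

abbreviation idem_group_algebra ::
  "('o, 'm) category \<Rightarrow> ('m \<Rightarrow> 'm \<Rightarrow> 'k::field) \<Rightarrow> 'm \<Rightarrow> ('m \<Rightarrow> 'k) ring" where
  "idem_group_algebra D \<alpha> e \<equiv> twisted_algebra (idem_group_cat D e) \<alpha>"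


section \<open>Modules\<close>

text \<open>The locale \<^locale>\<open>module\<close> requires a commutative ring of scalars.\<close>

locale left_module = A?: ring A + M?: abelian_group M
    for A :: "('a, 'c) ring_scheme" (structure) and M :: "('a, 'v, 'd) module_scheme" (structure) +
  assumes smult_closed: "\<lbrakk>a \<in> carrier A; x \<in> carrier M\<rbrakk> \<Longrightarrow> a \<odot>\<^bsub>M\<^esub> x \<in> carrier M"
    and smult_l_distr: "\<lbrakk>a \<in> carrier A; b \<in> carrier A; x \<in> carrier M\<rbrakk> \<Longrightarrow>
      (a \<oplus>\<^bsub>A\<^esub> b) \<odot>\<^bsub>M\<^esub> x = a \<odot>\<^bsub>M\<^esub> x \<oplus>\<^bsub>M\<^esub> b \<odot>\<^bsub>M\<^esub> x"
    and smult_r_distr: "\<lbrakk>a \<in> carrier A; x \<in> carrier M; y \<in> carrier M\<rbrakk> \<Longrightarrow>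
      a \<odot>\<^bsub>M\<^esub> (x \<oplus>\<^bsub>M\<^esub> y) = a \<odot>\<^bsub>M\<^esub> x \<oplus>\<^bsub>M\<^esub> a \<odot>\<^bsub>M\<^esub> y"
    and smult_assoc: "\<lbrakk>a \<in> carrier A; b \<in> carrier A; x \<in> carrier M\<rbrakk> \<Longrightarrow>
      (a \<otimes>\<^bsub>A\<^esub> b) \<odot>\<^bsub>M\<^esub> x = a \<odot>\<^bsub>M\<^esub> (b \<odot>\<^bsub>M\<^esub> x)"
    and smult_one: "x \<in> carrier M \<Longrightarrow> \<one>\<^bsub>A\<^esub> \<odot>\<^bsub>M\<^esub> x = x"

definition mod_hom ::
  "('a, 'c) ring_scheme \<Rightarrow> ('a, 'v) module \<Rightarrow> ('a, 'w) module \<Rightarrow> ('v \<Rightarrow> 'w) set" where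
  "mod_hom A M N = {h \<in> hom (add_monoid M) (add_monoid N).
     \<forall>a\<in>carrier A. \<forall>x\<in>carrier M. h (a \<odot>\<^bsub>M\<^esub> x) = a \<odot>\<^bsub>N\<^esub> h x}"

definition mod_iso :: "('a, 'c) ring_scheme \<Rightarrow> ('a, 'v) module \<Rightarrow> ('a, 'w) module \<Rightarrow> bool" where
  "mod_iso A M N \<longleftrightarrow> (\<exists>h\<in>mod_hom A M N. bij_betw h (carrier M) (carrier N))"

definition simple_module :: "('a, 'c) ring_scheme \<Rightarrow> ('a, 'v) module \<Rightarrow> bool" where
  "simple_module A M \<longleftrightarrow> left_module A M \<and> carrier M \<noteq> {\<zero>\<^bsub>M\<^esub>} \<and>
     (\<forall>H. submodule H A M \<longrightarrow> H = {\<zero>\<^bsub>M\<^esub>} \<or> H = carrier M)"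

text \<open>HOL cannot quantify over types, so the lifting problems are those between modules carried by
  subsets of the same type as \<open>T\<close>. The type \<open>nat \<Rightarrow> 'k\<close> used below carries a copy of every finitely
  generated module over a finite-dimensional \<open>'k\<close>-algebra, and a finitely generated \<open>T\<close> is
  projective as soon as it has the lifting property with respect to finitely generated modules.\<close>

definition projective_module :: "('a, 'c) ring_scheme \<Rightarrow> ('a, 'v) module \<Rightarrow> bool" where
  "projective_module A T \<longleftrightarrow> left_module A T \<and>
     (\<forall>(M :: ('a, 'v) module) (N :: ('a, 'v) module) g h.
        left_module A M \<and> left_module A N \<and>
        g \<in> mod_hom A M N \<and> g ` carrier M = carrier N \<and> h \<in> mod_hom A T N \<longrightarrow>
        (\<exists>h'\<in>mod_hom A T M. \<forall>x\<in>carrier T. g (h' x) = h x))"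

definition pull_scalars :: "('b \<Rightarrow> 'a) \<Rightarrow> ('a, 'v) module \<Rightarrow> ('b, 'v) module" where
  "pull_scalars \<psi> M = \<lparr>carrier = carrier M, monoid.mult = monoid.mult M, one = one M,
     ring.zero = ring.zero M, add = add M, module.smult = (\<lambda>b x. \<psi> b \<odot>\<^bsub>M\<^esub> x)\<rparr>"

definition iso_classes :: "('x \<Rightarrow> 'x \<Rightarrow> bool) \<Rightarrow> 'x set \<Rightarrow> 'x set set" where
  "iso_classes R S = S // {(x, y). x \<in> S \<and> y \<in> S \<and> R x y}"

text \<open>Every simple module over a finite-dimensional \<open>'k\<close>-algebra is finite-dimensional, hence
  isomorphic to one carried by a subset of \<open>nat \<Rightarrow> 'k\<close>; nothing is assumed about how the module
  structure relates to the pointwise operations of that type.\<close>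

type_synonym ('m, 'k) tw_module = "('m \<Rightarrow> 'k, nat \<Rightarrow> 'k) module"

definition simple_classes :: "('m \<Rightarrow> 'k) ring \<Rightarrow> ('m, 'k) tw_module set set" where
  "simple_classes A = iso_classes (mod_iso A) {M. simple_module A M}"


section \<open>Weights\<close>

definition weights ::
  "('o, 'm) category \<Rightarrow> ('m \<Rightarrow> 'm \<Rightarrow> 'k::field) \<Rightarrow> ('m \<times> ('m, 'k) tw_module) set" where
  "weights D \<alpha> = {(e, T). idempotent_endo D e \<and>
     simple_module (idem_group_algebra D \<alpha> e) T \<and> projective_module (idem_group_algebra D \<alpha> e) T}"

definition idem_iso_via :: "('o, 'm) category \<Rightarrow> 'm \<Rightarrow> 'm \<Rightarrow> 'm \<Rightarrow> 'm \<Rightarrow> bool" where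
  "idem_iso_via D e f s t \<longleftrightarrow>
     s \<in> (\<lambda>x. Comp D (Comp D f x) e) ` Hom D (Dom D e) (Dom D f) \<and>
     t \<in> (\<lambda>x. Comp D (Comp D e x) f) ` Hom D (Dom D f) (Dom D e) \<and>
     Comp D t s = e \<and> Comp D s t = f"

definition transport_coeff ::
  "('o, 'm) category \<Rightarrow> ('m \<Rightarrow> 'm \<Rightarrow> 'k::field) \<Rightarrow> 'm \<Rightarrow> 'm \<Rightarrow> 'm \<Rightarrow> 'm \<Rightarrow> 'k" where
  "transport_coeff D \<alpha> e s t x =
     \<alpha> x t * \<alpha> s (Comp D x t) * inverse (\<alpha> e e) * inverse (\<alpha> t s)"

definition transport ::
  "('o, 'm) category \<Rightarrow> ('m \<Rightarrow> 'm \<Rightarrow> 'k::field) \<Rightarrow> 'm \<Rightarrow> 'm \<Rightarrow> 'm \<Rightarrow> ('m \<Rightarrow> 'k) \<Rightarrow> ('m \<Rightarrow> 'k)" where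
  "transport D \<alpha> e s t a = (\<lambda>y.
     \<Sum>x \<in> {x \<in> idem_group D e. Comp D (Comp D s x) t = y}. a x * transport_coeff D \<alpha> e s t x)"

definition weight_iso :: "('o, 'm) category \<Rightarrow> ('m \<Rightarrow> 'm \<Rightarrow> 'k::field) \<Rightarrow>
    'm \<times> ('m, 'k) tw_module \<Rightarrow> 'm \<times> ('m, 'k) tw_module \<Rightarrow> bool" where
  "weight_iso D \<alpha> = (\<lambda>(e, T) (f, T'). \<exists>s t. idem_iso_via D e f s t \<and>
     mod_iso (idem_group_algebra D \<alpha> f)
       (pull_scalars (inv_into (carrier (idem_group_algebra D \<alpha> e)) (transport D \<alpha> e s t)) T) T')"

definition weight_classes ::
  "('o, 'm) category \<Rightarrow> ('m \<Rightarrow> 'm \<Rightarrow> 'k::field) \<Rightarrow> ('m \<times> ('m, 'k) tw_module) set set" where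
  "weight_classes D \<alpha> = iso_classes (weight_iso D \<alpha>) (weights D \<alpha>)"


section \<open>Galois action\<close>

text \<open>The prime subfield when the characteristic is positive.\<close>

definition prime_field :: "'k::field set" where
  "prime_field = range (of_int :: int \<Rightarrow> 'k)"

definition galois_group :: "('k::field \<Rightarrow> 'k) set" where
  "galois_group = {\<sigma> \<in> ring_iso ring_of_type_algebra ring_of_type_algebra.
     \<forall>x\<in>prime_field. \<sigma> x = x}"

definition galois_module :: "('k \<Rightarrow> 'k) \<Rightarrow> ('m, 'k) tw_module \<Rightarrow> ('m, 'k) tw_module" where
  "galois_module \<sigma> = pull_scalars (\<lambda>a. inv_into UNIV \<sigma> \<circ> a)"

text \<open>Conjugation by \<open>\<sigma>\<close> is invertible and preserves isomorphism, so the image of a class is exactly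
  the class of the conjugate of any representative.\<close>

definition galois_simple ::
  "('k \<Rightarrow> 'k) \<Rightarrow> ('m, 'k) tw_module set \<Rightarrow> ('m, 'k) tw_module set" where
  "galois_simple \<sigma> c = galois_module \<sigma> ` c"

definition galois_weight ::
  "('k \<Rightarrow> 'k) \<Rightarrow> ('m \<times> ('m, 'k) tw_module) set \<Rightarrow> ('m \<times> ('m, 'k) tw_module) set" where
  "galois_weight \<sigma> c = (\<lambda>(e, T). (e, galois_module \<sigma> T)) ` c"

definition equivariant_bijection ::
  "'g set \<Rightarrow> ('g \<Rightarrow> 'x \<Rightarrow> 'x) \<Rightarrow> ('g \<Rightarrow> 'y \<Rightarrow> 'y) \<Rightarrow> 'x set \<Rightarrow> 'y set \<Rightarrow> ('x \<Rightarrow> 'y) \<Rightarrow> bool" where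
  "equivariant_bijection G act act' V W F \<longleftrightarrow>
     bij_betw F V W \<and> (\<forall>\<sigma>\<in>G. \<forall>x\<in>V. F (act \<sigma> x) = act' \<sigma> (F x))"

end

theory Submission
  imports Defs
begin

text \<open>
  A simple module \<open>M\<close> over the twisted category algebra has an apex: an idempotent \<open>e\<close>, unique up to
  isomorphism, that acts nontrivially on \<open>M\<close> while all nonunits of the monoid \<open>e \<circ> End \<circ> e\<close> annihilate \<open>M\<close>.
  Then \<open>M \<mapsto> eM\<close> is a bijection from the simple modules with apex \<open>e\<close> to the simple modules of the twisted
  group algebra of \<open>G\<^sub>e\<close>. It commutes with the Galois action because the idempotent of the algebra that
  belongs to \<open>e\<close> has coefficients in the prime field.
  On the side of weights, every idempotent of the orbit category is isomorphic to the identity of a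
  \<open>p\<close>-subgroup of some \<open>G\<^sub>e\<close>, where \<open>e\<close> is unique up to isomorphism, and all isomorphisms between such
  identities already lie in the orbit category of \<open>G\<^sub>e\<close>. So the weights of the orbit category are the
  disjoint union of the weights of the orbit categories of the groups \<open>G\<^sub>e\<close>, over representatives \<open>e\<close> of the
  isomorphism classes of idempotents, and the given bijections can be glued.
\<close>

text \<open>No compatibility is assumed between the bijections given at isomorphic idempotents, so
  one idempotent is fixed in each isomorphism class and only its bijection is used. The twisted
  group algebra of G_e is not the corner of the category algebra at \<open>e\<close> but its
  quotient by the span of the nonunits. That span is an ideal since in a finite monoid a product is
  a unit only if both factors are, and the apex condition says that it annihilates the module. A
  simple \<open>M\<close> is determined by e M because the annihilator of a vector of e M can be
  computed inside e M. In the other direction \<open>M\<close> is built as a cyclic quotient of the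
  category algebra, realised on chosen coset representatives so that it lives on the type
  \<open>nat \<Rightarrow> 'k\<close>. The cocycle is not normalised: the idempotent of the algebra
  is \<alpha>(e, e)^-1 e. For the weights, a morphism between identities of
  \<open>p\<close>-subgroups of G_e that is invertible in the orbit category is represented by a
  unit at \<open>e\<close>. Hence the groups, algebras and isomorphisms coincide literally in both
  orbit categories.\<close>

section \<open>Finite semigroups and monoids\<close>

lemma finite_semigroup_idempotent:
  assumes "finite S" "S \<noteq> {}"
    and "\<And>x y. x \<in> S \<Longrightarrow> y \<in> S \<Longrightarrow> f x y \<in> S"
    and "\<And>x y z. x \<in> S \<Longrightarrow> y \<in> S \<Longrightarrow> z \<in> S \<Longrightarrow> f (f x y) z = f x (f y z)"
  shows "\<exists>x\<in>S. f x x = x"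
  using assms
proof (induction S rule: finite_psubset_induct)
  case (psubset S)
  then obtain x where x: "x \<in> S" by blast
  have *: "\<exists>z\<in>S. f z z = z" if "T \<subset> S" "T \<noteq> {}" "\<And>x y. x \<in> T \<Longrightarrow> y \<in> T \<Longrightarrow> f x y \<in> T" for T
  proof -
    have "\<exists>z\<in>T. f z z = z"
      using that psubset.prems(3) by (intro psubset.IH) (auto simp: psubset_eq subset_iff)
    then show ?thesis using that(1) by blast
  qed
  \<comment> \<open>If the right ideal \<open>?A\<close> is proper, the induction hypothesis applies
    to it. Otherwise \<open>x\<close> lies in \<open>?A\<close>, so \<open>?B\<close> is a nonempty
    subsemigroup. If \<open>?B\<close> is everything too, then it contains \<open>x\<close>, which
    is therefore idempotent.\<close>
  let ?A = "f x ` S" and ?B = "{y \<in> S. f x y = x}"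
  have A: "?A \<subseteq> S" using x psubset.prems(2) by blast
  have A_closed: "f a b \<in> ?A" if "a \<in> ?A" "b \<in> ?A" for a b
  proof -
    obtain c where c: "c \<in> S" "a = f x c" using \<open>a \<in> ?A\<close> by blast
    have "b \<in> S" using A that(2) by blast
    then have "f a b = f x (f c b)" "f c b \<in> S" using c x psubset.prems(2,3) by auto
    then show ?thesis by blast
  qed
  show ?case
  proof (cases "?A = S")
    case False
    then show ?thesis using * [of ?A] A A_closed x by blast
  next
    case True
    then have B: "?B \<noteq> {}" using x by (metis (mono_tags, lifting) empty_iff imageE mem_Collect_eq)
    have B_closed: "f a b \<in> ?B" if "a \<in> ?B" "b \<in> ?B" for a b
    proof -
      have "f x (f a b) = f (f x a) b" using that x psubset.prems(3) by force
      then show ?thesis using that psubset.prems(2) by simp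
    qed
    show ?thesis
    proof (cases "?B = S")
      case False
      then show ?thesis using * [of ?B] B B_closed by blast
    next
      case True
      then show ?thesis using x by blast
    qed
  qed
qed

text \<open>Since a b = e, left multiplication by \<open>b\<close> is injective, hence surjective by
  finiteness. So \<open>b\<close> has a right inverse \<open>c\<close>, and a = a (b c) = (a b) c =
  c.\<close>

lemma finite_monoid_left_inverse:
  assumes "finite S" and closed: "\<And>x y. x \<in> S \<Longrightarrow> y \<in> S \<Longrightarrow> f x y \<in> S"
    and assoc: "\<And>x y z. x \<in> S \<Longrightarrow> y \<in> S \<Longrightarrow> z \<in> S \<Longrightarrow> f (f x y) z = f x (f y z)"
    and unit: "e \<in> S" "\<And>x. x \<in> S \<Longrightarrow> f e x = x" "\<And>x. x \<in> S \<Longrightarrow> f x e = x"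
    and ab: "a \<in> S" "b \<in> S" "f a b = e"
  shows "f b a = e"
proof -
  have "inj_on (f b) S"
    by (rule inj_onI) (metis ab assoc unit(2))
  then have "f b ` S = S"
    using assms(1) ab closed by (meson endo_inj_surj image_subset_iff)
  then obtain c where c: "c \<in> S" "f b c = e" using unit by (metis imageE)
  then have "a = c" using ab assoc unit by metis
  then show ?thesis using c by simp
qed


section \<open>Idempotents in finite categories\<close>

text \<open>The monoid underlying \<open>idem_group\<close>, described by absorption of
  \<open>e\<close> instead of as an image: in this form membership supplies rewrite rules.\<close>

definition corner_monoid :: "('o, 'm) category \<Rightarrow> 'm \<Rightarrow> 'm set" where
  "corner_monoid C e = {x \<in> Mor C. Dom C x = Dom C e \<and> Cod C x = Dom C e \<and> Comp C e x = x \<and> Comp C x e = x}"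

definition idem_iso :: "('o, 'm) category \<Rightarrow> 'm \<Rightarrow> 'm \<Rightarrow> bool" where
  "idem_iso C e f \<longleftrightarrow> (\<exists>s t. idem_iso_via C e f s t)"

context category
begin

lemmas comp_simps [simp] = Comp_Mor Dom_Comp Cod_Comp Dom_closed Cod_closed Ident_Mor Dom_Ident Cod_Ident
  Comp_Ident Ident_Comp

lemma idempotent_endoD [simp]:
  assumes "idempotent_endo C e"
  shows "e \<in> Mor C" "Cod C e = Dom C e" "Comp C e e = e"
  using assms by (auto simp: idempotent_endo_def Hom_def)

lemma idempotent_endoI:
  "e \<in> Mor C \<Longrightarrow> Cod C e = Dom C e \<Longrightarrow> Comp C e e = e \<Longrightarrow> idempotent_endo C e"
  unfolding idempotent_endo_def Hom_def by blast

lemma idempotent_absorb [simp]: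
  assumes "idempotent_endo C e" "x \<in> Mor C"
  shows "Cod C x = Dom C e \<Longrightarrow> Comp C e (Comp C e x) = Comp C e x"
    and "Dom C x = Dom C e \<Longrightarrow> Comp C (Comp C x e) e = Comp C x e"
  using assms by (metis Comp_assoc idempotent_endoD)+

lemma corner_image:
  assumes "idempotent_endo C e" "idempotent_endo C f"
  shows "(\<lambda>x. Comp C (Comp C f x) e) ` Hom C (Dom C e) (Dom C f) =
    {x \<in> Mor C. Dom C x = Dom C e \<and> Cod C x = Dom C f \<and> Comp C f x = x \<and> Comp C x e = x}"
    (is "?L = ?R")
proof
  show "?L \<subseteq> ?R"
  proof
    fix y assume "y \<in> ?L"
    then obtain x where x: "x \<in> Mor C" "Dom C x = Dom C e" "Cod C x = Dom C f"
      and y: "y = Comp C (Comp C f x) e"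
      by (auto simp: Hom_def)
    have "y = Comp C f (Comp C x e)" using x y assms by (simp add: Comp_assoc)
    then have "Comp C f y = y" using x assms by simp
    moreover have "Comp C y e = y" using x y assms by simp
    ultimately show "y \<in> ?R" using x y assms by simp
  qed
  show "?R \<subseteq> ?L"
    by (auto simp: Hom_def image_iff) metis
qed

lemma idem_iso_via_iff:
  assumes "idempotent_endo C e" "idempotent_endo C f"
  shows "idem_iso_via C e f s t \<longleftrightarrow>
    s \<in> Mor C \<and> Dom C s = Dom C e \<and> Cod C s = Dom C f \<and> Comp C f s = s \<and> Comp C s e = s \<and>
    t \<in> Mor C \<and> Dom C t = Dom C f \<and> Cod C t = Dom C e \<and> Comp C e t = t \<and> Comp C t f = t \<and>
    Comp C t s = e \<and> Comp C s t = f"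
  unfolding idem_iso_via_def corner_image[OF assms] corner_image[OF assms(2,1)] by auto

lemma corner_monoid_eq:
  assumes "idempotent_endo C e"
  shows "(\<lambda>s. Comp C (Comp C e s) e) ` Hom C (Dom C e) (Dom C e) = corner_monoid C e"
  unfolding corner_image[OF assms assms] corner_monoid_def ..

lemma idem_group_iff:
  assumes "idempotent_endo C e"
  shows "x \<in> idem_group C e \<longleftrightarrow>
    x \<in> corner_monoid C e \<and> (\<exists>y\<in>corner_monoid C e. Comp C x y = e \<and> Comp C y x = e)"
  unfolding idem_group_def corner_monoid_eq[OF assms] Units_def comp_monoid_def by auto

lemma corner_monoidD:
  assumes "x \<in> corner_monoid C e"
  shows "x \<in> Mor C" "Dom C x = Dom C e" "Cod C x = Dom C e" "Comp C e x = x" "Comp C x e = x"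
  using assms by (auto simp: corner_monoid_def)

lemma corner_monoid_unit [simp]: "idempotent_endo C e \<Longrightarrow> e \<in> corner_monoid C e"
  by (simp add: corner_monoid_def)

lemma corner_monoid_Comp [simp]:
  assumes "idempotent_endo C e" "x \<in> corner_monoid C e" "y \<in> corner_monoid C e"
  shows "Comp C x y \<in> corner_monoid C e"
proof -
  have "Comp C e (Comp C x y) = Comp C (Comp C e x) y"
    using assms by (intro Comp_assoc[symmetric]) (auto simp: corner_monoid_def)
  moreover have "Comp C (Comp C x y) e = Comp C x (Comp C y e)"
    using assms by (intro Comp_assoc) (auto simp: corner_monoid_def)
  ultimately show ?thesis
    using assms by (simp add: corner_monoid_def)
qed

lemma corner_monoid_assoc:
  assumes "x \<in> corner_monoid C e" "y \<in> corner_monoid C e" "z \<in> corner_monoid C e"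
  shows "Comp C (Comp C x y) z = Comp C x (Comp C y z)"
  using assms by (simp add: Comp_assoc corner_monoid_def)

lemma idem_group_corner: "idempotent_endo C e \<Longrightarrow> x \<in> idem_group C e \<Longrightarrow> x \<in> corner_monoid C e"
  by (simp add: idem_group_iff)

lemma idem_group_unit [simp]: "idempotent_endo C e \<Longrightarrow> e \<in> idem_group C e"
  by (auto simp: idem_group_iff intro!: bexI[of _ e])

lemma idem_group_Comp [simp]:
  assumes e: "idempotent_endo C e" and x: "x \<in> idem_group C e" and y: "y \<in> idem_group C e"
  shows "Comp C x y \<in> idem_group C e"
proof -
  interpret monoid "comp_monoid C (corner_monoid C e) e"
    by unfold_locales
      (use e in \<open>auto simp: comp_monoid_def corner_monoid_assoc corner_monoidD\<close>)
  have "idem_group C e = Units (comp_monoid C (corner_monoid C e) e)"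
    unfolding idem_group_def corner_monoid_eq[OF e] ..
  then show ?thesis
    using Units_m_closed[of x y] x y by (simp add: comp_monoid_def)
qed

lemma idem_group_inverse:
  assumes "idempotent_endo C e" "x \<in> idem_group C e"
  obtains y where "y \<in> idem_group C e" "Comp C x y = e" "Comp C y x = e"
  using assms idem_group_iff by metis

lemma idem_group_idempotent:
  assumes e: "idempotent_endo C e" and x: "x \<in> idem_group C e" "Comp C x x = x"
  shows "x = e"
proof -
  obtain y where y: "y \<in> corner_monoid C e" "Comp C x y = e"
    using x idem_group_iff[OF e] by blast
  have c: "x \<in> corner_monoid C e" using x idem_group_corner[OF e] by blast
  show ?thesis using corner_monoid_assoc[OF c c y(1)] y c x by (simp add: corner_monoidD)
qed

text \<open>The two hypotheses on products provide a right and a left inverse of \<open>x\<close>,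
  which must coincide. No finiteness enters, so this serves in arbitrary categories.\<close>

lemma idem_groupI:
  assumes e: "idempotent_endo C e" and x: "x \<in> corner_monoid C e"
    and y: "y \<in> corner_monoid C e" "Comp C x y \<in> idem_group C e"
    and z: "z \<in> corner_monoid C e" "Comp C z x \<in> idem_group C e"
  shows "x \<in> idem_group C e"
proof -
  obtain a where a: "a \<in> corner_monoid C e" "Comp C (Comp C x y) a = e"
    using y(2) idem_group_iff[OF e] by blast
  obtain b where b: "b \<in> corner_monoid C e" "Comp C b (Comp C z x) = e"
    using z(2) idem_group_iff[OF e] by blast
  have r: "Comp C x (Comp C y a) = e" using a corner_monoid_assoc[OF x y(1) a(1)] by simp
  have l: "Comp C (Comp C b z) x = e" using b corner_monoid_assoc[OF b(1) z(1) x] by simp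
  have m: "Comp C y a \<in> corner_monoid C e" "Comp C b z \<in> corner_monoid C e"
    using a b y z e by auto
  have "Comp C b z = Comp C y a"
    using l r m corner_monoid_assoc[OF m(2) x m(1)] by (simp add: corner_monoidD)
  then show ?thesis using idem_group_iff[OF e] l r m x by metis
qed

lemma idem_iso_via_refl: "idempotent_endo C e \<Longrightarrow> idem_iso_via C e e e e"
  by (simp add: idem_iso_via_iff)

lemma idem_iso_via_sym:
  "idempotent_endo C e \<Longrightarrow> idempotent_endo C f \<Longrightarrow> idem_iso_via C e f s t \<Longrightarrow> idem_iso_via C f e t s"
  by (simp add: idem_iso_via_iff)

lemma Comp_cancel_mid:
  assumes "a \<in> Mor C" "b \<in> Mor C" "c \<in> Mor C" "d \<in> Mor C"
    "Dom C a = Cod C b" "Dom C b = Cod C c" "Dom C c = Cod C d"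
  shows "Comp C (Comp C a b) (Comp C c d) = Comp C a (Comp C (Comp C b c) d)"
  using assms by (simp add: Comp_assoc)

lemma idem_iso_via_trans:
  assumes id: "idempotent_endo C e" "idempotent_endo C f" "idempotent_endo C g"
    and "idem_iso_via C e f s t" "idem_iso_via C f g s' t'"
  shows "idem_iso_via C e g (Comp C s' s) (Comp C t t')"
proof -
  note 1 = assms(4)[unfolded idem_iso_via_iff[OF id(1,2)]]
  note 2 = assms(5)[unfolded idem_iso_via_iff[OF id(2,3)]]
  have "Comp C g (Comp C s' s) = Comp C s' s" "Comp C e (Comp C t t') = Comp C t t'"
    using 1 2 id Comp_assoc[of g s' s] Comp_assoc[of e t t'] by auto
  moreover have "Comp C (Comp C s' s) e = Comp C s' s" "Comp C (Comp C t t') g = Comp C t t'"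
    using 1 2 id by (auto simp add: Comp_assoc)
  moreover have "Comp C (Comp C t t') (Comp C s' s) = e" "Comp C (Comp C s' s) (Comp C t t') = g"
    using 1 2 id by (auto simp add: Comp_cancel_mid)
  ultimately show ?thesis
    unfolding idem_iso_via_iff[OF id(1,3)] using 1 2 by simp
qed

lemma idem_iso_refl: "idempotent_endo C e \<Longrightarrow> idem_iso C e e"
  unfolding idem_iso_def using idem_iso_via_refl by blast

lemma idem_iso_sym:
  "idempotent_endo C e \<Longrightarrow> idempotent_endo C f \<Longrightarrow> idem_iso C e f \<Longrightarrow> idem_iso C f e"
  unfolding idem_iso_def using idem_iso_via_sym by blast

lemma idem_iso_trans:
  "idempotent_endo C e \<Longrightarrow> idempotent_endo C f \<Longrightarrow> idempotent_endo C g \<Longrightarrow>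
    idem_iso C e f \<Longrightarrow> idem_iso C f g \<Longrightarrow> idem_iso C e g"
  unfolding idem_iso_def using idem_iso_via_trans by blast

text \<open>Correcting \<open>t\<close> and \<open>t'\<close> by inverses of the units gives a left
  and a right inverse of \<open>s\<close>, which then agree. Two different morphisms back are
  allowed because \<open>apex_unique\<close> finds them by independent choices.\<close>

lemma idem_iso_of_units:
  assumes e: "idempotent_endo C e" and f: "idempotent_endo C f"
    and s: "s \<in> Mor C" "Dom C s = Dom C e" "Cod C s = Dom C f" "Comp C f s = s" "Comp C s e = s"
    and t: "t \<in> Mor C" "Dom C t = Dom C f" "Cod C t = Dom C e" "Comp C e t = t" "Comp C t f = t"
    and t': "t' \<in> Mor C" "Dom C t' = Dom C f" "Cod C t' = Dom C e" "Comp C e t' = t'" "Comp C t' f = t'"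
    and ts: "Comp C t s \<in> idem_group C e" and st: "Comp C s t' \<in> idem_group C f"
  shows "idem_iso C e f"
proof -
  obtain x where x: "x \<in> idem_group C e" "Comp C x (Comp C t s) = e"
    using idem_group_inverse[OF e ts] by metis
  obtain y where y: "y \<in> idem_group C f" "Comp C (Comp C s t') y = f"
    using idem_group_inverse[OF f st] by metis
  note xr = corner_monoidD[OF idem_group_corner[OF e x(1)]]
    and yr = corner_monoidD[OF idem_group_corner[OF f y(1)]]
  let ?l = "Comp C x t" and ?r = "Comp C t' y"
  have l: "Comp C ?l s = e" and r: "Comp C s ?r = f"
    using x(2) y(2) xr yr s t t' by (simp_all add: Comp_assoc)
  have lf: "Comp C ?l f = ?l" and er: "Comp C e ?r = ?r" and el: "Comp C e ?l = ?l"
    using xr yr s t t' e f Comp_assoc[of x t f] Comp_assoc[of e t' y] Comp_assoc[of e x t] by simp_all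
  have "Comp C ?l (Comp C s ?r) = Comp C (Comp C ?l s) ?r"
    using xr yr s t t' by (intro Comp_assoc[symmetric]) simp_all
  then have "?l = ?r" using l r lf er by simp
  then have "idem_iso_via C e f s ?l"
    unfolding idem_iso_via_iff[OF e f] using s t t' xr yr l r lf el by simp
  then show ?thesis unfolding idem_iso_def by blast
qed

lemma idempotent_endo_Ident [simp]: "V \<in> Obj C \<Longrightarrow> idempotent_endo C (Ident C V)"
  using Comp_Ident[of "Ident C V"] by (intro idempotent_endoI) auto

text \<open>\<open>Comp_assoc\<close> nests composites to the right, where an absorbed idempotent is
  followed by a tail \<open>u\<close>. These rules, like \<open>iso_assoc\<close> below, are the
  absorption and cancellation laws in that normal form.\<close>

lemma corner_assoc:
  assumes e: "idempotent_endo C e" and x: "x \<in> corner_monoid C e" and u: "u \<in> Mor C"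
  shows "Cod C u = Dom C e \<Longrightarrow> Comp C e (Comp C x u) = Comp C x u"
    and "Cod C u = Dom C e \<Longrightarrow> Comp C x (Comp C e u) = Comp C x u"
  using e u corner_monoidD[OF x] by (simp_all flip: Comp_assoc)

context
  fixes e f s t
  assumes e: "idempotent_endo C e" and f: "idempotent_endo C f" and st: "idem_iso_via C e f s t"
begin

lemma iso_rules:
  "s \<in> Mor C" "Dom C s = Dom C e" "Cod C s = Dom C f" "Comp C f s = s" "Comp C s e = s"
  "t \<in> Mor C" "Dom C t = Dom C f" "Cod C t = Dom C e" "Comp C e t = t" "Comp C t f = t"
  "Comp C t s = e" "Comp C s t = f"
  using st[unfolded idem_iso_via_iff[OF e f]] by blast+

lemma iso_assoc:
  assumes "u \<in> Mor C"
  shows "Cod C u = Dom C e \<Longrightarrow> Comp C f (Comp C s u) = Comp C s u"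
    and "Cod C u = Dom C e \<Longrightarrow> Comp C s (Comp C e u) = Comp C s u"
    and "Cod C u = Dom C e \<Longrightarrow> Comp C t (Comp C s u) = Comp C e u"
    and "Cod C u = Dom C f \<Longrightarrow> Comp C e (Comp C t u) = Comp C t u"
    and "Cod C u = Dom C f \<Longrightarrow> Comp C t (Comp C f u) = Comp C t u"
    and "Cod C u = Dom C f \<Longrightarrow> Comp C s (Comp C t u) = Comp C f u"
  using assms e f by (simp_all add: iso_rules flip: Comp_assoc)

lemma conj_corner:
  assumes x: "x \<in> corner_monoid C e"
  shows "Comp C (Comp C s x) t \<in> corner_monoid C f"
    and "Comp C (Comp C t (Comp C (Comp C s x) t)) s = x"
  using e f corner_monoidD[OF x]
  by (simp_all add: corner_monoid_def Comp_assoc iso_rules iso_assoc corner_assoc[OF e x])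

lemma conj_mult:
  assumes x: "x \<in> corner_monoid C e" and y: "y \<in> corner_monoid C e"
  shows "Comp C (Comp C (Comp C s x) t) (Comp C (Comp C s y) t) = Comp C (Comp C s (Comp C x y)) t"
  using e f corner_monoidD[OF x] corner_monoidD[OF y]
  by (simp add: Comp_assoc iso_rules iso_assoc corner_assoc[OF e x] corner_assoc[OF e y])

lemma conj_unit: "Comp C (Comp C s e) t = f"
  by (simp add: iso_rules)

lemma conj_idem_group:
  assumes x: "x \<in> idem_group C e"
  shows "Comp C (Comp C s x) t \<in> idem_group C f"
proof -
  obtain y where y: "y \<in> corner_monoid C e" "Comp C x y = e" "Comp C y x = e"
    using x idem_group_iff[OF e] by blast
  have x': "x \<in> corner_monoid C e" using idem_group_corner[OF e x] .
  show ?thesis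
    unfolding idem_group_iff[OF f]
    using conj_corner(1)[OF x'] conj_corner(1)[OF y(1)] conj_mult[OF x' y(1)] conj_mult[OF y(1) x'] y(2,3)
      conj_unit by auto
qed

end

lemma category_idem_group_cat:
  assumes e: "idempotent_endo C e"
  shows "category (idem_group_cat C e)"
proof -
  obtain V where V: "Dom C e = V" by blast
  have "x \<in> Mor C" "Dom C x = V" "Cod C x = V" "Comp C e x = x" "Comp C x e = x"
    if "x \<in> idem_group C e" for x
    using idem_group_corner[OF e that] V by (simp_all add: corner_monoid_def)
  then show ?thesis
    using idem_group_unit[OF e] idem_group_Comp[OF e]
    by unfold_locales (simp_all add: idem_group_cat_def V Comp_assoc)
qed

end

lemma idem_group_cat_simps [simp]:
  "Mor (idem_group_cat C e) = idem_group C e" "Obj (idem_group_cat C e) = {Dom C e}"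
  "Dom (idem_group_cat C e) = Dom C" "Cod (idem_group_cat C e) = Cod C"
  "Comp (idem_group_cat C e) = Comp C" "Ident (idem_group_cat C e) = (\<lambda>_. e)"
  by (simp_all add: idem_group_cat_def)

lemma category_idem_group_subset:
  assumes "category C" "idempotent_endo C e"
  shows "idem_group C e \<subseteq> Mor C"
  using category.idem_group_corner[OF assms] category.corner_monoidD[OF assms(1)] by blast

locale fin_category = category +
  assumes finite_Mor: "finite (Mor C)"
begin

lemma fin_category_idem_group_cat:
  assumes "idempotent_endo C e"
  shows "fin_category (idem_group_cat C e)"
  using category_idem_group_cat[OF assms] category_idem_group_subset[OF category_axioms assms] finite_Mor
  by (auto simp: fin_category_def fin_category_axioms_def intro: finite_subset)

lemma finite_corner_monoid: "finite (corner_monoid C e)"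
  using finite_Mor by (simp add: corner_monoid_def)

lemma idem_group_of_factor:
  assumes e: "idempotent_endo C e" and x: "x \<in> corner_monoid C e"
    and y: "y \<in> corner_monoid C e" "Comp C x y = e \<or> Comp C y x = e"
  shows "x \<in> idem_group C e"
proof -
  have "Comp C b a = e"
    if "a \<in> corner_monoid C e" "b \<in> corner_monoid C e" "Comp C a b = e" for a b
    using finite_corner_monoid corner_monoid_Comp[OF e] corner_monoid_assoc corner_monoid_unit[OF e]
      corner_monoidD(4,5) that
    by (rule finite_monoid_left_inverse[of "corner_monoid C e"])
  then show ?thesis using assms idem_group_iff[OF e] by metis
qed

text \<open>In other words the nonunits of the corner monoid form a two-sided ideal. This makes the
  projection of the corner algebra onto the group algebra multiplicative.\<close>

lemma idem_group_of_product:
  assumes e: "idempotent_endo C e" and x: "x \<in> corner_monoid C e"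
    and y: "y \<in> corner_monoid C e" and xy: "Comp C x y \<in> idem_group C e"
  shows "x \<in> idem_group C e" "y \<in> idem_group C e"
proof -
  obtain z where z: "z \<in> corner_monoid C e" "Comp C (Comp C x y) z = e" "Comp C z (Comp C x y) = e"
    using xy idem_group_iff[OF e] by blast
  have "Comp C x (Comp C y z) = e" "Comp C (Comp C z x) y = e"
    using z corner_monoid_assoc[OF x y z(1)] corner_monoid_assoc[OF z(1) x y] by simp_all
  then show "x \<in> idem_group C e" "y \<in> idem_group C e"
    using idem_group_of_factor[OF e x, of "Comp C y z"] idem_group_of_factor[OF e y, of "Comp C z x"]
      corner_monoid_Comp[OF e] x y z(1) by blast+
qed

end

section \<open>Modules over noncommutative rings\<close>

lemma (in left_module) smult_r_null [simp]: "a \<in> carrier A \<Longrightarrow> a \<odot>\<^bsub>M\<^esub> \<zero>\<^bsub>M\<^esub> = \<zero>\<^bsub>M\<^esub>"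
  using smult_r_distr[of a "\<zero>\<^bsub>M\<^esub>" "\<zero>\<^bsub>M\<^esub>"] smult_closed[of a "\<zero>\<^bsub>M\<^esub>"]
  by (metis M.add.l_cancel_one M.l_zero M.zero_closed)

lemma (in left_module) smult_l_null [simp]: "x \<in> carrier M \<Longrightarrow> \<zero>\<^bsub>A\<^esub> \<odot>\<^bsub>M\<^esub> x = \<zero>\<^bsub>M\<^esub>"
  using smult_l_distr[of "\<zero>\<^bsub>A\<^esub>" "\<zero>\<^bsub>A\<^esub>" x] smult_closed[of "\<zero>\<^bsub>A\<^esub>" x]
  by (metis A.l_zero A.zero_closed M.add.l_cancel_one)

lemma (in left_module) smult_l_minus:
  assumes "a \<in> carrier A" "x \<in> carrier M"
  shows "(\<ominus>\<^bsub>A\<^esub> a) \<odot>\<^bsub>M\<^esub> x = \<ominus>\<^bsub>M\<^esub> (a \<odot>\<^bsub>M\<^esub> x)"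
  using assms smult_l_distr[of "\<ominus>\<^bsub>A\<^esub> a" a x]
  by (metis A.a_inv_closed A.l_neg M.minus_equality smult_closed smult_l_null)

lemma (in left_module) smult_eq_iff:
  assumes "a \<in> carrier A" "b \<in> carrier A" "x \<in> carrier M"
  shows "a \<odot>\<^bsub>M\<^esub> x = b \<odot>\<^bsub>M\<^esub> x \<longleftrightarrow> (a \<ominus>\<^bsub>A\<^esub> b) \<odot>\<^bsub>M\<^esub> x = \<zero>\<^bsub>M\<^esub>"
proof -
  let ?y = "a \<odot>\<^bsub>M\<^esub> x" and ?z = "b \<odot>\<^bsub>M\<^esub> x"
  have c: "?y \<in> carrier M" "?z \<in> carrier M" using assms smult_closed by auto
  have "(a \<ominus>\<^bsub>A\<^esub> b) \<odot>\<^bsub>M\<^esub> x = ?y \<oplus>\<^bsub>M\<^esub> \<ominus>\<^bsub>M\<^esub> ?z"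
    using assms by (simp add: a_minus_def smult_l_distr smult_l_minus)
  moreover have "?y = ?z \<longleftrightarrow> ?y \<oplus>\<^bsub>M\<^esub> \<ominus>\<^bsub>M\<^esub> ?z = \<zero>\<^bsub>M\<^esub>"
    using c M.r_neg[of ?z] M.minus_equality[of ?y "\<ominus>\<^bsub>M\<^esub> ?z"] M.minus_minus[of ?z] by auto
  ultimately show ?thesis by simp
qed

text \<open>The submodule to test is A v, which contains \<open>v\<close> because the unit of the
  ring acts as the identity. Afterwards simplicity is used only in this form, as transitivity on
  nonzero vectors.\<close>

lemma simple_module_iff:
  "simple_module A M \<longleftrightarrow> left_module A M \<and> carrier M \<noteq> {\<zero>\<^bsub>M\<^esub>} \<and>
     (\<forall>v\<in>carrier M. v \<noteq> \<zero>\<^bsub>M\<^esub> \<longrightarrow> (\<forall>w\<in>carrier M. \<exists>a\<in>carrier A. a \<odot>\<^bsub>M\<^esub> v = w))"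
    (is "?L \<longleftrightarrow> ?R")
proof
  assume L: ?L
  then interpret m: left_module A M by (simp add: simple_module_def)
  have "\<exists>a\<in>carrier A. a \<odot>\<^bsub>M\<^esub> v = w" if v: "v \<in> carrier M" "v \<noteq> \<zero>\<^bsub>M\<^esub>" and w: "w \<in> carrier M" for v w
  proof -
    let ?H = "(\<lambda>a. a \<odot>\<^bsub>M\<^esub> v) ` carrier A"
    have "submodule ?H A M"
    proof
      show "?H \<subseteq> carrier (add_monoid M)" using v m.smult_closed by auto
      show "x \<otimes>\<^bsub>add_monoid M\<^esub> y \<in> ?H" if "x \<in> ?H" "y \<in> ?H" for x y
        using that v by (auto simp: image_iff) (metis m.A.a_closed m.smult_l_distr)
      show "\<one>\<^bsub>add_monoid M\<^esub> \<in> ?H"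
        using v by (auto simp: image_iff intro!: bexI[of _ "\<zero>\<^bsub>A\<^esub>"])
      show "inv\<^bsub>add_monoid M\<^esub> x \<in> ?H" if "x \<in> ?H" for x
        using that v by (auto simp: image_iff simp flip: a_inv_def) (metis m.A.a_inv_closed m.smult_l_minus)
      show "a \<odot>\<^bsub>M\<^esub> x \<in> ?H" if "a \<in> carrier A" "x \<in> ?H" for a x
        using that v by (auto simp: image_iff) (metis m.A.m_closed m.smult_assoc)
    qed
    moreover have "v \<in> ?H"
      using v m.smult_one by (auto simp: image_iff intro!: bexI[of _ "\<one>\<^bsub>A\<^esub>"])
    ultimately have "?H = carrier M"
      using L v unfolding simple_module_def by blast
    then have "w \<in> ?H" using w by simp
    then show ?thesis by blast
  qed
  then show ?R using L unfolding simple_module_def by blast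
next
  assume R: ?R
  then have gen: "\<forall>v\<in>carrier M. v \<noteq> \<zero>\<^bsub>M\<^esub> \<longrightarrow> (\<forall>w\<in>carrier M. \<exists>a\<in>carrier A. a \<odot>\<^bsub>M\<^esub> v = w)"
    by (elim conjE)
  have "H = {\<zero>\<^bsub>M\<^esub>} \<or> H = carrier M" if H: "submodule H A M" for H
  proof (cases "H \<subseteq> {\<zero>\<^bsub>M\<^esub>}")
    case True
    then show ?thesis using H subgroup.one_closed[of H "add_monoid M"] by (auto simp: submodule_def)
  next
    case False
    then obtain v where v: "v \<in> H" "v \<noteq> \<zero>\<^bsub>M\<^esub>" by blast
    have sub: "H \<subseteq> carrier M"
      using H subgroup.subset[of H "add_monoid M"] by (auto simp: submodule_def)
    have "w \<in> H" if w: "w \<in> carrier M" for w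
    proof -
      obtain a where "a \<in> carrier A" "a \<odot>\<^bsub>M\<^esub> v = w"
        using gen v sub w by blast
      then show ?thesis using submodule.smult_closed[OF H _ v(1)] by blast
    qed
    then show ?thesis using sub by blast
  qed
  then show ?L using R unfolding simple_module_def by blast
qed

lemma simple_moduleD:
  assumes "simple_module A M"
  shows "left_module A M"
    and "\<exists>v\<in>carrier M. v \<noteq> \<zero>\<^bsub>M\<^esub>"
    and "v \<in> carrier M \<Longrightarrow> v \<noteq> \<zero>\<^bsub>M\<^esub> \<Longrightarrow> w \<in> carrier M \<Longrightarrow> \<exists>a\<in>carrier A. a \<odot>\<^bsub>M\<^esub> v = w"
proof -
  show l: "left_module A M" using assms by (simp add: simple_module_iff)
  interpret left_module A M by (rule l)
  show "\<exists>v\<in>carrier M. v \<noteq> \<zero>\<^bsub>M\<^esub>"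
    using assms M.zero_closed unfolding simple_module_iff by blast
qed (use assms in \<open>simp add: simple_module_iff\<close>)

lemma mod_homI:
  assumes "\<And>x. x \<in> carrier M \<Longrightarrow> h x \<in> carrier N"
    and "\<And>x y. x \<in> carrier M \<Longrightarrow> y \<in> carrier M \<Longrightarrow> h (x \<oplus>\<^bsub>M\<^esub> y) = h x \<oplus>\<^bsub>N\<^esub> h y"
    and "\<And>a x. a \<in> carrier A \<Longrightarrow> x \<in> carrier M \<Longrightarrow> h (a \<odot>\<^bsub>M\<^esub> x) = a \<odot>\<^bsub>N\<^esub> h x"
  shows "h \<in> mod_hom A M N"
  using assms by (auto simp: mod_hom_def hom_def)

lemma mod_homD:
  assumes "h \<in> mod_hom A M N"
  shows "x \<in> carrier M \<Longrightarrow> h x \<in> carrier N"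
    and "x \<in> carrier M \<Longrightarrow> y \<in> carrier M \<Longrightarrow> h (x \<oplus>\<^bsub>M\<^esub> y) = h x \<oplus>\<^bsub>N\<^esub> h y"
    and "a \<in> carrier A \<Longrightarrow> x \<in> carrier M \<Longrightarrow> h (a \<odot>\<^bsub>M\<^esub> x) = a \<odot>\<^bsub>N\<^esub> h x"
  using assms by (auto simp: mod_hom_def hom_def)

lemma mod_hom_zero:
  assumes "h \<in> mod_hom A M N" "left_module A M" "left_module A N"
  shows "h \<zero>\<^bsub>M\<^esub> = \<zero>\<^bsub>N\<^esub>"
proof -
  interpret m: left_module A M by (rule assms)
  interpret n: left_module A N by (rule assms)
  show ?thesis
    using mod_homD(3)[OF assms(1), of "\<zero>\<^bsub>A\<^esub>" "\<zero>\<^bsub>M\<^esub>"] mod_homD(1)[OF assms(1), of "\<zero>\<^bsub>M\<^esub>"] by simp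
qed

lemma mod_iso_refl: "mod_iso A M M"
  unfolding mod_iso_def by (rule bexI[of _ id]) (auto intro: mod_homI)

lemma mod_iso_sym:
  assumes M: "left_module A M" and iso: "mod_iso A M N"
  shows "mod_iso A N M"
proof -
  interpret m: left_module A M by (rule M)
  obtain h where h: "h \<in> mod_hom A M N" and b: "bij_betw h (carrier M) (carrier N)"
    using iso unfolding mod_iso_def by blast
  let ?g = "inv_into (carrier M) h"
  have gh: "?g (h x) = x" if "x \<in> carrier M" for x
    using b that by (simp add: bij_betw_inv_into_left)
  have ex: "\<exists>x\<in>carrier M. y = h x" if "y \<in> carrier N" for y
    using b that unfolding bij_betw_def by blast
  have "?g \<in> mod_hom A N M"
  proof (rule mod_homI)
    show "?g x \<in> carrier M" if "x \<in> carrier N" for x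
      using ex[OF that] gh by auto
    show "?g (x \<oplus>\<^bsub>N\<^esub> y) = ?g x \<oplus>\<^bsub>M\<^esub> ?g y" if "x \<in> carrier N" "y \<in> carrier N" for x y
      using ex[OF that(1)] ex[OF that(2)] by (auto simp: gh simp flip: mod_homD(2)[OF h])
    show "?g (a \<odot>\<^bsub>N\<^esub> x) = a \<odot>\<^bsub>M\<^esub> ?g x" if "a \<in> carrier A" "x \<in> carrier N" for a x
      using ex[OF that(2)] that by (auto simp: gh m.smult_closed simp flip: mod_homD(3)[OF h])
  qed
  then show ?thesis
    unfolding mod_iso_def using b bij_betw_inv_into by blast
qed

lemma mod_iso_trans:
  assumes "mod_iso A M N" "mod_iso A N P"
  shows "mod_iso A M P"
proof -
  obtain h where h: "h \<in> mod_hom A M N" "bij_betw h (carrier M) (carrier N)"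
    using assms(1) unfolding mod_iso_def by blast
  obtain g where g: "g \<in> mod_hom A N P" "bij_betw g (carrier N) (carrier P)"
    using assms(2) unfolding mod_iso_def by blast
  have "g \<circ> h \<in> mod_hom A M P"
    by (rule mod_homI) (simp_all add: mod_homD[OF h(1)] mod_homD[OF g(1)])
  then show ?thesis
    unfolding mod_iso_def using bij_betw_trans[OF h(2) g(2)] by blast
qed

text \<open>Both modules are cyclic, generated by \<open>v\<close> and \<open>w\<close>. Equal
  annihilators make the assignment a v \<mapsto> a w well defined and injective; it is surjective
  because \<open>w\<close> generates.\<close>

lemma simple_module_iso_if_same_annihilator:
  assumes M: "simple_module A M" and N: "simple_module A N"
    and v: "v \<in> carrier M" "v \<noteq> \<zero>\<^bsub>M\<^esub>" and w: "w \<in> carrier N" "w \<noteq> \<zero>\<^bsub>N\<^esub>"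
    and ann: "\<And>a. a \<in> carrier A \<Longrightarrow> a \<odot>\<^bsub>M\<^esub> v = \<zero>\<^bsub>M\<^esub> \<longleftrightarrow> a \<odot>\<^bsub>N\<^esub> w = \<zero>\<^bsub>N\<^esub>"
  shows "mod_iso A M N"
proof -
  interpret m: left_module A M by (rule simple_moduleD(1)[OF M])
  interpret n: left_module A N by (rule simple_moduleD(1)[OF N])
  have eq: "a \<odot>\<^bsub>M\<^esub> v = b \<odot>\<^bsub>M\<^esub> v \<longleftrightarrow> a \<odot>\<^bsub>N\<^esub> w = b \<odot>\<^bsub>N\<^esub> w" if "a \<in> carrier A" "b \<in> carrier A" for a b
    using that v w ann[of "a \<ominus>\<^bsub>A\<^esub> b"] by (simp add: m.smult_eq_iff n.smult_eq_iff)
  define h where "h x = (SOME a. a \<in> carrier A \<and> a \<odot>\<^bsub>M\<^esub> v = x) \<odot>\<^bsub>N\<^esub> w" for x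
  have h: "h (a \<odot>\<^bsub>M\<^esub> v) = a \<odot>\<^bsub>N\<^esub> w" if "a \<in> carrier A" for a
    unfolding h_def by (rule someI2[of _ a]) (use that eq in auto)
  have gen: "\<exists>a\<in>carrier A. x = a \<odot>\<^bsub>M\<^esub> v" if "x \<in> carrier M" for x
    using simple_moduleD(3)[OF M v that] by metis
  have "h \<in> mod_hom A M N"
  proof (rule mod_homI)
    show "h x \<in> carrier N" if "x \<in> carrier M" for x
      using gen[OF that] by (auto simp: h w n.smult_closed)
    show "h (x \<oplus>\<^bsub>M\<^esub> y) = h x \<oplus>\<^bsub>N\<^esub> h y" if "x \<in> carrier M" "y \<in> carrier M" for x y
      using gen[OF that(1)] gen[OF that(2)]
      by (auto simp: h w v n.smult_l_distr simp flip: m.smult_l_distr)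
    show "h (c \<odot>\<^bsub>M\<^esub> x) = c \<odot>\<^bsub>N\<^esub> h x" if "c \<in> carrier A" "x \<in> carrier M" for c x
      using gen[OF that(2)] that by (auto simp: h w v n.smult_assoc[symmetric] simp flip: m.smult_assoc)
  qed
  moreover have "bij_betw h (carrier M) (carrier N)"
  proof (rule bij_betw_imageI)
    show "inj_on h (carrier M)"
      by (rule inj_onI) (use gen h eq in metis)
    show "h ` carrier M = carrier N"
    proof
      show "h ` carrier M \<subseteq> carrier N"
        using gen h n.smult_closed w by fastforce
      show "carrier N \<subseteq> h ` carrier M"
      proof
        fix y assume "y \<in> carrier N"
        then obtain a where a: "a \<in> carrier A" "a \<odot>\<^bsub>N\<^esub> w = y"
          using simple_moduleD(3)[OF N w] by blast
        then have "y = h (a \<odot>\<^bsub>M\<^esub> v)" by (simp add: h)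
        then show "y \<in> h ` carrier M" using a v m.smult_closed by blast
      qed
    qed
  qed
  ultimately show ?thesis unfolding mod_iso_def by blast
qed

text \<open>\<open>M\<close> is the quotient of the regular module by \<open>L\<close>, and \<open>r\<close> is the projection. Choosing
  representatives puts it on any type into which the ring embeds.\<close>

lemma (in ring) cyclic_module_exists:
  fixes enc :: "'a \<Rightarrow> 'v"
  assumes enc: "inj_on enc (carrier R)" and L: "L \<subseteq> carrier R" "\<zero> \<in> L"
    and L_add: "\<And>x y. x \<in> L \<Longrightarrow> y \<in> L \<Longrightarrow> x \<oplus> y \<in> L"
    and L_mult: "\<And>a x. a \<in> carrier R \<Longrightarrow> x \<in> L \<Longrightarrow> a \<otimes> x \<in> L"
  shows "\<exists>(M :: ('a, 'v) module) r. left_module R M \<and> carrier M = r ` carrier R \<and>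
    (\<forall>a\<in>carrier R. r a = \<zero>\<^bsub>M\<^esub> \<longleftrightarrow> a \<in> L) \<and>
    (\<forall>a\<in>carrier R. \<forall>b\<in>carrier R. r a \<oplus>\<^bsub>M\<^esub> r b = r (a \<oplus> b)) \<and>
    (\<forall>a\<in>carrier R. \<forall>b\<in>carrier R. a \<odot>\<^bsub>M\<^esub> r b = r (a \<otimes> b))"
proof -
  have L_minus: "\<ominus> x \<in> L" if "x \<in> L" for x
    using L_mult[of "\<ominus> \<one>" x] that L(1) l_minus[of \<one> x] by auto
  define E where "E a = {b \<in> carrier R. a \<ominus> b \<in> L}" for a
  have E_eq: "E a = E b \<longleftrightarrow> a \<ominus> b \<in> L" if ab: "a \<in> carrier R" "b \<in> carrier R" for a b
  proof
    assume "E a = E b"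
    moreover have "b \<in> E b" using ab L by (simp add: E_def a_minus_def r_neg)
    ultimately show "a \<ominus> b \<in> L" by (auto simp: E_def)
  next
    assume *: "a \<ominus> b \<in> L"
    have "a \<ominus> c = (a \<ominus> b) \<oplus> (b \<ominus> c)" "b \<ominus> c = \<ominus> (a \<ominus> b) \<oplus> (a \<ominus> c)" if "c \<in> carrier R" for c
      using ab that by algebra+
    then show "E a = E b"
      using * L_add L_minus unfolding E_def by (metis (no_types, lifting))
  qed
  \<comment> \<open>\<open>E a\<close> is the coset of \<open>a\<close>. A coset is a set of ring
    elements, so it is replaced by the code of one chosen member; injectivity of \<open>enc\<close>
    ensures that different cosets get different codes.\<close>
  define r where "r a = enc (SOME b. b \<in> E a)" for a
  have some: "(SOME b. b \<in> E a) \<in> E a" if "a \<in> carrier R" for a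
    by (rule someI[of _ a]) (use that L in \<open>simp add: E_def a_minus_def r_neg\<close>)
  have r_eq: "r a = r b \<longleftrightarrow> a \<ominus> b \<in> L" if ab: "a \<in> carrier R" "b \<in> carrier R" for a b
  proof
    assume "r a = r b"
    then have "(SOME x. x \<in> E a) = (SOME x. x \<in> E b)"
      using some[OF ab(1)] some[OF ab(2)] inj_onD[OF enc] unfolding r_def E_def by blast
    then obtain c where c: "c \<in> E a" "c \<in> E b" using some[OF ab(1)] some[OF ab(2)] by metis
    then have "E a = E c" "E b = E c" using E_eq ab by (auto simp: E_def)
    then show "a \<ominus> b \<in> L" using E_eq ab by blast
  next
    assume "a \<ominus> b \<in> L"
    then show "r a = r b" using E_eq[OF ab] unfolding r_def by simp
  qed
  \<comment> \<open>\<open>g\<close> decodes to some ring element in the right coset. It need not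
    return the element that was encoded, but the two differ by an element of \<open>L\<close>, which
    the operations on \<open>M\<close> do not see.\<close>
  define g where "g x = inv_into (carrier R) r x" for x
  have g: "g (r a) \<in> carrier R" "g (r a) \<ominus> a \<in> L" if "a \<in> carrier R" for a
  proof -
    have *: "r a \<in> r ` carrier R" using that by blast
    show "g (r a) \<in> carrier R" unfolding g_def by (rule inv_into_into[OF *])
    then show "g (r a) \<ominus> a \<in> L"
      using f_inv_into_f[OF *] that by (simp add: g_def r_eq[symmetric])
  qed
  define M :: "('a, 'v) module" where
    "M = \<lparr>carrier = r ` carrier R, monoid.mult = (\<lambda>x y. r \<zero>), one = r \<zero>, ring.zero = r \<zero>,
       add = (\<lambda>x y. r (g x \<oplus> g y)), module.smult = (\<lambda>a x. r (a \<otimes> g x))\<rparr>"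
  have M_carrier: "carrier M = r ` carrier R" and M_zero: "\<zero>\<^bsub>M\<^esub> = r \<zero>"
    by (simp_all add: M_def)
  have M_add: "r a \<oplus>\<^bsub>M\<^esub> r b = r (a \<oplus> b)" if ab: "a \<in> carrier R" "b \<in> carrier R" for a b
  proof -
    have "(g (r a) \<oplus> g (r b)) \<ominus> (a \<oplus> b) = (g (r a) \<ominus> a) \<oplus> (g (r b) \<ominus> b)"
      using ab g(1) by algebra
    then show ?thesis
      using ab g L_add by (simp add: M_def r_eq)
  qed
  have M_smult: "a \<odot>\<^bsub>M\<^esub> r b = r (a \<otimes> b)" if ab: "a \<in> carrier R" "b \<in> carrier R" for a b
  proof -
    have "(a \<otimes> g (r b)) \<ominus> (a \<otimes> b) = a \<otimes> (g (r b) \<ominus> b)"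
      using ab g(1) by algebra
    then show ?thesis
      using ab g L_mult by (simp add: M_def r_eq)
  qed
  have "abelian_group M"
  proof (rule abelian_groupI)
    show "\<exists>y\<in>carrier M. y \<oplus>\<^bsub>M\<^esub> x = \<zero>\<^bsub>M\<^esub>" if x: "x \<in> carrier M" for x
    proof -
      obtain a where "a \<in> carrier R" "x = r a" using x M_carrier by blast
      then have "r (\<ominus> a) \<oplus>\<^bsub>M\<^esub> x = \<zero>\<^bsub>M\<^esub>" "r (\<ominus> a) \<in> carrier M"
        by (simp_all add: M_add M_zero M_carrier l_neg)
      then show ?thesis by blast
    qed
  qed (auto simp: M_carrier M_add M_zero a_assoc, auto simp: a_comm)
  then have "left_module R M"
    unfolding left_module_def left_module_axioms_def using ring_axioms
    by (auto simp: M_carrier M_add M_smult l_distr r_distr m_assoc)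
  moreover have "\<forall>a\<in>carrier R. r a = \<zero>\<^bsub>M\<^esub> \<longleftrightarrow> a \<in> L"
    using r_eq[of _ \<zero>] by (simp add: M_zero a_minus_def)
  ultimately show ?thesis using M_carrier M_add M_smult by blast
qed

section \<open>Change of scalars\<close>

lemma pull_scalars_simps [simp]:
  "carrier (pull_scalars \<psi> M) = carrier M" "add (pull_scalars \<psi> M) = add M"
  "ring.zero (pull_scalars \<psi> M) = ring.zero M"
  "module.smult (pull_scalars \<psi> M) = (\<lambda>b x. \<psi> b \<odot>\<^bsub>M\<^esub> x)"
  by (simp_all add: pull_scalars_def)

lemma pull_scalars_pull_scalars: "pull_scalars \<psi> (pull_scalars \<chi> M) = pull_scalars (\<chi> \<circ> \<psi>) M"
  by (simp add: pull_scalars_def)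

lemma pull_scalars_id: "pull_scalars (\<lambda>a. a) M = M"
  by (simp add: pull_scalars_def)

lemma pull_scalars_cong:
  assumes "\<And>b. b \<in> carrier B \<Longrightarrow> \<psi> b = \<chi> b"
  shows "mod_iso B (pull_scalars \<psi> M) (pull_scalars \<chi> M)"
  unfolding mod_iso_def by (rule bexI[of _ id]) (auto intro!: mod_homI simp: assms)

lemma mod_iso_pull_scalars:
  assumes "mod_iso A M N" "\<And>b. b \<in> carrier B \<Longrightarrow> \<psi> b \<in> carrier A"
  shows "mod_iso B (pull_scalars \<psi> M) (pull_scalars \<psi> N)"
proof -
  obtain h where h: "h \<in> mod_hom A M N" "bij_betw h (carrier M) (carrier N)"
    using assms(1) unfolding mod_iso_def by blast
  have "h \<in> mod_hom B (pull_scalars \<psi> M) (pull_scalars \<psi> N)"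
    by (rule mod_homI) (simp_all add: mod_homD[OF h(1)] assms(2))
  then show ?thesis using h(2) unfolding mod_iso_def by auto
qed

lemma ring_isoD:
  assumes "\<psi> \<in> ring_iso B A"
  shows "b \<in> carrier B \<Longrightarrow> \<psi> b \<in> carrier A"
    and "b \<in> carrier B \<Longrightarrow> c \<in> carrier B \<Longrightarrow> \<psi> (b \<oplus>\<^bsub>B\<^esub> c) = \<psi> b \<oplus>\<^bsub>A\<^esub> \<psi> c"
    and "b \<in> carrier B \<Longrightarrow> c \<in> carrier B \<Longrightarrow> \<psi> (b \<otimes>\<^bsub>B\<^esub> c) = \<psi> b \<otimes>\<^bsub>A\<^esub> \<psi> c"
    and "\<psi> \<one>\<^bsub>B\<^esub> = \<one>\<^bsub>A\<^esub>" and "bij_betw \<psi> (carrier B) (carrier A)"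
  using assms by (auto simp: ring_iso_def ring_hom_def)

lemma left_module_pull_scalars:
  assumes "ring B" "\<psi> \<in> ring_iso B A" "left_module A M"
  shows "left_module B (pull_scalars \<psi> M)"
proof -
  interpret m: left_module A M by (rule assms)
  have "abelian_group (pull_scalars \<psi> M)"
    by (rule abelian_groupI)
      (auto simp: m.M.add.m_ac intro: m.M.l_neg bexI[of _ "\<ominus>\<^bsub>M\<^esub> _"])
  then show ?thesis
    unfolding left_module_def left_module_axioms_def using assms(1)
    by (auto simp: ring_isoD[OF assms(2)] m.smult_closed m.smult_l_distr m.smult_r_distr m.smult_assoc
        m.smult_one)
qed

lemma simple_module_pull_scalars:
  assumes "ring B" "\<psi> \<in> ring_iso B A" "simple_module A M"
  shows "simple_module B (pull_scalars \<psi> M)"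
proof -
  have eq: "\<psi> ` carrier B = carrier A"
    using ring_isoD(5)[OF assms(2)] by (simp add: bij_betw_def)
  have "(\<exists>b\<in>carrier B. \<psi> b \<odot>\<^bsub>M\<^esub> v = w) \<longleftrightarrow> (\<exists>a\<in>carrier A. a \<odot>\<^bsub>M\<^esub> v = w)" for v w
    unfolding eq[symmetric] by simp
  then show ?thesis
    using assms(3) left_module_pull_scalars[OF assms(1,2), of M] unfolding simple_module_iff by simp
qed

text \<open>Restriction along the inverse of \<open>\<psi>\<close> turns a lifting problem over
  \<open>B\<close> into one over \<open>A\<close> with the same carriers and maps. So a solution
  over \<open>A\<close> solves the original problem, and the test modules stay on the same
  type.\<close>

lemma projective_module_pull_scalars:
  fixes A :: "('a, 'e) ring_scheme" and B :: "('b, 'f) ring_scheme" and T :: "('a, 'v) module"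
  assumes A: "ring A" and B: "ring B" and iso: "\<psi> \<in> ring_iso B A" and T: "projective_module A T"
  shows "projective_module B (pull_scalars \<psi> T)"
proof -
  define \<chi> where "\<chi> = inv_into (carrier B) \<psi>"
  have \<chi>: "\<chi> \<in> ring_iso A B"
    unfolding \<chi>_def by (rule ring_iso_set_sym[OF B iso])
  have \<chi>\<psi>: "\<chi> (\<psi> b) = b" if "b \<in> carrier B" for b
    using ring_isoD(5)[OF iso] that by (simp add: \<chi>_def bij_betw_inv_into_left)
  have \<psi>\<chi>: "\<psi> (\<chi> a) = a" if "a \<in> carrier A" for a
    using ring_isoD(5)[OF iso] that by (simp add: \<chi>_def bij_betw_inv_into_right)
  have "\<exists>h'\<in>mod_hom B (pull_scalars \<psi> T) M. \<forall>x\<in>carrier (pull_scalars \<psi> T). g (h' x) = h x"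
    if M: "left_module B M" and N: "left_module B N" and g: "g \<in> mod_hom B M N"
      and surj: "g ` carrier M = carrier N" and h: "h \<in> mod_hom B (pull_scalars \<psi> T) N"
    for M N :: "('b, 'v) module" and g h
  proof -
    have "g \<in> mod_hom A (pull_scalars \<chi> M) (pull_scalars \<chi> N)"
      by (rule mod_homI) (simp_all add: mod_homD[OF g] ring_isoD(1)[OF \<chi>])
    moreover have "h \<in> mod_hom A T (pull_scalars \<chi> N)"
    proof (rule mod_homI)
      show "h (a \<odot>\<^bsub>T\<^esub> x) = a \<odot>\<^bsub>pull_scalars \<chi> N\<^esub> h x" if "a \<in> carrier A" "x \<in> carrier T" for a x
        using mod_homD(3)[OF h, of "\<chi> a" x] that by (simp add: \<psi>\<chi> ring_isoD(1)[OF \<chi>])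
    qed (use mod_homD(1,2)[OF h] in auto)
    ultimately obtain h' where h': "h' \<in> mod_hom A T (pull_scalars \<chi> M)" "\<forall>x\<in>carrier T. g (h' x) = h x"
      using T left_module_pull_scalars[OF A \<chi> M] left_module_pull_scalars[OF A \<chi> N] surj
      unfolding projective_module_def pull_scalars_simps by (metis pull_scalars_simps(1))
    have "h' \<in> mod_hom B (pull_scalars \<psi> T) M"
    proof (rule mod_homI)
      show "h' (b \<odot>\<^bsub>pull_scalars \<psi> T\<^esub> x) = b \<odot>\<^bsub>M\<^esub> h' x"
        if "b \<in> carrier B" "x \<in> carrier (pull_scalars \<psi> T)" for b x
        using mod_homD(3)[OF h'(1), of "\<psi> b" x] that by (simp add: \<chi>\<psi> ring_isoD(1)[OF iso])
    qed (use mod_homD(1,2)[OF h'(1)] in auto)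
    then show ?thesis using h'(2) by auto
  qed
  then show ?thesis
    using left_module_pull_scalars[OF B iso, of T] T unfolding projective_module_def by blast
qed


section \<open>Equivariant bijections between sets of isomorphism classes\<close>

abbreviation rel_on :: "('x \<Rightarrow> 'x \<Rightarrow> bool) \<Rightarrow> 'x set \<Rightarrow> ('x \<times> 'x) set" where
  "rel_on R V \<equiv> {(x, y). x \<in> V \<and> y \<in> V \<and> R x y}"

text \<open>\<open>G\<close> is a bare set without group laws. Each member only has to be undone by
  another one, which is what makes the image of an isomorphism class a full class again.\<close>

definition acts_by_isos :: "'g set \<Rightarrow> ('g \<Rightarrow> 'x \<Rightarrow> 'x) \<Rightarrow> ('x \<Rightarrow> 'x \<Rightarrow> bool) \<Rightarrow> 'x set \<Rightarrow> bool" where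
  "acts_by_isos G act R V \<longleftrightarrow> (\<forall>\<sigma>\<in>G. \<exists>\<tau>\<in>G. (\<forall>x\<in>V. act \<sigma> x \<in> V \<and> act \<tau> (act \<sigma> x) = x \<and> act \<sigma> (act \<tau> x) = x) \<and>
     (\<forall>x\<in>V. \<forall>y\<in>V. R x y \<longrightarrow> R (act \<sigma> x) (act \<sigma> y)))"

lemma equiv_rel_onI:
  assumes "\<And>x. x \<in> V \<Longrightarrow> R x x"
    and "\<And>x y. x \<in> V \<Longrightarrow> y \<in> V \<Longrightarrow> R x y \<Longrightarrow> R y x"
    and "\<And>x y z. x \<in> V \<Longrightarrow> y \<in> V \<Longrightarrow> z \<in> V \<Longrightarrow> R x y \<Longrightarrow> R y z \<Longrightarrow> R x z"
  shows "equiv V (rel_on R V)"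
  using assms by (intro equivI refl_onI symI transI) blast+

text \<open>An object \<open>y\<close> isomorphic to the conjugate of \<open>x\<close> is itself the
  conjugate of \<open>act \<tau> y\<close>, and \<open>act \<tau> y\<close> is isomorphic to
  \<open>x\<close>. This gives the inclusion that is not immediate.\<close>

lemma acts_by_isos_class:
  assumes V: "equiv V (rel_on R V)" and act: "acts_by_isos G act R V" and "\<sigma> \<in> G" "x \<in> V"
  shows "act \<sigma> ` (rel_on R V `` {x}) = rel_on R V `` {act \<sigma> x}"
proof -
  obtain \<tau> where \<tau>: "\<tau> \<in> G" "\<forall>x\<in>V. act \<sigma> x \<in> V \<and> act \<tau> (act \<sigma> x) = x \<and> act \<sigma> (act \<tau> x) = x"
    "\<forall>x\<in>V. \<forall>y\<in>V. R x y \<longrightarrow> R (act \<sigma> x) (act \<sigma> y)"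
    using act \<open>\<sigma> \<in> G\<close> unfolding acts_by_isos_def by blast
  have \<tau>': "act \<tau> y \<in> V \<and> (\<forall>z\<in>V. R y z \<longrightarrow> R (act \<tau> y) (act \<tau> z))" if "y \<in> V" for y
    using act \<tau>(1) that unfolding acts_by_isos_def by blast
  show ?thesis
  proof
    show "act \<sigma> ` (rel_on R V `` {x}) \<subseteq> rel_on R V `` {act \<sigma> x}"
      using \<tau> by blast
    show "rel_on R V `` {act \<sigma> x} \<subseteq> act \<sigma> ` (rel_on R V `` {x})"
    proof
      fix y assume "y \<in> rel_on R V `` {act \<sigma> x}"
      then have y: "y \<in> V" "R (act \<sigma> x) y" by auto
      then have "R x (act \<tau> y)" using \<tau>' \<tau>(2) \<open>x \<in> V\<close> by metis
      then have "act \<tau> y \<in> rel_on R V `` {x}" using \<tau>' y(1) \<open>x \<in> V\<close> by blast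
      moreover have "y = act \<sigma> (act \<tau> y)" using \<tau>(2) y(1) by simp
      ultimately show "y \<in> act \<sigma> ` (rel_on R V `` {x})" by blast
    qed
  qed
qed

lemma acts_by_isos_iso_classes:
  assumes V: "equiv V (rel_on R V)" and act: "acts_by_isos G act R V" and \<sigma>: "\<sigma> \<in> G" and c: "c \<in> iso_classes R V"
  shows "act \<sigma> ` c \<in> iso_classes R V"
proof -
  obtain x where x: "x \<in> V" "c = rel_on R V `` {x}" using c unfolding iso_classes_def by (auto elim: quotientE)
  have "act \<sigma> x \<in> V" using act \<sigma> x(1) unfolding acts_by_isos_def by blast
  then show ?thesis
    unfolding x(2) acts_by_isos_class[OF V act \<sigma> x(1)] iso_classes_def by (rule quotientI)
qed

lemma acts_by_isos_subset:
  assumes act: "acts_by_isos G act R V" and U: "U \<subseteq> V" "\<And>\<sigma> x. \<sigma> \<in> G \<Longrightarrow> x \<in> U \<Longrightarrow> act \<sigma> x \<in> U"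
  shows "acts_by_isos G act R U"
  unfolding acts_by_isos_def
proof
  fix \<sigma> assume \<sigma>: "\<sigma> \<in> G"
  then obtain \<tau> where \<tau>: "\<tau> \<in> G" "\<forall>x\<in>V. act \<sigma> x \<in> V \<and> act \<tau> (act \<sigma> x) = x \<and> act \<sigma> (act \<tau> x) = x"
    "\<forall>x\<in>V. \<forall>y\<in>V. R x y \<longrightarrow> R (act \<sigma> x) (act \<sigma> y)"
    using act unfolding acts_by_isos_def by blast
  show "\<exists>\<tau>\<in>G. (\<forall>x\<in>U. act \<sigma> x \<in> U \<and> act \<tau> (act \<sigma> x) = x \<and> act \<sigma> (act \<tau> x) = x) \<and>
      (\<forall>x\<in>U. \<forall>y\<in>U. R x y \<longrightarrow> R (act \<sigma> x) (act \<sigma> y))"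
  proof (rule bexI[OF _ \<tau>(1)], intro conjI ballI impI)
    fix x y assume x: "x \<in> U"
    then have "x \<in> V" using U(1) by blast
    then show "act \<tau> (act \<sigma> x) = x" "act \<sigma> (act \<tau> x) = x" using \<tau>(2) by blast+
    show "act \<sigma> x \<in> U" by (rule U(2)[OF \<sigma> x])
    assume "y \<in> U" "R x y"
    then show "R (act \<sigma> x) (act \<sigma> y)" using \<tau>(3) \<open>x \<in> V\<close> U(1) by blast
  qed
qed

text \<open>As for an equivalence of groupoids: a map of representatives that preserves and reflects
  isomorphism and is essentially surjective induces a bijection of classes. It has to commute with
  the actions only up to isomorphism.\<close>

lemma iso_classes_equivariant_bijection:
  assumes V: "equiv V (rel_on R V)" and W: "equiv W (rel_on S W)"
    and act: "acts_by_isos G act R V" and act': "acts_by_isos G act' S W"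
    and f: "\<And>x. x \<in> V \<Longrightarrow> f x \<in> W"
    and f_iff: "\<And>x y. x \<in> V \<Longrightarrow> y \<in> V \<Longrightarrow> S (f x) (f y) \<longleftrightarrow> R x y"
    and f_surj: "\<And>y. y \<in> W \<Longrightarrow> \<exists>x\<in>V. S (f x) y"
    and f_act: "\<And>\<sigma> x. \<sigma> \<in> G \<Longrightarrow> x \<in> V \<Longrightarrow> S (f (act \<sigma> x)) (act' \<sigma> (f x))"
  shows "\<exists>F. equivariant_bijection G (\<lambda>\<sigma> c. act \<sigma> ` c) (\<lambda>\<sigma> c. act' \<sigma> ` c)
    (iso_classes R V) (iso_classes S W) F"
proof -
  \<comment> \<open>Saturating the image of the whole class avoids a choice of
    representatives.\<close>
  define F where "F c = rel_on S W `` (f ` c)" for c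
  have F: "F (rel_on R V `` {x}) = rel_on S W `` {f x}" if x: "x \<in> V" for x
  proof -
    have "(f x, f y) \<in> rel_on S W" if "y \<in> rel_on R V `` {x}" for y
      using that f f_iff by auto
    then have "rel_on S W `` {f y} = rel_on S W `` {f x}" if "y \<in> rel_on R V `` {x}" for y
      using equiv_class_eq[OF W] that by blast
    moreover have "x \<in> rel_on R V `` {x}" using equiv_class_self[OF V x] .
    ultimately show ?thesis unfolding F_def by blast
  qed
  have cls: "\<exists>x\<in>V. c = rel_on R V `` {x}" if "c \<in> iso_classes R V" for c
    using that unfolding iso_classes_def by (auto elim: quotientE)
  have "bij_betw F (iso_classes R V) (iso_classes S W)"
  proof (rule bij_betw_imageI)
    show "inj_on F (iso_classes R V)"
    proof (rule inj_onI)
      fix c d assume cd: "c \<in> iso_classes R V" "d \<in> iso_classes R V" and eq: "F c = F d"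
      obtain x y where x: "x \<in> V" "c = rel_on R V `` {x}" and y: "y \<in> V" "d = rel_on R V `` {y}"
        using cls cd by meson
      have "rel_on S W `` {f x} = rel_on S W `` {f y}" using eq F x y by simp
      then have "S (f x) (f y)"
        using eq_equiv_class_iff[OF W f[OF x(1)] f[OF y(1)]] by simp
      then have "R x y" using f_iff x y by blast
      then show "c = d" using equiv_class_eq[OF V, of x y] x y by blast
    qed
    show "F ` iso_classes R V = iso_classes S W"
    proof
      show "F ` iso_classes R V \<subseteq> iso_classes S W"
        using cls F f quotientI[of _ W] unfolding iso_classes_def by (metis (no_types, lifting) image_subsetI)
      show "iso_classes S W \<subseteq> F ` iso_classes R V"
      proof
        fix d assume "d \<in> iso_classes S W"
        then obtain y where y: "y \<in> W" "d = rel_on S W `` {y}"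
          unfolding iso_classes_def by (auto elim: quotientE)
        obtain x where x: "x \<in> V" "S (f x) y" using f_surj y by blast
        have "d = F (rel_on R V `` {x})"
          unfolding F[OF x(1)] y(2) using equiv_class_eq[OF W, of "f x" y] x y f by blast
        then show "d \<in> F ` iso_classes R V"
          using x quotientI[of x V] unfolding iso_classes_def by blast
      qed
    qed
  qed
  moreover have "F (act \<sigma> ` c) = act' \<sigma> ` F c" if \<sigma>: "\<sigma> \<in> G" and c: "c \<in> iso_classes R V" for \<sigma> c
  proof -
    obtain x where x: "x \<in> V" "c = rel_on R V `` {x}" using cls c by blast
    have \<sigma>x: "act \<sigma> x \<in> V" using act \<sigma> x unfolding acts_by_isos_def by blast
    have "act' \<sigma> (f x) \<in> W" using act' \<sigma> f[OF x(1)] unfolding acts_by_isos_def by blast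
    then have "rel_on S W `` {f (act \<sigma> x)} = rel_on S W `` {act' \<sigma> (f x)}"
      using equiv_class_eq[OF W, of "f (act \<sigma> x)"] f_act[OF \<sigma> x(1)] f \<sigma>x by blast
    then show ?thesis
      unfolding x(2) acts_by_isos_class[OF V act \<sigma> x(1)] F[OF x(1)] F[OF \<sigma>x]
        acts_by_isos_class[OF W act' \<sigma> f[OF x(1)]] .
  qed
  ultimately show ?thesis unfolding equivariant_bijection_def by blast
qed

lemma equivariant_bijection_comp:
  assumes "equivariant_bijection G a b V W F" "equivariant_bijection G b c W U F'"
  shows "equivariant_bijection G a c V U (F' \<circ> F)"
  using assms bij_betw_trans[of F V W F' U] bij_betwE[of F V W]
  unfolding equivariant_bijection_def by simp

text \<open>Disjointness of the domains determines which map applies to an element, and disjointness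
  of the targets keeps the union injective. Since the action preserves each piece, an element and
  its conjugate are treated by the same map.\<close>

lemma equivariant_bijection_Union:
  assumes ex: "\<And>i. i \<in> I \<Longrightarrow> \<exists>F. equivariant_bijection G act act' (V i) (W i) F"
    and V: "disjoint_family_on V I" and W: "disjoint_family_on W I"
    and act: "\<And>i \<sigma> x. i \<in> I \<Longrightarrow> \<sigma> \<in> G \<Longrightarrow> x \<in> V i \<Longrightarrow> act \<sigma> x \<in> V i"
  shows "\<exists>F. equivariant_bijection G act act' (\<Union>i\<in>I. V i) (\<Union>i\<in>I. W i) F"
proof -
  obtain F where F: "\<And>i. i \<in> I \<Longrightarrow> equivariant_bijection G act act' (V i) (W i) (F i)"
    using ex by metis
  define H where "H x = F (THE i. i \<in> I \<and> x \<in> V i) x" for x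
  have H: "H x = F i x" if "i \<in> I" "x \<in> V i" for i x
  proof -
    have "(THE i. i \<in> I \<and> x \<in> V i) = i"
      using that V by (intro the_equality) (auto simp: disjoint_family_on_def)
    then show ?thesis by (simp add: H_def)
  qed
  have "bij_betw H (V i) (W i)" if "i \<in> I" for i
    using F[OF that] bij_betw_cong[of "V i" H "F i"] H[OF that] unfolding equivariant_bijection_def by simp
  then have "bij_betw H (\<Union>i\<in>I. V i) (\<Union>i\<in>I. W i)"
    using bij_betw_UNION_disjoint[OF W] by blast
  moreover have "H (act \<sigma> x) = act' \<sigma> (H x)" if "\<sigma> \<in> G" "x \<in> (\<Union>i\<in>I. V i)" for \<sigma> x
    using that F act H unfolding equivariant_bijection_def by fastforce
  ultimately show ?thesis unfolding equivariant_bijection_def by blast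
qed

text \<open>No relation leads from one piece to another, so an element has the same class in its
  piece as in the union. Reflexivity keeps classes nonempty; an empty class could be shared by two
  pieces.\<close>

lemma iso_classes_Union:
  assumes "\<And>i j x y. i \<in> I \<Longrightarrow> j \<in> I \<Longrightarrow> x \<in> V i \<Longrightarrow> y \<in> V j \<Longrightarrow> R x y \<Longrightarrow> i = j"
    and refl: "\<And>i x. i \<in> I \<Longrightarrow> x \<in> V i \<Longrightarrow> R x x"
  shows "iso_classes R (\<Union>i\<in>I. V i) = (\<Union>i\<in>I. iso_classes R (V i))"
    and "disjoint_family_on (\<lambda>i. iso_classes R (V i)) I"
proof -
  have "rel_on R (\<Union>i\<in>I. V i) `` {x} = rel_on R (V i) `` {x}" if "i \<in> I" "x \<in> V i" for i x
    using assms(1) that by blast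
  then show "iso_classes R (\<Union>i\<in>I. V i) = (\<Union>i\<in>I. iso_classes R (V i))"
    unfolding iso_classes_def quotient_def UN_UN_flatten
    by (intro SUP_cong refl arg_cong[of _ _ "\<lambda>c. {c}"]) blast+
  show "disjoint_family_on (\<lambda>i. iso_classes R (V i)) I"
    unfolding disjoint_family_on_def
  proof (intro ballI impI, rule ccontr)
    fix i j assume ij: "i \<in> I" "j \<in> I" "i \<noteq> j" and "iso_classes R (V i) \<inter> iso_classes R (V j) \<noteq> {}"
    then obtain c where c: "c \<in> iso_classes R (V i)" "c \<in> iso_classes R (V j)" by blast
    obtain x where "x \<in> V i" "c = rel_on R (V i) `` {x}"
      using c(1) unfolding iso_classes_def quotient_def by blast
    then have x: "x \<in> c" "x \<in> V i" using refl[OF ij(1)] by auto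
    moreover have "c \<subseteq> V j" using c(2) unfolding iso_classes_def quotient_def by blast
    ultimately show False using assms(1)[OF ij(1,2), of x x] refl[OF ij(1) x(2)] ij(3) by blast
  qed
qed

section \<open>Twisted category algebras\<close>

lemma sum_rotate3:
  "(\<Sum>x\<in>A. \<Sum>y\<in>B. \<Sum>z\<in>D. f x y z) = (\<Sum>z\<in>D. \<Sum>x\<in>A. \<Sum>y\<in>B. f x y z)"
proof -
  have "(\<Sum>x\<in>A. \<Sum>y\<in>B. \<Sum>z\<in>D. f x y z) = (\<Sum>x\<in>A. \<Sum>z\<in>D. \<Sum>y\<in>B. f x y z)"
    by (rule sum.cong[OF refl], rule sum.swap)
  also have "\<dots> = (\<Sum>z\<in>D. \<Sum>x\<in>A. \<Sum>y\<in>B. f x y z)"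
    by (rule sum.swap)
  finally show ?thesis .
qed

locale twisted_category = fin_category C for C :: "('o, 'm) category" +
  fixes \<alpha> :: "'m \<Rightarrow> 'm \<Rightarrow> 'k::field"
  assumes cocycles2: "\<alpha> \<in> cocycles2 C (-{0})"
begin

lemma cocycle:
  assumes "u \<in> Mor C" "t \<in> Mor C" "s \<in> Mor C" "Dom C t = Cod C s" "Dom C u = Cod C t"
  shows "\<alpha> u (Comp C t s) * \<alpha> t s = \<alpha> (Comp C u t) s * \<alpha> u t"
  using cocycles2 assms unfolding cocycles2_def by blast

lemma cocycle_nonzero:
  assumes "t \<in> Mor C" "s \<in> Mor C" "Dom C t = Cod C s"
  shows "\<alpha> t s \<noteq> 0"
  using cocycles2 assms unfolding cocycles2_def by blast

text \<open>This is the cocycle identity at (x, e, e) after cancelling \<alpha>(x, e). It is the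
  substitute for normalisation: all values against an absorbed idempotent equal \<alpha>(e,
  e).\<close>

lemma cocycle_idem_right:
  assumes "idempotent_endo C e" "x \<in> Mor C" "Dom C x = Dom C e" "Comp C x e = x"
  shows "\<alpha> x e = \<alpha> e e"
proof -
  have "\<alpha> x (Comp C e e) * \<alpha> e e = \<alpha> (Comp C x e) e * \<alpha> x e"
    by (rule cocycle) (use assms in auto)
  then show ?thesis using cocycle_nonzero[of x e] assms by simp
qed

lemma cocycle_idem_left:
  assumes "idempotent_endo C e" "x \<in> Mor C" "Cod C x = Dom C e" "Comp C e x = x"
  shows "\<alpha> e x = \<alpha> e e"
proof -
  have "\<alpha> e (Comp C e x) * \<alpha> e x = \<alpha> (Comp C e e) x * \<alpha> e e"
    by (rule cocycle) (use assms in auto)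
  then show ?thesis using cocycle_nonzero[of e x] assms by simp
qed

lemma twisted_category_idem_group_cat:
  assumes e: "idempotent_endo C e"
  shows "twisted_category (idem_group_cat C e) \<alpha>"
proof -
  have "idem_group C e \<subseteq> Mor C"
    by (rule category_idem_group_subset[OF category_axioms e])
  then have "\<alpha> \<in> cocycles2 (idem_group_cat C e) (-{0})"
    using cocycles2 unfolding cocycles2_def by (auto simp: subset_iff)
  then show ?thesis
    using fin_category_idem_group_cat[OF e]
    by (simp add: twisted_category_def twisted_category_axioms_def)
qed

text \<open>The multiplication constants with respect to the basis of morphisms. They vanish on
  pairs that cannot be composed, where the values of \<open>\<alpha>\<close> are unconstrained, so
  products become sums over all pairs.\<close>

definition structure_const :: "'m \<Rightarrow> 'm \<Rightarrow> 'm \<Rightarrow> 'k" where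
  "structure_const t s u = (if Dom C t = Cod C s \<and> Comp C t s = u then \<alpha> t s else 0)"

abbreviation "alg \<equiv> twisted_algebra C \<alpha>"

lemma carrier_alg: "carrier alg = {a. \<forall>u. u \<notin> Mor C \<longrightarrow> a u = 0}"
  and add_alg: "a \<oplus>\<^bsub>alg\<^esub> b = (\<lambda>u. a u + b u)"
  and zero_alg: "\<zero>\<^bsub>alg\<^esub> = (\<lambda>u. 0)"
  and one_alg: "\<one>\<^bsub>alg\<^esub> = (\<lambda>u. if u \<in> Ident C ` Obj C then inverse (\<alpha> u u) else 0)"
  by (simp_all add: twisted_algebra_def)

lemma mult_alg:
  "(a \<otimes>\<^bsub>alg\<^esub> b) u = (\<Sum>t\<in>Mor C. \<Sum>s\<in>Mor C. structure_const t s u * a t * b s)"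
proof -
  have "(a \<otimes>\<^bsub>alg\<^esub> b) u = (\<Sum>p\<in>Mor C \<times> Mor C. structure_const (fst p) (snd p) u * a (fst p) * b (snd p))"
    unfolding twisted_algebra_def monoid.simps
    by (rule sum.mono_neutral_cong_left)
      (auto simp: structure_const_def finite_Mor split: if_splits)
  then show ?thesis
    by (simp add: sum.cartesian_product case_prod_unfold)
qed

lemma mult_alg_support:
  assumes "(a \<otimes>\<^bsub>alg\<^esub> b) u \<noteq> 0"
  obtains t s where "t \<in> Mor C" "s \<in> Mor C" "Dom C t = Cod C s" "Comp C t s = u" "a t \<noteq> 0" "b s \<noteq> 0"
proof -
  obtain t where t: "t \<in> Mor C" "(\<Sum>s\<in>Mor C. structure_const t s u * a t * b s) \<noteq> 0"
    using assms sum.not_neutral_contains_not_neutral unfolding mult_alg by blast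
  then obtain s where "s \<in> Mor C" "structure_const t s u * a t * b s \<noteq> 0"
    using sum.not_neutral_contains_not_neutral by blast
  then show ?thesis
    using t that[of t s] by (auto simp: structure_const_def split: if_splits)
qed

text \<open>Each sum has at most one nonzero term, at the composite of the first or of the last two
  morphisms. Comparing the two terms is exactly the cocycle identity together with associativity of
  composition.\<close>

lemma structure_const_assoc:
  assumes "t \<in> Mor C" "s \<in> Mor C" "r \<in> Mor C"
  shows "(\<Sum>w\<in>Mor C. structure_const t s w * structure_const w r u) =
    (\<Sum>w\<in>Mor C. structure_const s r w * structure_const t w u)"
proof -
  have "(\<Sum>w\<in>Mor C. structure_const t s w * structure_const w r u) =
      (\<Sum>w\<in>Mor C. if w = Comp C t s then (if Dom C t = Cod C s then \<alpha> t s * structure_const w r u else 0) else 0)"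
    by (rule sum.cong) (auto simp: structure_const_def)
  also have "\<dots> = (if Dom C t = Cod C s then \<alpha> t s * structure_const (Comp C t s) r u else 0)"
    using assms finite_Mor by (simp add: sum.delta)
  also have "\<dots> = (if Dom C s = Cod C r then \<alpha> s r * structure_const t (Comp C s r) u else 0)"
    using assms cocycle[of t s r] by (auto simp: structure_const_def Comp_assoc mult.commute)
  also have "\<dots> = (\<Sum>w\<in>Mor C. if w = Comp C s r then (if Dom C s = Cod C r then \<alpha> s r * structure_const t w u else 0) else 0)"
    using assms finite_Mor by (simp add: sum.delta)
  also have "\<dots> = (\<Sum>w\<in>Mor C. structure_const s r w * structure_const t w u)"
    by (rule sum.cong) (auto simp: structure_const_def)
  finally show ?thesis .
qed

lemma mult_alg_closed: "a \<otimes>\<^bsub>alg\<^esub> b \<in> carrier alg"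
  unfolding carrier_alg using mult_alg_support Comp_Mor by blast

lemma mult_alg_assoc: "(a \<otimes>\<^bsub>alg\<^esub> b) \<otimes>\<^bsub>alg\<^esub> c = a \<otimes>\<^bsub>alg\<^esub> (b \<otimes>\<^bsub>alg\<^esub> c)"
proof
  fix u
  let ?g = structure_const and ?M = "Mor C"
  have "((a \<otimes>\<^bsub>alg\<^esub> b) \<otimes>\<^bsub>alg\<^esub> c) u =
      (\<Sum>w\<in>?M. \<Sum>r\<in>?M. \<Sum>t\<in>?M. \<Sum>s\<in>?M. ?g t s w * ?g w r u * (a t * b s * c r))"
    unfolding mult_alg by (simp add: sum_distrib_left sum_distrib_right mult_ac)
  also have "\<dots> = (\<Sum>t\<in>?M. \<Sum>s\<in>?M. \<Sum>r\<in>?M. \<Sum>w\<in>?M. ?g t s w * ?g w r u * (a t * b s * c r))"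
    by (subst sum.swap, subst sum_rotate3[symmetric], subst sum_rotate3[symmetric], rule refl)
  also have "\<dots> = (\<Sum>t\<in>?M. \<Sum>s\<in>?M. \<Sum>r\<in>?M. \<Sum>w\<in>?M. ?g s r w * ?g t w u * (a t * b s * c r))"
    by (rule sum.cong[OF refl], rule sum.cong[OF refl], rule sum.cong[OF refl])
      (simp add: structure_const_assoc flip: sum_distrib_right)
  also have "\<dots> = (\<Sum>t\<in>?M. \<Sum>w\<in>?M. \<Sum>s\<in>?M. \<Sum>r\<in>?M. ?g s r w * ?g t w u * (a t * b s * c r))"
    by (rule sum.cong[OF refl], rule sum_rotate3)
  also have "\<dots> = (a \<otimes>\<^bsub>alg\<^esub> (b \<otimes>\<^bsub>alg\<^esub> c)) u"
    unfolding mult_alg by (simp add: sum_distrib_left sum_distrib_right mult_ac)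
  finally show "((a \<otimes>\<^bsub>alg\<^esub> b) \<otimes>\<^bsub>alg\<^esub> c) u = (a \<otimes>\<^bsub>alg\<^esub> (b \<otimes>\<^bsub>alg\<^esub> c)) u" .
qed

lemma one_alg_apply: "V \<in> Obj C \<Longrightarrow> \<one>\<^bsub>alg\<^esub> (Ident C V) = inverse (\<alpha> (Ident C V) (Ident C V))"
  by (simp add: one_alg)

lemma one_alg_mult:
  assumes "a \<in> carrier alg"
  shows "\<one>\<^bsub>alg\<^esub> \<otimes>\<^bsub>alg\<^esub> a = a"
proof
  fix u
  have inner: "(\<Sum>t\<in>Mor C. structure_const t s u * \<one>\<^bsub>alg\<^esub> t * a s) = (if s = u then a s else 0)"
    if s: "s \<in> Mor C" for s
  proof -
    let ?i = "Ident C (Cod C s)"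
    \<comment> \<open>Only the identity of the codomain of \<open>s\<close> contributes, and its
      coefficient, the inverse of \<alpha>(i, i), cancels \<alpha>(i, s) = \<alpha>(i, i).\<close>
    have "structure_const t s u * \<one>\<^bsub>alg\<^esub> t * a s = (if t = ?i then (if s = u then a s else 0) else 0)"
      if "t \<in> Mor C" for t
    proof (cases "t \<in> Ident C ` Obj C \<and> Dom C t = Cod C s")
      case True
      then have t: "t = ?i" by auto
      have "\<alpha> ?i s = \<alpha> ?i ?i" "\<alpha> ?i ?i \<noteq> 0"
        using s cocycle_idem_left[of ?i s] cocycle_nonzero[of ?i ?i] by auto
      then show ?thesis
        using s by (auto simp: t structure_const_def one_alg_apply)
    next
      case False
      moreover have "t \<noteq> ?i" using False s by auto
      ultimately show ?thesis by (auto simp: structure_const_def one_alg)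
    qed
    then have "(\<Sum>t\<in>Mor C. structure_const t s u * \<one>\<^bsub>alg\<^esub> t * a s) =
        (\<Sum>t\<in>Mor C. if t = ?i then (if s = u then a s else 0) else 0)"
      by (rule sum.cong[OF refl])
    then show ?thesis using s finite_Mor by simp
  qed
  have "(\<one>\<^bsub>alg\<^esub> \<otimes>\<^bsub>alg\<^esub> a) u = (\<Sum>s\<in>Mor C. \<Sum>t\<in>Mor C. structure_const t s u * \<one>\<^bsub>alg\<^esub> t * a s)"
    unfolding mult_alg by (rule sum.swap)
  also have "\<dots> = a u"
    using inner finite_Mor assms by (simp add: carrier_alg)
  finally show "(\<one>\<^bsub>alg\<^esub> \<otimes>\<^bsub>alg\<^esub> a) u = a u" .
qed

lemma mult_one_alg:
  assumes "a \<in> carrier alg"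
  shows "a \<otimes>\<^bsub>alg\<^esub> \<one>\<^bsub>alg\<^esub> = a"
proof
  fix u
  have inner: "(\<Sum>s\<in>Mor C. structure_const t s u * a t * \<one>\<^bsub>alg\<^esub> s) = (if t = u then a t else 0)"
    if t: "t \<in> Mor C" for t
  proof -
    let ?i = "Ident C (Dom C t)"
    have "structure_const t s u * a t * \<one>\<^bsub>alg\<^esub> s = (if s = ?i then (if t = u then a t else 0) else 0)"
      if "s \<in> Mor C" for s
    proof (cases "s \<in> Ident C ` Obj C \<and> Dom C t = Cod C s")
      case True
      then have s: "s = ?i" by auto
      have "\<alpha> t ?i = \<alpha> ?i ?i" "\<alpha> ?i ?i \<noteq> 0"
        using t cocycle_idem_right[of ?i t] cocycle_nonzero[of ?i ?i] by auto
      then show ?thesis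
        using t by (auto simp: s structure_const_def one_alg_apply)
    next
      case False
      moreover have "s \<noteq> ?i" using False t by auto
      ultimately show ?thesis by (auto simp: structure_const_def one_alg)
    qed
    then have "(\<Sum>s\<in>Mor C. structure_const t s u * a t * \<one>\<^bsub>alg\<^esub> s) =
        (\<Sum>s\<in>Mor C. if s = ?i then (if t = u then a t else 0) else 0)"
      by (rule sum.cong[OF refl])
    then show ?thesis using t finite_Mor by simp
  qed
  show "(a \<otimes>\<^bsub>alg\<^esub> \<one>\<^bsub>alg\<^esub>) u = a u"
    using inner finite_Mor assms unfolding mult_alg by (simp add: carrier_alg)
qed

lemma ring_alg: "ring alg"
proof (rule ringI)
  show "abelian_group alg"
  proof (rule abelian_groupI)
    show "\<exists>y\<in>carrier alg. y \<oplus>\<^bsub>alg\<^esub> x = \<zero>\<^bsub>alg\<^esub>" if "x \<in> carrier alg" for x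
      using that by (intro bexI[of _ "\<lambda>u. - x u"]) (auto simp: carrier_alg add_alg zero_alg)
  qed (auto simp: carrier_alg add_alg zero_alg add_ac)
  show "monoid alg"
    by (rule monoidI) (auto simp: mult_alg_closed mult_alg_assoc one_alg_mult mult_one_alg,
      auto simp: carrier_alg one_alg)
qed (auto simp: fun_eq_iff mult_alg add_alg algebra_simps sum.distrib)

section \<open>Basis elements and the idempotents of the algebra\<close>

definition single :: "'k \<Rightarrow> 'm \<Rightarrow> 'm \<Rightarrow> 'k" where
  "single c s = (\<lambda>u. if u = s then c else 0)"

lemma single_closed: "s \<in> Mor C \<Longrightarrow> single c s \<in> carrier alg"
  by (auto simp: carrier_alg single_def)

lemma single_mult:
  assumes "t \<in> Mor C" "s \<in> Mor C"
  shows "single c t \<otimes>\<^bsub>alg\<^esub> single d s =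
    (if Dom C t = Cod C s then single (\<alpha> t s * c * d) (Comp C t s) else \<zero>\<^bsub>alg\<^esub>)"
proof
  fix u
  have "(single c t \<otimes>\<^bsub>alg\<^esub> single d s) u =
      (\<Sum>t'\<in>Mor C. \<Sum>s'\<in>Mor C. if s' = s then (if t' = t then structure_const t s u * c * d else 0) else 0)"
    unfolding mult_alg by (intro sum.cong refl) (auto simp: single_def)
  also have "\<dots> = structure_const t s u * c * d"
    using assms finite_Mor by simp
  finally show "(single c t \<otimes>\<^bsub>alg\<^esub> single d s) u =
      (if Dom C t = Cod C s then single (\<alpha> t s * c * d) (Comp C t s) else \<zero>\<^bsub>alg\<^esub>) u"
    by (auto simp: structure_const_def single_def zero_alg)
qed

text \<open>In the algebra the square of the basis element \<open>e\<close> is \<alpha>(e, e) e, so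
  this multiple of it is the idempotent. It is also the unit of the twisted algebra of G_e.\<close>

definition idem_elt :: "'m \<Rightarrow> 'm \<Rightarrow> 'k" where
  "idem_elt e = single (inverse (\<alpha> e e)) e"

lemma idem_elt_mult_single:
  assumes "idempotent_endo C e" "x \<in> Mor C"
  shows "Cod C x = Dom C e \<Longrightarrow> Comp C e x = x \<Longrightarrow> idem_elt e \<otimes>\<^bsub>alg\<^esub> single c x = single c x"
    and "Dom C x = Dom C e \<Longrightarrow> Comp C x e = x \<Longrightarrow> single c x \<otimes>\<^bsub>alg\<^esub> idem_elt e = single c x"
  using assms cocycle_idem_left[of e x] cocycle_idem_right[of e x] cocycle_nonzero[of e e]
  by (auto simp: idem_elt_def single_mult field_simps)

lemma one_idem_group_algebra: "\<one>\<^bsub>idem_group_algebra C \<alpha> e\<^esub> = idem_elt e"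
  by (auto simp: twisted_algebra_def idem_elt_def single_def)

subsection \<open>Transport along isomorphisms of idempotents\<close>

context
  fixes e f s t
  assumes e: "idempotent_endo C e" and f: "idempotent_endo C f" and st: "idem_iso_via C e f s t"
begin

text \<open>Origin of the coefficient: in the algebra, t' = t / (\<alpha>(e, e) \<alpha>(t, s))
  satisfies t' s = \<open>idem_elt e\<close>, and the product s x t' is
  \<open>transport_coeff C \<alpha> e s t x\<close> times the basis element of the composite. So
  transport is conjugation by \<open>s\<close>, and multiplicativity is (s p t') (s q t') = s p q
  t', written out with the cocycle identity.\<close>

lemma transport_coeff_mult:
  assumes p: "p \<in> corner_monoid C e" and q: "q \<in> corner_monoid C e"
  shows "\<alpha> (Comp C (Comp C s p) t) (Comp C (Comp C s q) t) *
      transport_coeff C \<alpha> e s t p * transport_coeff C \<alpha> e s t q =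
    transport_coeff C \<alpha> e s t (Comp C p q) * \<alpha> p q"
proof -
  note 1 = iso_rules[OF e f st] and 2 = corner_monoidD[OF p] and 3 = corner_monoidD[OF q]
  let ?pt = "Comp C p t" and ?qt = "Comp C q t"
  have sqt: "Comp C (Comp C s q) t = Comp C s ?qt" and spt: "Comp C (Comp C s p) t = Comp C s ?pt"
    and pqt: "Comp C (Comp C p q) t = Comp C p ?qt"
    using 1 2 3 by (simp_all add: Comp_assoc)
  have pts: "Comp C ?pt s = p" using 1 2 by (simp_all add: Comp_assoc)
  have mid: "Comp C ?pt (Comp C s ?qt) = Comp C p ?qt"
    using 1 2 3 Comp_assoc[of ?pt s ?qt] pts by simp
  have c1: "\<alpha> s (Comp C p ?qt) * \<alpha> ?pt (Comp C s ?qt) = \<alpha> (Comp C s ?pt) (Comp C s ?qt) * \<alpha> s ?pt"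
    using cocycle[of s ?pt "Comp C s ?qt"] 1 2 3 mid by simp
  have c2: "\<alpha> ?pt (Comp C s ?qt) * \<alpha> s ?qt = \<alpha> p ?qt * \<alpha> ?pt s"
    using cocycle[of ?pt s ?qt] 1 2 3 pts by simp
  have c3: "\<alpha> e e * \<alpha> t s = \<alpha> ?pt s * \<alpha> p t"
    using cocycle[of p t s] cocycle_idem_right[OF e, of p] 1 2 3 by simp
  have c4: "\<alpha> p ?qt * \<alpha> q t = \<alpha> (Comp C p q) t * \<alpha> p q"
    using cocycle[of p q t] 1 2 3 by simp
  have nz: "\<alpha> e e \<noteq> 0" "\<alpha> t s \<noteq> 0"
    using 1 e by (simp_all add: cocycle_nonzero)
  have "\<alpha> (Comp C s ?pt) (Comp C s ?qt) * (\<alpha> p t * \<alpha> s ?pt) * (\<alpha> q t * \<alpha> s ?qt) =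
      \<alpha> s (Comp C p ?qt) * (\<alpha> ?pt (Comp C s ?qt) * \<alpha> s ?qt) * \<alpha> p t * \<alpha> q t"
    using c1 by (simp add: mult_ac)
  also have "\<dots> = \<alpha> s (Comp C p ?qt) * (\<alpha> ?pt s * \<alpha> p t) * (\<alpha> p ?qt * \<alpha> q t)"
    unfolding c2 by (simp add: mult_ac)
  also have "\<dots> = (\<alpha> (Comp C p q) t * \<alpha> s (Comp C p ?qt)) * \<alpha> p q * (\<alpha> e e * \<alpha> t s)"
    unfolding c3[symmetric] c4 by (simp add: mult_ac)
  finally have "\<alpha> (Comp C s ?pt) (Comp C s ?qt) * (\<alpha> p t * \<alpha> s ?pt) * (\<alpha> q t * \<alpha> s ?qt) =
      (\<alpha> (Comp C p q) t * \<alpha> s (Comp C p ?qt)) * \<alpha> p q * (\<alpha> e e * \<alpha> t s)" .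
  then show ?thesis
    unfolding transport_coeff_def sqt spt pqt using nz by (simp add: field_simps)
qed

text \<open>The cocycle identity at (s, t, s) gives \<alpha>(e, e) \<alpha>(t, s) = \<alpha>(f, f)
  \<alpha>(s, t). This is what sends the unit \<open>idem_elt e\<close> to
  \<open>idem_elt f\<close>.\<close>

lemma transport_coeff_unit:
  "transport_coeff C \<alpha> e s t e * inverse (\<alpha> e e) = inverse (\<alpha> f f)"
proof -
  note 1 = iso_rules[OF e f st]
  have "\<alpha> s (Comp C t s) * \<alpha> t s = \<alpha> (Comp C s t) s * \<alpha> s t"
    using 1 by (intro cocycle) auto
  moreover have "\<alpha> s e = \<alpha> e e" "\<alpha> f s = \<alpha> f f" "\<alpha> e t = \<alpha> e e"
    using 1 e f cocycle_idem_right[of e s] cocycle_idem_left[of f s] cocycle_idem_left[of e t] by simp_all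
  ultimately have "\<alpha> e e * \<alpha> t s = \<alpha> f f * \<alpha> s t" using 1 by simp
  moreover have "\<alpha> e e \<noteq> 0" "\<alpha> t s \<noteq> 0" "\<alpha> f f \<noteq> 0" "\<alpha> s t \<noteq> 0"
    using 1 e f by (simp_all add: cocycle_nonzero)
  ultimately show ?thesis
    using 1 \<open>\<alpha> e t = \<alpha> e e\<close> by (simp add: transport_coeff_def field_simps)
qed

end

lemma transport_coeff_id:
  assumes e: "idempotent_endo C e" and x: "x \<in> corner_monoid C e"
  shows "transport_coeff C \<alpha> e e e x = 1"
  using cocycle_idem_right[OF e, of x] cocycle_idem_left[OF e, of x] cocycle_nonzero[of e e] corner_monoidD[OF x] e
  by (simp add: transport_coeff_def field_simps)

text \<open>Conjugation by \<open>s\<close> and then by \<open>s'\<close> is conjugation by their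
  product in the algebra. That product is the composite up to the scalar \<alpha>(s', s), which
  cancels against its inverse.\<close>

lemma transport_coeff_trans:
  assumes id: "idempotent_endo C e" "idempotent_endo C f" "idempotent_endo C g"
    and st: "idem_iso_via C e f s t" and st': "idem_iso_via C f g s' t'" and x: "x \<in> corner_monoid C e"
  shows "transport_coeff C \<alpha> e s t x * transport_coeff C \<alpha> f s' t' (Comp C (Comp C s x) t) =
    transport_coeff C \<alpha> e (Comp C s' s) (Comp C t t') x"
proof -
  note 1 = iso_rules[OF id(1,2) st] and 2 = iso_rules[OF id(2,3) st']
    and 3 = corner_monoidD[OF x]
  let ?xt = "Comp C x t" and ?tt = "Comp C t t'" and ?ss = "Comp C s' s"
  let ?xtt = "Comp C ?xt t'"
  have as: "Comp C (Comp C s x) t = Comp C s ?xt" "Comp C (Comp C s ?xt) t' = Comp C s ?xtt"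
    "Comp C x ?tt = ?xtt"
    using 1 2 3 by (simp_all add: Comp_assoc)
  have "Comp C t' ?ss = s"
    using 1 2 Comp_assoc[of t' s' s] by simp
  note as = as this
  have c1: "\<alpha> x ?tt * \<alpha> t t' = \<alpha> ?xt t' * \<alpha> x t"
    using cocycle[of x t t'] 1 2 3 by simp
  have c2: "\<alpha> s' (Comp C s ?xtt) * \<alpha> s ?xtt = \<alpha> ?ss ?xtt * \<alpha> s' s"
    using cocycle[of s' s ?xtt] 1 2 3 by simp
  have c3: "\<alpha> s ?xtt * \<alpha> ?xt t' = \<alpha> (Comp C s ?xt) t' * \<alpha> s ?xt"
    using cocycle[of s ?xt t'] 1 2 3 by simp
  have c4: "\<alpha> t s * \<alpha> t' ?ss = \<alpha> ?tt ?ss * \<alpha> t t'"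
    using cocycle[of t t' ?ss] 1 2 3 as by simp
  have c5: "\<alpha> t' ?ss * \<alpha> s' s = \<alpha> f f * \<alpha> t' s'"
    using cocycle[of t' s' s] cocycle_idem_left[OF id(2), of s] 1 2 3 by simp
  have nz: "\<alpha> e e \<noteq> 0" "\<alpha> t s \<noteq> 0" "\<alpha> f f \<noteq> 0" "\<alpha> t' s' \<noteq> 0" "\<alpha> ?tt ?ss \<noteq> 0" "\<alpha> t t' \<noteq> 0" "\<alpha> s' s \<noteq> 0"
    "\<alpha> ?xt t' \<noteq> 0" "\<alpha> s ?xtt \<noteq> 0" "\<alpha> t' ?ss \<noteq> 0"
    using 1 2 3 id as by (simp_all add: cocycle_nonzero)
  have e1: "\<alpha> x t = \<alpha> x ?tt * \<alpha> t t' / \<alpha> ?xt t'" using c1 nz by (simp add: field_simps)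
  have e2: "\<alpha> s' (Comp C s ?xtt) = \<alpha> ?ss ?xtt * \<alpha> s' s / \<alpha> s ?xtt" using c2 nz by (simp add: field_simps)
  have e3: "\<alpha> (Comp C s ?xt) t' * \<alpha> s ?xt = \<alpha> s ?xtt * \<alpha> ?xt t'" using c3 by simp
  have e4: "\<alpha> ?tt ?ss = \<alpha> t s * \<alpha> t' ?ss / \<alpha> t t'" using c4 nz by (simp add: field_simps)
  have e5: "\<alpha> t' s' = \<alpha> t' ?ss * \<alpha> s' s / \<alpha> f f" using c5 nz by (simp add: field_simps)
  have "transport_coeff C \<alpha> e s t x * transport_coeff C \<alpha> f s' t' (Comp C (Comp C s x) t) =
      (\<alpha> (Comp C s ?xt) t' * \<alpha> s ?xt) * \<alpha> x t * \<alpha> s' (Comp C s ?xtt) *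
      inverse (\<alpha> e e) * inverse (\<alpha> t s) * inverse (\<alpha> f f) * inverse (\<alpha> t' s')"
    unfolding transport_coeff_def as by (simp add: mult_ac)
  also have "\<dots> = transport_coeff C \<alpha> e ?ss ?tt x"
    unfolding transport_coeff_def as e1 e2 e3 e4 e5 using nz by (simp add: field_simps)
  finally show ?thesis .
qed

text \<open>Conjugation by \<open>s\<close> and \<open>t\<close> is injective on the group, so the
  sum defining \<open>transport\<close> has a single term, at the conjugate of \<open>y\<close> in
  the opposite direction.\<close>

lemma transport_apply:
  assumes e: "idempotent_endo C e" and f: "idempotent_endo C f" and st: "idem_iso_via C e f s t"
  shows "transport C \<alpha> e s t a y = (if y \<in> idem_group C f
    then a (Comp C (Comp C t y) s) * transport_coeff C \<alpha> e s t (Comp C (Comp C t y) s) else 0)"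
proof (cases "y \<in> idem_group C f")
  case True
  note ts = idem_iso_via_sym[OF e f st]
  have "x = Comp C (Comp C t y) s \<longleftrightarrow> x \<in> idem_group C e \<and> Comp C (Comp C s x) t = y" for x
    using conj_idem_group[OF f e ts True] conj_corner(2)[OF f e ts idem_group_corner[OF f True]]
      conj_corner(2)[OF e f st idem_group_corner[OF e]] by auto
  then have "{x \<in> idem_group C e. Comp C (Comp C s x) t = y} = {Comp C (Comp C t y) s}"
    by blast
  then show ?thesis using True by (simp add: transport_def)
next
  case False
  then have "{x \<in> idem_group C e. Comp C (Comp C s x) t = y} = {}"
    using conj_idem_group[OF e f st] by blast
  then show ?thesis using False unfolding transport_def by (metis sum.empty)
qed

lemma carrier_idem_group_algebra:
  "carrier (idem_group_algebra C \<alpha> e) = {a. \<forall>u. u \<notin> idem_group C e \<longrightarrow> a u = 0}"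
  by (simp add: twisted_algebra_def)

lemma transport_id:
  assumes e: "idempotent_endo C e" and a: "a \<in> carrier (idem_group_algebra C \<alpha> e)"
  shows "transport C \<alpha> e e e a = a"
  using a idem_group_corner[OF e] corner_monoidD[of _ e]
  by (auto simp: fun_eq_iff transport_apply[OF e e idem_iso_via_refl[OF e]] carrier_idem_group_algebra
      transport_coeff_id[OF e])

lemma transport_trans:
  assumes id: "idempotent_endo C e" "idempotent_endo C f" "idempotent_endo C g"
    and st: "idem_iso_via C e f s t" and st': "idem_iso_via C f g s' t'"
  shows "transport C \<alpha> f s' t' (transport C \<alpha> e s t a) = transport C \<alpha> e (Comp C s' s) (Comp C t t') a"
proof
  fix y
  show "transport C \<alpha> f s' t' (transport C \<alpha> e s t a) y = transport C \<alpha> e (Comp C s' s) (Comp C t t') a y"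
  proof (cases "y \<in> idem_group C g")
    case False
    then show ?thesis
      by (simp add: transport_apply[OF id(2,3) st'] transport_apply[OF id(1,3) idem_iso_via_trans[OF id st st']])
  next
    case True
    let ?z = "Comp C (Comp C t' y) s'"
    let ?x = "Comp C (Comp C t ?z) s"
    note ts = idem_iso_via_sym[OF id(1,2) st] and ts' = idem_iso_via_sym[OF id(2,3) st']
    have z: "?z \<in> idem_group C f" using conj_idem_group[OF id(3,2) ts' True] .
    have x: "?x \<in> idem_group C e" using conj_idem_group[OF id(2,1) ts z] .
    have sxt: "Comp C (Comp C s ?x) t = ?z"
      using conj_corner(2)[OF id(2,1) ts idem_group_corner[OF id(2) z]] .
    note 1 = iso_rules[OF id(1,2) st] and 2 = iso_rules[OF id(2,3) st']
      and 3 = corner_monoidD[OF idem_group_corner[OF id(3) True]]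
    have x_eq: "Comp C (Comp C (Comp C t t') y) (Comp C s' s) = ?x"
      using 1 2 3 by (simp add: Comp_assoc)
    show ?thesis
      using transport_coeff_trans[OF id st st' idem_group_corner[OF id(1) x]] True z
      unfolding transport_apply[OF id(2,3) st'] transport_apply[OF id(1,2) st]
        transport_apply[OF id(1,3) idem_iso_via_trans[OF id st st']] x_eq sxt
      by (simp add: mult_ac)
  qed
qed

lemma transport_inverse:
  assumes e: "idempotent_endo C e" and f: "idempotent_endo C f" and st: "idem_iso_via C e f s t"
    and a: "a \<in> carrier (idem_group_algebra C \<alpha> e)"
  shows "transport C \<alpha> f t s (transport C \<alpha> e s t a) = a"
  using transport_trans[OF e f e st idem_iso_via_sym[OF e f st]] transport_id[OF e a]
    iso_rules[OF e f st] by simp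

lemma transport_closed:
  assumes "idempotent_endo C e" "idempotent_endo C f" "idem_iso_via C e f s t"
  shows "transport C \<alpha> e s t a \<in> carrier (idem_group_algebra C \<alpha> f)"
  by (simp add: transport_apply[OF assms] carrier_idem_group_algebra)

lemma idem_group_algebra_mult:
  assumes e: "idempotent_endo C e"
  shows "(a \<otimes>\<^bsub>idem_group_algebra C \<alpha> e\<^esub> b) u =
    (\<Sum>p\<in>idem_group C e. \<Sum>q\<in>idem_group C e. if Comp C p q = u then \<alpha> p q * a p * b q else 0)"
proof -
  interpret G: twisted_category "idem_group_cat C e" \<alpha>
    by (rule twisted_category_idem_group_cat[OF e])
  have dom: "Dom C p = Cod C q" if "p \<in> idem_group C e" "q \<in> idem_group C e" for p q
    using that[THEN idem_group_corner[OF e], THEN corner_monoidD(2)]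
      that[THEN idem_group_corner[OF e], THEN corner_monoidD(3)] by simp
  show ?thesis
    unfolding G.mult_alg idem_group_cat_simps
  proof (intro sum.cong refl)
    fix p q assume "p \<in> idem_group C e" "q \<in> idem_group C e"
    from dom[OF this] show "G.structure_const p q u * a p * b q = (if Comp C p q = u then \<alpha> p q * a p * b q else 0)"
      by (simp add: G.structure_const_def)
  qed
qed

lemma transport_ring_iso:
  assumes e: "idempotent_endo C e" and f: "idempotent_endo C f" and st: "idem_iso_via C e f s t"
  shows "transport C \<alpha> e s t \<in> ring_iso (idem_group_algebra C \<alpha> e) (idem_group_algebra C \<alpha> f)"
proof -
  let ?T = "transport C \<alpha> e s t" and ?A = "idem_group_algebra C \<alpha> e" and ?B = "idem_group_algebra C \<alpha> f"
  let ?\<kappa> = "\<lambda>x. Comp C (Comp C s x) t" and ?\<theta> = "\<lambda>y. Comp C (Comp C t y) s"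
  let ?\<beta> = "transport_coeff C \<alpha> e s t"
  note ts = idem_iso_via_sym[OF e f st]
  have T: "?T a y = (if y \<in> idem_group C f then a (?\<theta> y) * ?\<beta> (?\<theta> y) else 0)" for a y
    by (rule transport_apply[OF e f st])
  have \<kappa>: "?\<kappa> x \<in> idem_group C f" "?\<theta> (?\<kappa> x) = x" if "x \<in> idem_group C e" for x
    using conj_idem_group[OF e f st that] conj_corner(2)[OF e f st idem_group_corner[OF e that]] by auto
  have \<theta>: "?\<theta> y \<in> idem_group C e" "?\<kappa> (?\<theta> y) = y" if "y \<in> idem_group C f" for y
    using conj_idem_group[OF f e ts that] conj_corner(2)[OF f e ts idem_group_corner[OF f that]] by auto
  have bij: "bij_betw ?\<kappa> (idem_group C e) (idem_group C f)"
    by (rule bij_betw_byWitness[of _ ?\<theta>]) (use \<kappa> \<theta> in auto)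
  have mult: "?T (a \<otimes>\<^bsub>?A\<^esub> b) = ?T a \<otimes>\<^bsub>?B\<^esub> ?T b" for a b
  proof
    fix y
    show "?T (a \<otimes>\<^bsub>?A\<^esub> b) y = (?T a \<otimes>\<^bsub>?B\<^esub> ?T b) y"
    proof (cases "y \<in> idem_group C f")
      case False
      then have "Comp C p q \<noteq> y" if "p \<in> idem_group C f" "q \<in> idem_group C f" for p q
        using idem_group_Comp[OF f that] by blast
      then have "(?T a \<otimes>\<^bsub>?B\<^esub> ?T b) y = 0"
        unfolding idem_group_algebra_mult[OF f] by (intro sum.neutral ballI) simp
      then show ?thesis using False by (simp add: T)
    next
      case True
      \<comment> \<open>Reindexing both factors along the conjugation \<open>?\<kappa>\<close>
        reduces the claim, term by term, to \<open>transport_coeff_mult\<close>.\<close>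
      have "(?T a \<otimes>\<^bsub>?B\<^esub> ?T b) y = (\<Sum>p\<in>idem_group C e. \<Sum>q\<in>idem_group C e.
          if Comp C (?\<kappa> p) (?\<kappa> q) = y then \<alpha> (?\<kappa> p) (?\<kappa> q) * ?T a (?\<kappa> p) * ?T b (?\<kappa> q) else 0)"
        unfolding idem_group_algebra_mult[OF f]
        by (subst sum.reindex_bij_betw[OF bij, symmetric], subst sum.reindex_bij_betw[OF bij, symmetric], rule refl)
      also have "\<dots> = (\<Sum>p\<in>idem_group C e. \<Sum>q\<in>idem_group C e.
          (if Comp C p q = ?\<theta> y then \<alpha> p q * a p * b q else 0) * ?\<beta> (?\<theta> y))"
      proof (intro sum.cong refl)
        fix p q assume p: "p \<in> idem_group C e" and q: "q \<in> idem_group C e"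
        note pq = idem_group_corner[OF e p] idem_group_corner[OF e q]
        have eq: "Comp C (?\<kappa> p) (?\<kappa> q) = ?\<kappa> (Comp C p q)"
          by (rule conj_mult[OF e f st pq])
        have iff: "?\<kappa> (Comp C p q) = y \<longleftrightarrow> Comp C p q = ?\<theta> y"
          using \<kappa>(2)[OF idem_group_Comp[OF e p q]] \<theta>(2)[OF True] by auto
        show "(if Comp C (?\<kappa> p) (?\<kappa> q) = y then \<alpha> (?\<kappa> p) (?\<kappa> q) * ?T a (?\<kappa> p) * ?T b (?\<kappa> q) else 0) =
            (if Comp C p q = ?\<theta> y then \<alpha> p q * a p * b q else 0) * ?\<beta> (?\<theta> y)"
        proof (cases "Comp C p q = ?\<theta> y")
          case pq_y: True
          have "\<alpha> (?\<kappa> p) (?\<kappa> q) * ?T a (?\<kappa> p) * ?T b (?\<kappa> q) =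
              (\<alpha> (?\<kappa> p) (?\<kappa> q) * ?\<beta> p * ?\<beta> q) * a p * b q"
            using \<kappa>[OF p] \<kappa>[OF q] by (simp add: T mult_ac)
          also have "\<dots> = \<alpha> p q * a p * b q * ?\<beta> (Comp C p q)"
            unfolding transport_coeff_mult[OF e f st pq] by (simp add: mult_ac)
          finally show ?thesis using iff pq_y unfolding eq by simp
        next
          case False
          then show ?thesis using iff unfolding eq by simp
        qed
      qed
      also have "\<dots> = ?T (a \<otimes>\<^bsub>?A\<^esub> b) y"
        using True unfolding T idem_group_algebra_mult[OF e] sum_distrib_right by simp
      finally show ?thesis by simp
    qed
  qed
  have one: "?T \<one>\<^bsub>?A\<^esub> = \<one>\<^bsub>?B\<^esub>"
  proof
    fix y
    have "?\<theta> y = e \<longleftrightarrow> y = f" if "y \<in> idem_group C f"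
      using \<theta>(2)[OF that] conj_unit[OF e f st] conj_unit[OF f e ts] by auto
    then show "?T \<one>\<^bsub>?A\<^esub> y = \<one>\<^bsub>?B\<^esub> y"
      using transport_coeff_unit[OF e f st] f
      unfolding T one_idem_group_algebra by (auto simp: idem_elt_def single_def mult.commute)
  qed
  have "bij_betw ?T (carrier ?A) (carrier ?B)"
    by (rule bij_betw_byWitness[of _ "transport C \<alpha> f t s"])
      (use transport_inverse[OF e f st] transport_inverse[OF f e ts] transport_closed[OF e f st]
        transport_closed[OF f e ts] in auto)
  moreover have "?T \<in> ring_hom ?A ?B"
  proof (rule ring_hom_memI)
    show "?T (a \<oplus>\<^bsub>?A\<^esub> b) = ?T a \<oplus>\<^bsub>?B\<^esub> ?T b" for a b
      by (simp add: fun_eq_iff T twisted_algebra_def algebra_simps)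
  qed (use mult one transport_closed[OF e f st] in auto)
  ultimately show ?thesis by (simp add: ring_iso_def)
qed

lemma ring_idem_group_algebra:
  assumes "idempotent_endo C e"
  shows "ring (idem_group_algebra C \<alpha> e)"
  by (rule twisted_category.ring_alg[OF twisted_category_idem_group_cat[OF assms]])

lemma inv_into_transport:
  assumes e: "idempotent_endo C e" and f: "idempotent_endo C f" and st: "idem_iso_via C e f s t"
    and b: "b \<in> carrier (idem_group_algebra C \<alpha> f)"
  shows "inv_into (carrier (idem_group_algebra C \<alpha> e)) (transport C \<alpha> e s t) b = transport C \<alpha> f t s b"
proof (rule inv_into_f_eq)
  note ts = idem_iso_via_sym[OF e f st]
  show "inj_on (transport C \<alpha> e s t) (carrier (idem_group_algebra C \<alpha> e))"
    using ring_isoD(5)[OF transport_ring_iso[OF e f st]] by (simp add: bij_betw_def)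
  show "transport C \<alpha> f t s b \<in> carrier (idem_group_algebra C \<alpha> e)"
    by (rule transport_closed[OF f e ts])
  show "transport C \<alpha> e s t (transport C \<alpha> f t s b) = b"
    by (rule transport_inverse[OF f e ts b])
qed

end

section \<open>Simple modules and idempotents\<close>

locale ring_corner = A: ring A + B: ring B
  for A :: "'a ring" and B :: "'a ring" +
  fixes q :: "'a \<Rightarrow> 'a"  \<comment> \<open>\<open>a \<mapsto> e a e\<close> followed by a ring homomorphism from \<open>e A e\<close> onto \<open>B\<close> that fixes \<open>B\<close>\<close>
  assumes B_subset: "carrier B \<subseteq> carrier A"
    and B_add: "x \<in> carrier B \<Longrightarrow> y \<in> carrier B \<Longrightarrow> x \<oplus>\<^bsub>B\<^esub> y = x \<oplus>\<^bsub>A\<^esub> y"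
    and B_mult: "x \<in> carrier B \<Longrightarrow> y \<in> carrier B \<Longrightarrow> x \<otimes>\<^bsub>B\<^esub> y = x \<otimes>\<^bsub>A\<^esub> y"
    and q_closed: "a \<in> carrier A \<Longrightarrow> q a \<in> carrier B"
    and q_id: "b \<in> carrier B \<Longrightarrow> q b = b"
    and q_add: "a \<in> carrier A \<Longrightarrow> b \<in> carrier A \<Longrightarrow> q (a \<oplus>\<^bsub>A\<^esub> b) = q a \<oplus>\<^bsub>A\<^esub> q b"
    and q_mult: "a \<in> carrier A \<Longrightarrow> b \<in> carrier A \<Longrightarrow> q (a \<otimes>\<^bsub>A\<^esub> (\<one>\<^bsub>B\<^esub> \<otimes>\<^bsub>A\<^esub> b)) = q a \<otimes>\<^bsub>A\<^esub> q b"
    and q_right: "a \<in> carrier A \<Longrightarrow> q (a \<otimes>\<^bsub>A\<^esub> \<one>\<^bsub>B\<^esub>) = q a"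
begin

abbreviation "e \<equiv> \<one>\<^bsub>B\<^esub>"

text \<open>The module e M as the set of fixed points of \<open>e\<close>, with the operations of
  \<open>M\<close> unchanged. It therefore commutes on the nose with a twist of scalars that fixes
  \<open>e\<close>.\<close>

definition corner :: "('a, 'v) module \<Rightarrow> ('a, 'v) module" where
  "corner M = M\<lparr>carrier := {x \<in> carrier M. e \<odot>\<^bsub>M\<^esub> x = x}\<rparr>"

text \<open>The conditions say that e M is nonzero and that the kernel of \<open>q\<close> on e A e
  annihilates \<open>M\<close>. For twisted category algebras this becomes the apex condition, see
  \<open>supported_iff_apex\<close>.\<close>

definition supported :: "('a, 'v) module \<Rightarrow> bool" where
  "supported M \<longleftrightarrow> (\<exists>x\<in>carrier M. e \<odot>\<^bsub>M\<^esub> x \<noteq> \<zero>\<^bsub>M\<^esub>) \<and>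
     (\<forall>a\<in>carrier A. \<forall>x\<in>carrier M. (e \<otimes>\<^bsub>A\<^esub> (a \<otimes>\<^bsub>A\<^esub> e)) \<odot>\<^bsub>M\<^esub> x = q a \<odot>\<^bsub>M\<^esub> x)"

lemma B_closed [simp]: "b \<in> carrier B \<Longrightarrow> b \<in> carrier A"
  using B_subset by blast

lemma e_mult [simp]: "b \<in> carrier B \<Longrightarrow> e \<otimes>\<^bsub>A\<^esub> b = b" "b \<in> carrier B \<Longrightarrow> b \<otimes>\<^bsub>A\<^esub> e = b"
  using B_mult[of e b] B_mult[of b e] by simp_all

lemma q_closed' [simp]: "a \<in> carrier A \<Longrightarrow> q a \<in> carrier A"
  using q_closed B_closed by blast

lemma q_zero: "q \<zero>\<^bsub>A\<^esub> = \<zero>\<^bsub>A\<^esub>"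
  using q_add[of "\<zero>\<^bsub>A\<^esub>" "\<zero>\<^bsub>A\<^esub>"] q_closed'[of "\<zero>\<^bsub>A\<^esub>"] by (simp add: A.add.l_cancel_one)

lemma zero_eq: "\<zero>\<^bsub>B\<^esub> = \<zero>\<^bsub>A\<^esub>"
  using B_add[of "\<zero>\<^bsub>B\<^esub>" "\<zero>\<^bsub>B\<^esub>"] A.add.l_cancel_one[of "\<zero>\<^bsub>B\<^esub>" "\<zero>\<^bsub>B\<^esub>"] by simp

lemma q_mult_B:
  assumes "a \<in> carrier A" "b \<in> carrier B" "c \<in> carrier A"
  shows "q (a \<otimes>\<^bsub>A\<^esub> (b \<otimes>\<^bsub>A\<^esub> c)) = q a \<otimes>\<^bsub>A\<^esub> (b \<otimes>\<^bsub>A\<^esub> q c)"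
proof -
  have "e \<otimes>\<^bsub>A\<^esub> (b \<otimes>\<^bsub>A\<^esub> c) = b \<otimes>\<^bsub>A\<^esub> c" "b \<otimes>\<^bsub>A\<^esub> (e \<otimes>\<^bsub>A\<^esub> c) = b \<otimes>\<^bsub>A\<^esub> c"
    using assms by (simp_all flip: A.m_assoc)
  then show ?thesis
    using assms q_mult[of a "b \<otimes>\<^bsub>A\<^esub> c"] q_mult[of b c] by (simp add: q_id)
qed

lemma q_mult_B_right: "a \<in> carrier A \<Longrightarrow> b \<in> carrier B \<Longrightarrow> q (a \<otimes>\<^bsub>A\<^esub> b) = q a \<otimes>\<^bsub>A\<^esub> b"
  using q_mult_B[of a b e] by (simp add: q_id q_right)

lemma corner_simps [simp]:
  "carrier (corner M) = {x \<in> carrier M. e \<odot>\<^bsub>M\<^esub> x = x}" "add (corner M) = add M"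
  "ring.zero (corner M) = ring.zero M" "module.smult (corner M) = module.smult M"
  by (simp_all add: corner_def)

lemma left_module_corner:
  assumes M: "left_module A M"
  shows "left_module B (corner M)"
proof -
  interpret m: left_module A M by (rule M)
  have "abelian_group (corner M)"
  proof (rule abelian_groupI)
    show "\<exists>y\<in>carrier (corner M). y \<oplus>\<^bsub>corner M\<^esub> x = \<zero>\<^bsub>corner M\<^esub>" if "x \<in> carrier (corner M)" for x
    proof (rule bexI)
      have x: "x \<in> carrier M" "e \<odot>\<^bsub>M\<^esub> x = x" using that by auto
      have "e \<odot>\<^bsub>M\<^esub> (\<ominus>\<^bsub>A\<^esub> \<one>\<^bsub>A\<^esub> \<odot>\<^bsub>M\<^esub> x) = \<ominus>\<^bsub>A\<^esub> \<one>\<^bsub>A\<^esub> \<odot>\<^bsub>M\<^esub> (e \<odot>\<^bsub>M\<^esub> x)"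
        using x(1) by (simp flip: m.smult_assoc add: A.l_minus A.r_minus)
      then show "\<ominus>\<^bsub>M\<^esub> x \<in> carrier (corner M)"
        using x by (simp add: m.smult_l_minus m.smult_one)
      show "\<ominus>\<^bsub>M\<^esub> x \<oplus>\<^bsub>corner M\<^esub> x = \<zero>\<^bsub>corner M\<^esub>"
        using x by (simp add: m.M.l_neg)
    qed
  qed (auto simp: m.smult_r_distr m.M.add.m_ac)
  moreover have "e \<odot>\<^bsub>M\<^esub> (b \<odot>\<^bsub>M\<^esub> x) = b \<odot>\<^bsub>M\<^esub> x" if "b \<in> carrier B" "x \<in> carrier M" for b x
    using that by (simp flip: m.smult_assoc)
  ultimately show ?thesis
    unfolding left_module_def left_module_axioms_def using B.ring_axioms
    by (auto simp: B_add B_mult m.smult_closed m.smult_l_distr m.smult_r_distr m.smult_assoc)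
qed

lemma supported_smult:
  assumes "left_module A M" "supported M" "a \<in> carrier A" "x \<in> carrier M" "e \<odot>\<^bsub>M\<^esub> x = x"
  shows "e \<odot>\<^bsub>M\<^esub> (a \<odot>\<^bsub>M\<^esub> x) = q a \<odot>\<^bsub>M\<^esub> x"
proof -
  interpret m: left_module A M by (rule assms)
  have "e \<odot>\<^bsub>M\<^esub> (a \<odot>\<^bsub>M\<^esub> x) = (e \<otimes>\<^bsub>A\<^esub> (a \<otimes>\<^bsub>A\<^esub> e)) \<odot>\<^bsub>M\<^esub> x"
    using assms by (simp add: m.smult_assoc m.smult_closed)
  then show ?thesis using assms unfolding supported_def by simp
qed

lemma supported_corner_nonzero:
  assumes M: "left_module A M" and s: "supported M"
  obtains v where "v \<in> carrier M" "e \<odot>\<^bsub>M\<^esub> v = v" "v \<noteq> \<zero>\<^bsub>M\<^esub>"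
proof -
  interpret m: left_module A M by (rule M)
  obtain x where x: "x \<in> carrier M" "e \<odot>\<^bsub>M\<^esub> x \<noteq> \<zero>\<^bsub>M\<^esub>" using s unfolding supported_def by blast
  have "e \<odot>\<^bsub>M\<^esub> (e \<odot>\<^bsub>M\<^esub> x) = e \<odot>\<^bsub>M\<^esub> x" using x by (simp flip: m.smult_assoc)
  then show ?thesis using that[of "e \<odot>\<^bsub>M\<^esub> x"] x m.smult_closed by simp
qed

text \<open>If a v = w with both vectors fixed by \<open>e\<close>, then w = e a v = q(a) v. So
  transitivity of \<open>A\<close> on \<open>M\<close> passes to transitivity of \<open>B\<close> on
  the corner.\<close>

lemma simple_corner:
  assumes M: "simple_module A M" and s: "supported M"
  shows "simple_module B (corner M)"
proof -
  note l = simple_moduleD(1)[OF M]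
  have "\<exists>b\<in>carrier B. b \<odot>\<^bsub>M\<^esub> v = w"
    if v: "v \<in> carrier M" "e \<odot>\<^bsub>M\<^esub> v = v" "v \<noteq> \<zero>\<^bsub>M\<^esub>" and w: "w \<in> carrier M" "e \<odot>\<^bsub>M\<^esub> w = w" for v w
  proof -
    obtain a where "a \<in> carrier A" "a \<odot>\<^bsub>M\<^esub> v = w"
      using simple_moduleD(3)[OF M v(1,3) w(1)] by blast
    then show ?thesis
      using supported_smult[OF l s _ v(1,2), of a] w(2) q_closed by auto
  qed
  moreover have "carrier (corner M) \<noteq> {\<zero>\<^bsub>M\<^esub>}"
    using supported_corner_nonzero[OF l s] by (metis (mono_tags, lifting) corner_simps(1) mem_Collect_eq singletonD)
  ultimately show ?thesis
    using left_module_corner[OF l] unfolding simple_module_iff by auto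
qed

lemma mod_iso_corner:
  assumes "mod_iso A M N" "left_module A M" "left_module A N"
  shows "mod_iso B (corner M) (corner N)"
proof -
  obtain h where h: "h \<in> mod_hom A M N" and b: "bij_betw h (carrier M) (carrier N)"
    using assms(1) unfolding mod_iso_def by blast
  interpret m: left_module A M by (rule assms)
  have e_h: "e \<odot>\<^bsub>N\<^esub> h x = h (e \<odot>\<^bsub>M\<^esub> x)" if "x \<in> carrier M" for x
    using mod_homD(3)[OF h, of e x] that by simp
  have "h \<in> mod_hom B (corner M) (corner N)"
    by (rule mod_homI) (auto simp: mod_homD[OF h] e_h)
  moreover have "bij_betw h (carrier (corner M)) (carrier (corner N))"
  proof (rule bij_betw_imageI)
    show "inj_on h (carrier (corner M))"
      using b unfolding bij_betw_def inj_on_def by simp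
    show "h ` carrier (corner M) = carrier (corner N)"
    proof
      show "h ` carrier (corner M) \<subseteq> carrier (corner N)"
        by (auto simp: mod_homD[OF h] e_h)
      show "carrier (corner N) \<subseteq> h ` carrier (corner M)"
      proof
        fix y assume y: "y \<in> carrier (corner N)"
        then obtain x where x: "x \<in> carrier M" "y = h x"
          using b unfolding bij_betw_def by auto
        then have "h (e \<odot>\<^bsub>M\<^esub> x) = h x" using y e_h by simp
        then have "e \<odot>\<^bsub>M\<^esub> x = x"
          using b x(1) m.smult_closed[of e x] unfolding bij_betw_def inj_on_def by simp
        then show "y \<in> h ` carrier (corner M)" using x by simp
      qed
    qed
  qed
  ultimately show ?thesis unfolding mod_iso_def by blast
qed

text \<open>If a v were nonzero, simplicity would give \<open>b\<close> with b a v = v, and then q(b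
  a) v = e b a v = v is nonzero. So the annihilator of \<open>v\<close> in \<open>A\<close> depends
  only on the action of \<open>B\<close> on the corner.\<close>

lemma annihilator_iff:
  assumes M: "simple_module A M" and s: "supported M"
    and v: "v \<in> carrier M" "e \<odot>\<^bsub>M\<^esub> v = v" "v \<noteq> \<zero>\<^bsub>M\<^esub>" and a: "a \<in> carrier A"
  shows "a \<odot>\<^bsub>M\<^esub> v = \<zero>\<^bsub>M\<^esub> \<longleftrightarrow> (\<forall>b\<in>carrier A. q (b \<otimes>\<^bsub>A\<^esub> a) \<odot>\<^bsub>M\<^esub> v = \<zero>\<^bsub>M\<^esub>)"
proof -
  note l = simple_moduleD(1)[OF M]
  interpret m: left_module A M by (rule l)
  have *: "q (b \<otimes>\<^bsub>A\<^esub> a) \<odot>\<^bsub>M\<^esub> v = e \<odot>\<^bsub>M\<^esub> (b \<odot>\<^bsub>M\<^esub> (a \<odot>\<^bsub>M\<^esub> v))" if "b \<in> carrier A" for b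
    using supported_smult[OF l s _ v(1,2), of "b \<otimes>\<^bsub>A\<^esub> a"] that a v(1) by (simp add: m.smult_assoc)
  show ?thesis
  proof
    assume "a \<odot>\<^bsub>M\<^esub> v = \<zero>\<^bsub>M\<^esub>"
    then show "\<forall>b\<in>carrier A. q (b \<otimes>\<^bsub>A\<^esub> a) \<odot>\<^bsub>M\<^esub> v = \<zero>\<^bsub>M\<^esub>" using * by simp
  next
    assume q0: "\<forall>b\<in>carrier A. q (b \<otimes>\<^bsub>A\<^esub> a) \<odot>\<^bsub>M\<^esub> v = \<zero>\<^bsub>M\<^esub>"
    show "a \<odot>\<^bsub>M\<^esub> v = \<zero>\<^bsub>M\<^esub>"
    proof (rule ccontr)
      assume "a \<odot>\<^bsub>M\<^esub> v \<noteq> \<zero>\<^bsub>M\<^esub>"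
      then obtain b where "b \<in> carrier A" "b \<odot>\<^bsub>M\<^esub> (a \<odot>\<^bsub>M\<^esub> v) = v"
        using simple_moduleD(3)[OF M _ _ v(1)] m.smult_closed[OF a v(1)] by blast
      then show False using * q0 v by force
    qed
  qed
qed

text \<open>The isomorphism of corners is not extended directly. It matches a vector
  \<open>v\<close> with a vector \<open>h v\<close>, these have the same annihilator in
  \<open>A\<close> by \<open>annihilator_iff\<close>, and cyclic modules are determined by
  annihilators.\<close>

lemma mod_iso_if_corner_iso:
  assumes M: "simple_module A M" "supported M" and N: "simple_module A N" "supported N"
    and iso: "mod_iso B (corner M) (corner N)"
  shows "mod_iso A M N"
proof -
  note lM = simple_moduleD(1)[OF M(1)] and lN = simple_moduleD(1)[OF N(1)]
  interpret m: left_module A M by (rule lM)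
  obtain h where h: "h \<in> mod_hom B (corner M) (corner N)" and b: "bij_betw h (carrier (corner M)) (carrier (corner N))"
    using iso unfolding mod_iso_def by blast
  obtain v where v: "v \<in> carrier M" "e \<odot>\<^bsub>M\<^esub> v = v" "v \<noteq> \<zero>\<^bsub>M\<^esub>"
    using supported_corner_nonzero[OF lM M(2)] .
  have h0: "h \<zero>\<^bsub>M\<^esub> = \<zero>\<^bsub>N\<^esub>"
    using mod_hom_zero[OF h left_module_corner[OF lM] left_module_corner[OF lN]] by simp
  have h_eq0: "h x = \<zero>\<^bsub>N\<^esub> \<longleftrightarrow> x = \<zero>\<^bsub>M\<^esub>" if "x \<in> carrier (corner M)" for x
    using b h0 that inj_onD[of h "carrier (corner M)" x "\<zero>\<^bsub>M\<^esub>"] unfolding bij_betw_def by auto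
  have v': "v \<in> carrier (corner M)" using v by simp
  have w: "h v \<in> carrier N" "e \<odot>\<^bsub>N\<^esub> h v = h v" "h v \<noteq> \<zero>\<^bsub>N\<^esub>"
    using mod_homD(1)[OF h v'] h_eq0[OF v'] v(3) by auto
  have "a \<odot>\<^bsub>M\<^esub> v = \<zero>\<^bsub>M\<^esub> \<longleftrightarrow> a \<odot>\<^bsub>N\<^esub> h v = \<zero>\<^bsub>N\<^esub>" if a: "a \<in> carrier A" for a
  proof -
    have "q (b \<otimes>\<^bsub>A\<^esub> a) \<odot>\<^bsub>M\<^esub> v = \<zero>\<^bsub>M\<^esub> \<longleftrightarrow> q (b \<otimes>\<^bsub>A\<^esub> a) \<odot>\<^bsub>N\<^esub> h v = \<zero>\<^bsub>N\<^esub>" if "b \<in> carrier A" for b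
    proof -
      have qB: "q (b \<otimes>\<^bsub>A\<^esub> a) \<in> carrier B" using that a by (simp add: q_closed)
      then have "q (b \<otimes>\<^bsub>A\<^esub> a) \<odot>\<^bsub>M\<^esub> v \<in> carrier (corner M)"
        using v by (simp add: m.smult_closed flip: m.smult_assoc)
      from h_eq0[OF this] show ?thesis using mod_homD(3)[OF h qB v'] by simp
    qed
    then show ?thesis
      unfolding annihilator_iff[OF M v a] annihilator_iff[OF N w a] by blast
  qed
  then show ?thesis
    using simple_module_iso_if_same_annihilator[OF M(1) N(1) v(1,3) w(1,3)] by blast
qed

text \<open>The module is the image of the induced module \<open>A \<otimes> T\<close> in the coinduced one: the map
  \<open>a \<mapsto> (b \<mapsto> q (b a) t\<^sub>0)\<close> has the kernel \<open>L\<close>, for any nonzero \<open>t\<^sub>0\<close> in \<open>T\<close>.\<close>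

lemma simple_module_with_corner:
  fixes enc :: "'a \<Rightarrow> 'v" and T :: "('a, 'w) module"
  assumes enc: "inj_on enc (carrier A)" and T: "simple_module B T"
  shows "\<exists>M :: ('a, 'v) module. simple_module A M \<and> supported M \<and> mod_iso B (corner M) T"
proof -
  interpret t: left_module B T by (rule simple_moduleD(1)[OF T])
  obtain t0 where t0: "t0 \<in> carrier T" "t0 \<noteq> \<zero>\<^bsub>T\<^esub>" using simple_moduleD(2)[OF T] by blast
  define L where "L = {a \<in> carrier A. \<forall>b\<in>carrier A. q (b \<otimes>\<^bsub>A\<^esub> a) \<odot>\<^bsub>T\<^esub> t0 = \<zero>\<^bsub>T\<^esub>}"
  have q_distr: "q (b \<otimes>\<^bsub>A\<^esub> (x \<oplus>\<^bsub>A\<^esub> y)) \<odot>\<^bsub>T\<^esub> t0 = q (b \<otimes>\<^bsub>A\<^esub> x) \<odot>\<^bsub>T\<^esub> t0 \<oplus>\<^bsub>T\<^esub> q (b \<otimes>\<^bsub>A\<^esub> y) \<odot>\<^bsub>T\<^esub> t0"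
    if "b \<in> carrier A" "x \<in> carrier A" "y \<in> carrier A" for b x y
    using that t0 q_closed by (simp add: A.r_distr q_add t.smult_l_distr flip: B_add)
  have "L \<subseteq> carrier A" by (auto simp: L_def)
  moreover have "\<zero>\<^bsub>A\<^esub> \<in> L"
    using t0 q_zero t.smult_l_null[OF t0(1)] by (simp add: L_def zero_eq)
  moreover have "x \<oplus>\<^bsub>A\<^esub> y \<in> L" if "x \<in> L" "y \<in> L" for x y
    using that by (simp add: L_def q_distr)
  moreover have "c \<otimes>\<^bsub>A\<^esub> x \<in> L" if "c \<in> carrier A" "x \<in> L" for c x
    using that by (simp add: L_def flip: A.m_assoc)
  ultimately obtain M :: "('a, 'v) module" and r where lM: "left_module A M"
    and carrier_M: "carrier M = r ` carrier A"
    and r0: "\<forall>a\<in>carrier A. r a = \<zero>\<^bsub>M\<^esub> \<longleftrightarrow> a \<in> L"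
    and r_add: "\<forall>a\<in>carrier A. \<forall>b\<in>carrier A. r a \<oplus>\<^bsub>M\<^esub> r b = r (a \<oplus>\<^bsub>A\<^esub> b)"
    and r_smult: "\<forall>a\<in>carrier A. \<forall>b\<in>carrier A. a \<odot>\<^bsub>M\<^esub> r b = r (a \<otimes>\<^bsub>A\<^esub> b)"
    using A.cyclic_module_exists[OF enc, of L] by blast
  interpret m: left_module A M by (rule lM)
  have r_closed: "r a \<in> carrier M" if "a \<in> carrier A" for a
    using that carrier_M by blast
  \<comment> \<open>Elements of \<open>M\<close> are compared by this criterion from here on:
    \<open>r x\<close> is determined by the function sending \<open>b\<close> to q(b x) t0.\<close>
  have r_eqI: "r x = r y"
    if xy: "x \<in> carrier A" "y \<in> carrier A" and q_eq: "\<And>b. b \<in> carrier A \<Longrightarrow> q (b \<otimes>\<^bsub>A\<^esub> x) \<odot>\<^bsub>T\<^esub> t0 = q (b \<otimes>\<^bsub>A\<^esub> y) \<odot>\<^bsub>T\<^esub> t0"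
    for x y
  proof -
    let ?d = "x \<ominus>\<^bsub>A\<^esub> y"
    have d: "?d \<in> carrier A" "?d \<oplus>\<^bsub>A\<^esub> y = x"
      using xy by (simp_all add: a_minus_def A.a_assoc A.l_neg)
    have "q (b \<otimes>\<^bsub>A\<^esub> ?d) \<odot>\<^bsub>T\<^esub> t0 = \<zero>\<^bsub>T\<^esub>" if b: "b \<in> carrier A" for b
    proof -
      have "q (b \<otimes>\<^bsub>A\<^esub> ?d) \<odot>\<^bsub>T\<^esub> t0 \<oplus>\<^bsub>T\<^esub> q (b \<otimes>\<^bsub>A\<^esub> y) \<odot>\<^bsub>T\<^esub> t0 = q (b \<otimes>\<^bsub>A\<^esub> y) \<odot>\<^bsub>T\<^esub> t0"
        using q_distr[OF b d(1) xy(2)] d(2) q_eq[OF b] by simp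
      then show ?thesis
        using t.smult_closed[OF q_closed t0(1)] b d(1) xy by (simp add: t.M.add.r_cancel_one)
    qed
    then have "r ?d = \<zero>\<^bsub>M\<^esub>" using r0 d(1) by (simp add: L_def)
    then have "r (?d \<oplus>\<^bsub>A\<^esub> y) = r y"
      using r_add d(1) xy(2) r_closed by (metis m.M.l_zero)
    then show ?thesis using d(2) by simp
  qed
  have q_assoc: "(q b \<otimes>\<^bsub>A\<^esub> c) \<odot>\<^bsub>T\<^esub> x = q b \<odot>\<^bsub>T\<^esub> (c \<odot>\<^bsub>T\<^esub> x)"
    if "b \<in> carrier A" "c \<in> carrier B" "x \<in> carrier T" for b c x
    using that q_closed by (simp add: t.smult_assoc flip: B_mult)
  have re: "r e \<in> carrier M" "e \<odot>\<^bsub>M\<^esub> r e = r e" using r_closed r_smult by simp_all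
  have re0: "r e \<noteq> \<zero>\<^bsub>M\<^esub>"
  proof -
    have "q (\<one>\<^bsub>A\<^esub> \<otimes>\<^bsub>A\<^esub> e) \<odot>\<^bsub>T\<^esub> t0 = t0" using t0 by (simp add: q_id t.smult_one)
    then have "e \<notin> L" using t0(2) A.one_closed unfolding L_def by force
    then show ?thesis using r0 by simp
  qed
  \<comment> \<open>Right multiplication by \<open>e\<close> is invisible to \<open>q\<close>, so 1
    and \<open>e\<close> have the same class. Hence the vector \<open>r e\<close> of the corner
    generates \<open>M\<close>.\<close>
  have r1: "r \<one>\<^bsub>A\<^esub> = r e" by (rule r_eqI) (simp_all add: q_right)
  have simple: "simple_module A M"
    unfolding simple_module_iff
  proof (intro conjI ballI impI)
    show "left_module A M" by (rule lM)
    show "carrier M \<noteq> {\<zero>\<^bsub>M\<^esub>}" using re(1) re0 by blast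
    fix v w assume v: "v \<in> carrier M" "v \<noteq> \<zero>\<^bsub>M\<^esub>" and w: "w \<in> carrier M"
    obtain a where a: "a \<in> carrier A" "v = r a" using v(1) carrier_M by blast
    obtain c where c: "c \<in> carrier A" "w = r c" using w carrier_M by blast
    \<comment> \<open>A nonzero vector is detected by some \<open>b\<close>, which produces a
      nonzero vector of \<open>T\<close>. Simplicity of \<open>T\<close> leads from there back to
      \<open>t0\<close> by some c', so that c' b carries \<open>v\<close> to the generator
      \<open>r e\<close>.\<close>
    obtain b where b: "b \<in> carrier A" "q (b \<otimes>\<^bsub>A\<^esub> a) \<odot>\<^bsub>T\<^esub> t0 \<noteq> \<zero>\<^bsub>T\<^esub>"
      using v(2) r0 a by (auto simp: L_def)
    have "q (b \<otimes>\<^bsub>A\<^esub> a) \<odot>\<^bsub>T\<^esub> t0 \<in> carrier T"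
      using a b t0 by (simp add: t.smult_closed q_closed)
    then obtain c' where c': "c' \<in> carrier B" "c' \<odot>\<^bsub>T\<^esub> (q (b \<otimes>\<^bsub>A\<^esub> a) \<odot>\<^bsub>T\<^esub> t0) = t0"
      using simple_moduleD(3)[OF T _ b(2) t0(1)] by blast
    have "r (c' \<otimes>\<^bsub>A\<^esub> (b \<otimes>\<^bsub>A\<^esub> a)) = r e"
    proof (rule r_eqI)
      fix x assume x: "x \<in> carrier A"
      have "q (x \<otimes>\<^bsub>A\<^esub> (c' \<otimes>\<^bsub>A\<^esub> (b \<otimes>\<^bsub>A\<^esub> a))) \<odot>\<^bsub>T\<^esub> t0 = q x \<odot>\<^bsub>T\<^esub> ((c' \<otimes>\<^bsub>A\<^esub> q (b \<otimes>\<^bsub>A\<^esub> a)) \<odot>\<^bsub>T\<^esub> t0)"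
        using x c' a b t0 q_closed B.m_closed[of c' "q (b \<otimes>\<^bsub>A\<^esub> a)"]
        by (simp add: q_mult_B q_assoc B_mult)
      also have "\<dots> = q x \<odot>\<^bsub>T\<^esub> t0"
        using c' a b t0 q_closed by (simp add: t.smult_assoc flip: B_mult)
      finally show "q (x \<otimes>\<^bsub>A\<^esub> (c' \<otimes>\<^bsub>A\<^esub> (b \<otimes>\<^bsub>A\<^esub> a))) \<odot>\<^bsub>T\<^esub> t0 = q (x \<otimes>\<^bsub>A\<^esub> e) \<odot>\<^bsub>T\<^esub> t0"
        using x by (simp add: q_right)
    qed (use a b c' in auto)
    note eq = this
    have "(c \<otimes>\<^bsub>A\<^esub> (c' \<otimes>\<^bsub>A\<^esub> b)) \<odot>\<^bsub>M\<^esub> v = c \<odot>\<^bsub>M\<^esub> r (c' \<otimes>\<^bsub>A\<^esub> (b \<otimes>\<^bsub>A\<^esub> a))"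
      using a b c c' r_smult by (simp add: A.m_assoc)
    also have "\<dots> = c \<odot>\<^bsub>M\<^esub> r \<one>\<^bsub>A\<^esub>" by (simp only: eq r1)
    also have "\<dots> = w" using c r_smult by simp
    finally show "\<exists>a\<in>carrier A. a \<odot>\<^bsub>M\<^esub> v = w"
      using b c(1) c'(1) by (intro bexI[of _ "c \<otimes>\<^bsub>A\<^esub> (c' \<otimes>\<^bsub>A\<^esub> b)"]) simp_all
  qed
  have supp: "supported M"
    unfolding supported_def
  proof (intro conjI ballI)
    show "\<exists>x\<in>carrier M. e \<odot>\<^bsub>M\<^esub> x \<noteq> \<zero>\<^bsub>M\<^esub>" using re re0 by metis
    fix a x assume a: "a \<in> carrier A" and "x \<in> carrier M"
    then obtain c where c: "c \<in> carrier A" "x = r c" using carrier_M by blast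
    have "r (e \<otimes>\<^bsub>A\<^esub> (a \<otimes>\<^bsub>A\<^esub> (e \<otimes>\<^bsub>A\<^esub> c))) = r (q a \<otimes>\<^bsub>A\<^esub> c)"
    proof (rule r_eqI)
      fix b assume b: "b \<in> carrier A"
      have "q (b \<otimes>\<^bsub>A\<^esub> (e \<otimes>\<^bsub>A\<^esub> (a \<otimes>\<^bsub>A\<^esub> (e \<otimes>\<^bsub>A\<^esub> c)))) = q b \<otimes>\<^bsub>A\<^esub> (q a \<otimes>\<^bsub>A\<^esub> q c)"
        using a b c by (simp add: q_mult)
      also have "\<dots> = q (b \<otimes>\<^bsub>A\<^esub> (q a \<otimes>\<^bsub>A\<^esub> c))"
        using a b c by (simp add: q_mult_B q_closed)
      finally show "q (b \<otimes>\<^bsub>A\<^esub> (e \<otimes>\<^bsub>A\<^esub> (a \<otimes>\<^bsub>A\<^esub> (e \<otimes>\<^bsub>A\<^esub> c)))) \<odot>\<^bsub>T\<^esub> t0 = q (b \<otimes>\<^bsub>A\<^esub> (q a \<otimes>\<^bsub>A\<^esub> c)) \<odot>\<^bsub>T\<^esub> t0"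
        by simp
    qed (use a c in auto)
    then show "(e \<otimes>\<^bsub>A\<^esub> (a \<otimes>\<^bsub>A\<^esub> e)) \<odot>\<^bsub>M\<^esub> x = q a \<odot>\<^bsub>M\<^esub> x"
      using a c r_smult by (simp add: A.m_assoc)
  qed
  have "mod_iso B (corner M) T"
  proof (rule simple_module_iso_if_same_annihilator[OF simple_corner[OF simple supp] T _ _ t0])
    fix c assume c: "c \<in> carrier B"
    have *: "q (b \<otimes>\<^bsub>A\<^esub> c) \<odot>\<^bsub>T\<^esub> t0 = q b \<odot>\<^bsub>T\<^esub> (c \<odot>\<^bsub>T\<^esub> t0)" if "b \<in> carrier A" for b
      using that c t0 by (simp add: q_mult_B_right q_assoc)
    have "c \<in> L \<longleftrightarrow> c \<odot>\<^bsub>T\<^esub> t0 = \<zero>\<^bsub>T\<^esub>"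
    proof
      assume "c \<in> L"
      then have "q (e \<otimes>\<^bsub>A\<^esub> c) \<odot>\<^bsub>T\<^esub> t0 = \<zero>\<^bsub>T\<^esub>"
        unfolding L_def using B_closed[OF B.one_closed] by blast
      then show "c \<odot>\<^bsub>T\<^esub> t0 = \<zero>\<^bsub>T\<^esub>"
        using c by (simp add: q_id)
    qed (use * c q_closed in \<open>simp add: L_def\<close>)
    then show "c \<odot>\<^bsub>corner M\<^esub> r e = \<zero>\<^bsub>corner M\<^esub> \<longleftrightarrow> c \<odot>\<^bsub>T\<^esub> t0 = \<zero>\<^bsub>T\<^esub>"
      using c r0 r_smult by simp
  qed (use re re0 in auto)
  then show ?thesis using simple supp by blast
qed

end

section \<open>The group algebra as a quotient of the corner of the category algebra\<close>

context twisted_category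
begin

definition idem_proj :: "'m \<Rightarrow> ('m \<Rightarrow> 'k) \<Rightarrow> 'm \<Rightarrow> 'k" where
  "idem_proj e a = (\<lambda>u. if u \<in> idem_group C e then (idem_elt e \<otimes>\<^bsub>alg\<^esub> (a \<otimes>\<^bsub>alg\<^esub> idem_elt e)) u else 0)"

lemma corner_support:
  assumes e: "idempotent_endo C e" and u: "(idem_elt e \<otimes>\<^bsub>alg\<^esub> (a \<otimes>\<^bsub>alg\<^esub> idem_elt e)) u \<noteq> 0"
  shows "u \<in> corner_monoid C e"
proof -
  obtain t s where ts: "t \<in> Mor C" "s \<in> Mor C" "Dom C t = Cod C s" "Comp C t s = u" "idem_elt e t \<noteq> 0"
    "(a \<otimes>\<^bsub>alg\<^esub> idem_elt e) s \<noteq> 0"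
    by (rule mult_alg_support[OF u])
  obtain x y where xy: "x \<in> Mor C" "y \<in> Mor C" "Dom C x = Cod C y" "Comp C x y = s" "idem_elt e y \<noteq> 0"
    by (rule mult_alg_support[OF ts(6)])
  have te: "t = e" "y = e"
    using ts(5) xy(5) unfolding idem_elt_def single_def by presburger+
  have "Cod C s = Dom C e" "u = Comp C e s" using ts(3,4) te(1) by simp_all
  moreover have "Dom C x = Cod C e" "s = Comp C x e" using xy(3,4) te(2) by simp_all
  then have "Dom C s = Dom C e" "Comp C s e = s" using xy(1) e by simp_all
  ultimately have s: "Cod C s = Dom C e" "Dom C s = Dom C e" "Comp C s e = s" and u: "u = Comp C e s"
    by simp_all
  show ?thesis
    using s ts(2) e Comp_assoc[of e s e] unfolding u corner_monoid_def by simp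
qed

text \<open>A product of two elements of the corner monoid is a unit only if both factors are. So no
  term involving a nonunit contributes to a coefficient at a unit, and cutting off the nonunits is
  multiplicative.\<close>

lemma mult_alg_restrict:
  assumes e: "idempotent_endo C e"
    and a: "\<And>u. a u \<noteq> 0 \<Longrightarrow> u \<in> corner_monoid C e" and b: "\<And>u. b u \<noteq> 0 \<Longrightarrow> u \<in> corner_monoid C e"
  defines "r \<equiv> \<lambda>(a :: 'm \<Rightarrow> 'k) u. if u \<in> idem_group C e then a u else 0"
  shows "r (a \<otimes>\<^bsub>alg\<^esub> b) = r a \<otimes>\<^bsub>alg\<^esub> r b"
proof
  fix u
  show "r (a \<otimes>\<^bsub>alg\<^esub> b) u = (r a \<otimes>\<^bsub>alg\<^esub> r b) u"
  proof (cases "u \<in> idem_group C e")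
    case True
    have eq: "structure_const t s u * a t * b s = structure_const t s u * r a t * r b s" for t s
    proof (cases "structure_const t s u * a t * b s = 0")
      case True
      then show ?thesis by (auto simp: r_def)
    next
      case False
      then have "Comp C t s = u" "t \<in> corner_monoid C e" "s \<in> corner_monoid C e"
        using a b by (auto simp: structure_const_def split: if_splits)
      then have "t \<in> idem_group C e" "s \<in> idem_group C e"
        using idem_group_of_product[OF e] \<open>u \<in> idem_group C e\<close> by auto
      then show ?thesis by (simp add: r_def)
    qed
    have "r (a \<otimes>\<^bsub>alg\<^esub> b) u = (a \<otimes>\<^bsub>alg\<^esub> b) u" using True by (simp add: r_def)
    then show ?thesis unfolding mult_alg by (simp only: eq)
  next
    case False
    have "(r a \<otimes>\<^bsub>alg\<^esub> r b) u = 0"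
    proof (rule ccontr)
      assume "(r a \<otimes>\<^bsub>alg\<^esub> r b) u \<noteq> 0"
      from mult_alg_support[OF this] obtain t s where "Comp C t s = u" "r a t \<noteq> 0" "r b s \<noteq> 0"
        by metis
      then have "u \<in> idem_group C e"
        using idem_group_Comp[OF e, of t s] by (auto simp: r_def split: if_splits)
      then show False using False by blast
    qed
    then show ?thesis using False by (simp add: r_def)
  qed
qed

lemma idem_elt_closed: "idempotent_endo C e \<Longrightarrow> idem_elt e \<in> carrier alg"
  by (simp add: idem_elt_def single_closed)

lemma idem_elt_idem: "idempotent_endo C e \<Longrightarrow> idem_elt e \<otimes>\<^bsub>alg\<^esub> idem_elt e = idem_elt e"
  using idem_elt_mult_single(1)[of e e] unfolding idem_elt_def by simp

lemma ring_corner_idem_group_algebra: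
  assumes e: "idempotent_endo C e"
  shows "ring_corner alg (idem_group_algebra C \<alpha> e) (idem_proj e)"
proof -
  interpret A: ring alg by (rule ring_alg)
  interpret G: twisted_category "idem_group_cat C e" \<alpha> by (rule twisted_category_idem_group_cat[OF e])
  interpret B: ring "idem_group_algebra C \<alpha> e" by (rule G.ring_alg)
  let ?B = "idem_group_algebra C \<alpha> e" and ?e = "idem_elt e"
  have sub: "idem_group C e \<subseteq> Mor C" by (rule category_idem_group_subset[OF category_axioms e])
  have carrier_B: "carrier ?B = {a. \<forall>u. u \<notin> idem_group C e \<longrightarrow> a u = 0}"
    by (simp add: twisted_algebra_def)
  then have sub': "carrier ?B \<subseteq> carrier alg" using sub by (auto simp: carrier_alg)
  note [simp] = idem_elt_closed[OF e] idem_elt_idem[OF e]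
  have B_mult: "a \<otimes>\<^bsub>?B\<^esub> b = a \<otimes>\<^bsub>alg\<^esub> b" if a: "a \<in> carrier ?B" and b: "b \<in> carrier ?B" for a b
  proof
    fix u
    have sc: "G.structure_const = structure_const"
      by (simp add: fun_eq_iff G.structure_const_def structure_const_def)
    have "(a \<otimes>\<^bsub>alg\<^esub> b) u = (\<Sum>t\<in>idem_group C e. \<Sum>s\<in>Mor C. structure_const t s u * a t * b s)"
      unfolding mult_alg using sub a by (intro sum.mono_neutral_right) (auto simp: finite_Mor carrier_B)
    also have "\<dots> = (\<Sum>t\<in>idem_group C e. \<Sum>s\<in>idem_group C e. structure_const t s u * a t * b s)"
      using sub b by (intro sum.cong refl sum.mono_neutral_right) (auto simp: finite_Mor carrier_B)
    finally show "(a \<otimes>\<^bsub>?B\<^esub> b) u = (a \<otimes>\<^bsub>alg\<^esub> b) u"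
      by (simp add: G.mult_alg sc)
  qed
  have one_B: "\<one>\<^bsub>?B\<^esub> = ?e" by (rule one_idem_group_algebra)
  have absorb: "?e \<otimes>\<^bsub>alg\<^esub> (?e \<otimes>\<^bsub>alg\<^esub> a) = ?e \<otimes>\<^bsub>alg\<^esub> a" if "a \<in> carrier alg" for a
    using that by (simp flip: A.m_assoc)
  show ?thesis
  proof
    show "carrier ?B \<subseteq> carrier alg" by (rule sub')
    show "x \<oplus>\<^bsub>?B\<^esub> y = x \<oplus>\<^bsub>alg\<^esub> y" for x y by (simp add: twisted_algebra_def)
    show "x \<otimes>\<^bsub>?B\<^esub> y = x \<otimes>\<^bsub>alg\<^esub> y" if "x \<in> carrier ?B" "y \<in> carrier ?B" for x y
      using B_mult that .
    show "idem_proj e a \<in> carrier ?B" for a by (simp add: carrier_B idem_proj_def)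
    show "idem_proj e b = b" if b: "b \<in> carrier ?B" for b
    proof -
      have "?e \<otimes>\<^bsub>alg\<^esub> (b \<otimes>\<^bsub>alg\<^esub> ?e) = b"
        using b B.one_closed B.l_one B.r_one unfolding one_B by (simp flip: B_mult)
      then show ?thesis using b by (auto simp: idem_proj_def carrier_B fun_eq_iff)
    qed
    show "idem_proj e (a \<oplus>\<^bsub>alg\<^esub> b) = idem_proj e a \<oplus>\<^bsub>alg\<^esub> idem_proj e b"
      if "a \<in> carrier alg" "b \<in> carrier alg" for a b
    proof -
      have "?e \<otimes>\<^bsub>alg\<^esub> ((a \<oplus>\<^bsub>alg\<^esub> b) \<otimes>\<^bsub>alg\<^esub> ?e) =
          ?e \<otimes>\<^bsub>alg\<^esub> (a \<otimes>\<^bsub>alg\<^esub> ?e) \<oplus>\<^bsub>alg\<^esub> ?e \<otimes>\<^bsub>alg\<^esub> (b \<otimes>\<^bsub>alg\<^esub> ?e)"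
        using that by (simp add: A.l_distr A.r_distr)
      then show ?thesis unfolding idem_proj_def by (simp add: add_alg fun_eq_iff)
    qed
    show "idem_proj e (a \<otimes>\<^bsub>alg\<^esub> (\<one>\<^bsub>?B\<^esub> \<otimes>\<^bsub>alg\<^esub> b)) = idem_proj e a \<otimes>\<^bsub>alg\<^esub> idem_proj e b"
      if ab: "a \<in> carrier alg" "b \<in> carrier alg" for a b
    proof -
      have "?e \<otimes>\<^bsub>alg\<^esub> ((a \<otimes>\<^bsub>alg\<^esub> (?e \<otimes>\<^bsub>alg\<^esub> b)) \<otimes>\<^bsub>alg\<^esub> ?e) =
          (?e \<otimes>\<^bsub>alg\<^esub> (a \<otimes>\<^bsub>alg\<^esub> ?e)) \<otimes>\<^bsub>alg\<^esub> (?e \<otimes>\<^bsub>alg\<^esub> (b \<otimes>\<^bsub>alg\<^esub> ?e))"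
        using ab by (simp add: A.m_assoc absorb)
      note eq = this
      show ?thesis
        unfolding idem_proj_def one_B eq
        by (rule mult_alg_restrict[OF e]; rule corner_support[OF e])
    qed
    show "idem_proj e (a \<otimes>\<^bsub>alg\<^esub> \<one>\<^bsub>?B\<^esub>) = idem_proj e a" if "a \<in> carrier alg" for a
    proof -
      have "(a \<otimes>\<^bsub>alg\<^esub> ?e) \<otimes>\<^bsub>alg\<^esub> ?e = a \<otimes>\<^bsub>alg\<^esub> ?e" using that by (simp add: A.m_assoc)
      then show ?thesis by (simp only: idem_proj_def one_B)
    qed
  qed
qed

section \<open>Acting morphisms and the apex of a simple module\<close>

text \<open>Quantifying over the coefficient makes the notion visibly independent of scalars, in
  particular stable under Galois twists of \<open>M\<close>.\<close>

definition acts :: "'m \<Rightarrow> ('m \<Rightarrow> 'k, 'v) module \<Rightarrow> bool" where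
  "acts s M \<longleftrightarrow> (\<exists>c. \<exists>v\<in>carrier M. single c s \<odot>\<^bsub>M\<^esub> v \<noteq> \<zero>\<^bsub>M\<^esub>)"

definition apex :: "'m \<Rightarrow> ('m \<Rightarrow> 'k, 'v) module \<Rightarrow> bool" where
  "apex e M \<longleftrightarrow> acts e M \<and> (\<forall>x\<in>corner_monoid C e - idem_group C e. \<not> acts x M)"

text \<open>Induction over the finite support of \<open>a\<close>: statements about the action of
  the algebra reduce to basis elements with nonzero coefficient in \<open>a\<close>.\<close>

lemma smult_alg_induct:
  assumes M: "left_module alg M" and v: "v \<in> carrier M" and a: "a \<in> carrier alg"
    and P_zero: "P \<zero>\<^bsub>M\<^esub>"
    and P_add: "\<And>x y. x \<in> carrier M \<Longrightarrow> y \<in> carrier M \<Longrightarrow> P x \<Longrightarrow> P y \<Longrightarrow> P (x \<oplus>\<^bsub>M\<^esub> y)"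
    and P_single: "\<And>u. u \<in> Mor C \<Longrightarrow> a u \<noteq> 0 \<Longrightarrow> P (single (a u) u \<odot>\<^bsub>M\<^esub> v)"
  shows "P (a \<odot>\<^bsub>M\<^esub> v)"
proof -
  interpret left_module alg M by (rule M)
  define r where "r F = (\<lambda>u. if u \<in> F then a u else 0)" for F
  have "P (r F \<odot>\<^bsub>M\<^esub> v)" if "finite F" "F \<subseteq> Mor C" for F
    using that
  proof (induction F rule: finite_induct)
    case empty
    have "r {} = \<zero>\<^bsub>alg\<^esub>" by (simp add: r_def zero_alg)
    then show ?case using P_zero v by simp
  next
    case (insert u F)
    show ?case
    proof (cases "a u = 0")
      case True
      then have "r (insert u F) = r F" by (auto simp: r_def)
      then show ?thesis using insert by simp
    next
      case False
      have "r (insert u F) = single (a u) u \<oplus>\<^bsub>alg\<^esub> r F"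
        using insert(2) by (auto simp: r_def add_alg single_def)
      moreover have c: "r F \<in> carrier alg" "single (a u) u \<in> carrier alg"
        using insert.prems by (auto simp: r_def carrier_alg single_def)
      ultimately show ?thesis
        using insert False v P_single P_add by (simp add: smult_l_distr smult_closed)
    qed
  qed
  from this[OF finite_Mor] have "P (r (Mor C) \<odot>\<^bsub>M\<^esub> v)" by simp
  moreover have "r (Mor C) = a" using a by (auto simp: r_def carrier_alg)
  ultimately show ?thesis by simp
qed

context
  fixes M :: "('m \<Rightarrow> 'k, 'v) module"
  assumes M: "left_module alg M"
begin

interpretation left_module alg M by (rule M)

lemma acts_single:
  assumes "\<not> acts s M" "v \<in> carrier M"
  shows "single c s \<odot>\<^bsub>M\<^esub> v = \<zero>\<^bsub>M\<^esub>"
  using assms unfolding acts_def by blast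

text \<open>Up to a nonzero scalar the composite is the product of \<open>t\<close> and
  \<open>s\<close> in the algebra. So the morphisms that do not act form an ideal of the
  category.\<close>

lemma acts_Comp:
  assumes t: "t \<in> Mor C" and s: "s \<in> Mor C" and ts: "Dom C t = Cod C s" and act: "acts (Comp C t s) M"
  shows "acts t M" "acts s M"
proof -
  obtain c v where v: "v \<in> carrier M" "single c (Comp C t s) \<odot>\<^bsub>M\<^esub> v \<noteq> \<zero>\<^bsub>M\<^esub>"
    using act unfolding acts_def by blast
  have "single c (Comp C t s) = single (c / \<alpha> t s) t \<otimes>\<^bsub>alg\<^esub> single 1 s"
    using t s ts cocycle_nonzero[OF t s ts] by (simp add: single_mult)
  then have *: "single (c / \<alpha> t s) t \<odot>\<^bsub>M\<^esub> (single 1 s \<odot>\<^bsub>M\<^esub> v) \<noteq> \<zero>\<^bsub>M\<^esub>"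
    using v t s by (simp add: single_closed smult_assoc)
  have w: "single 1 s \<odot>\<^bsub>M\<^esub> v \<in> carrier M" using v s by (simp add: single_closed smult_closed)
  show "acts t M" unfolding acts_def using * w by blast
  have "single 1 s \<odot>\<^bsub>M\<^esub> v \<noteq> \<zero>\<^bsub>M\<^esub>" using * t by (auto simp: single_closed)
  then show "acts s M" unfolding acts_def using v by blast
qed

text \<open>Since e = t f s acts, so does its factor \<open>f\<close>. An acting \<open>x\<close> in
  the corner of \<open>f\<close> equals s (t x s) t, so t x s acts, is a unit at \<open>e\<close>,
  and conjugates back to a unit at \<open>f\<close>.\<close>

lemma apex_idem_iso:
  assumes e: "idempotent_endo C e" and f: "idempotent_endo C f" and st: "idem_iso_via C e f s t"
    and apex: "apex e M"
  shows "apex f M"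
proof -
  note r = iso_rules[OF e f st]
  have "acts (Comp C t (Comp C f s)) M" using apex r unfolding apex_def by simp
  then have "acts (Comp C f s) M" by (rule acts_Comp(2)[rotated 3]) (use r f in auto)
  then have "acts f M" by (rule acts_Comp(1)[rotated 3]) (use r f in auto)
  moreover have "x \<in> idem_group C f" if x: "x \<in> corner_monoid C f" "acts x M" for x
  proof -
    note ts = idem_iso_via_sym[OF e f st]
    let ?y = "Comp C (Comp C t x) s"
    note xr = corner_monoidD[OF x(1)]
    have y: "?y \<in> corner_monoid C e" "Comp C (Comp C s ?y) t = x"
      using conj_corner[OF f e ts x(1)] by auto
    have "acts (Comp C s ?y) M"
      by (rule acts_Comp(1)[of _ t]) (use r y x corner_monoidD[OF y(1)] in auto)
    then have "acts ?y M" by (rule acts_Comp(2)[rotated 3]) (use r corner_monoidD[OF y(1)] in auto)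
    then have "?y \<in> idem_group C e" using apex y(1) unfolding apex_def by blast
    then show ?thesis using conj_idem_group[OF e f st] y(2) by metis
  qed
  ultimately show ?thesis unfolding apex_def by blast
qed

lemma acts_exists:
  assumes v: "v \<in> carrier M" "v \<noteq> \<zero>\<^bsub>M\<^esub>"
  shows "\<exists>s\<in>Mor C. acts s M"
proof (rule ccontr)
  assume no: "\<not> ?thesis"
  have "\<one>\<^bsub>alg\<^esub> \<odot>\<^bsub>M\<^esub> v = \<zero>\<^bsub>M\<^esub>"
    by (rule smult_alg_induct[OF M v(1)]) (use no v(1) acts_single in auto)
  then show False using v smult_one by simp
qed

end

lemma supported_iff_apex:
  assumes e: "idempotent_endo C e" and M: "left_module alg M"
  shows "ring_corner.supported alg (idem_group_algebra C \<alpha> e) (idem_proj e) M \<longleftrightarrow> apex e M"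
proof -
  interpret r: ring_corner alg "idem_group_algebra C \<alpha> e" "idem_proj e"
    by (rule ring_corner_idem_group_algebra[OF e])
  interpret m: left_module alg M by (rule M)
  let ?e = "idem_elt e"
  note [simp] = idem_elt_closed[OF e] idem_elt_idem[OF e]
  have one_B: "\<one>\<^bsub>idem_group_algebra C \<alpha> e\<^esub> = ?e" by (rule one_idem_group_algebra)
  have acts_e: "acts e M \<longleftrightarrow> (\<exists>x\<in>carrier M. ?e \<odot>\<^bsub>M\<^esub> x \<noteq> \<zero>\<^bsub>M\<^esub>)"
  proof
    assume "acts e M"
    then obtain c v where v: "v \<in> carrier M" "single c e \<odot>\<^bsub>M\<^esub> v \<noteq> \<zero>\<^bsub>M\<^esub>" unfolding acts_def by blast
    have "single c e \<odot>\<^bsub>M\<^esub> v = single c e \<odot>\<^bsub>M\<^esub> (?e \<odot>\<^bsub>M\<^esub> v)"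
      using e v(1) idem_elt_mult_single(2)[OF e, of e c] by (simp add: single_closed flip: m.smult_assoc)
    then have "?e \<odot>\<^bsub>M\<^esub> v \<noteq> \<zero>\<^bsub>M\<^esub>" using v e by (auto simp: single_closed)
    then show "\<exists>x\<in>carrier M. ?e \<odot>\<^bsub>M\<^esub> x \<noteq> \<zero>\<^bsub>M\<^esub>" using v by blast
  qed (auto simp: acts_def idem_elt_def)
  show ?thesis
  proof
    assume s: "r.supported M"
    have "\<not> acts x M" if x: "x \<in> corner_monoid C e" "x \<notin> idem_group C e" for x
    proof -
      have "single c x \<odot>\<^bsub>M\<^esub> v = \<zero>\<^bsub>M\<^esub>" if v: "v \<in> carrier M" for c v
      proof -
        have x': "single c x \<in> carrier alg" using x corner_monoidD by (simp add: single_closed)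
        have eq: "?e \<otimes>\<^bsub>alg\<^esub> (single c x \<otimes>\<^bsub>alg\<^esub> ?e) = single c x"
          using idem_elt_mult_single[OF e, of x c] corner_monoidD[OF x(1)] by simp
        have "idem_proj e (single c x) = \<zero>\<^bsub>alg\<^esub>"
          unfolding idem_proj_def eq using x by (auto simp: single_def zero_alg)
        then show ?thesis
          using s v x' unfolding r.supported_def one_B by (metis eq m.smult_l_null)
      qed
      then show ?thesis unfolding acts_def by blast
    qed
    then show "apex e M" using s acts_e unfolding apex_def r.supported_def one_B by blast
  next
    assume a: "apex e M"
    have "(?e \<otimes>\<^bsub>alg\<^esub> (a \<otimes>\<^bsub>alg\<^esub> ?e)) \<odot>\<^bsub>M\<^esub> x = idem_proj e a \<odot>\<^bsub>M\<^esub> x"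
      if "a \<in> carrier alg" and x: "x \<in> carrier M" for a x
    proof -
      let ?w = "?e \<otimes>\<^bsub>alg\<^esub> (a \<otimes>\<^bsub>alg\<^esub> ?e)"
      \<comment> \<open>\<open>d\<close> is the part of e a e supported on the nonunits of the
        corner monoid. The apex condition annihilates it term by term, leaving the action of
        \<open>idem_proj e a\<close>.\<close>
      define d where "d = (\<lambda>u. if u \<in> idem_group C e then 0 else ?w u)"
      have w: "?w = d \<oplus>\<^bsub>alg\<^esub> idem_proj e a"
        by (auto simp: d_def add_alg idem_proj_def fun_eq_iff)
      have w_closed: "?w \<in> carrier alg" using that by simp
      then have d: "d \<in> carrier alg" by (auto simp: d_def carrier_alg)
      have "d \<odot>\<^bsub>M\<^esub> x = \<zero>\<^bsub>M\<^esub>"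
      proof (rule smult_alg_induct[OF M x d])
        fix u assume "d u \<noteq> 0"
        then have "u \<in> corner_monoid C e - idem_group C e"
          using corner_support[OF e] by (auto simp: d_def split: if_splits)
        then show "single (d u) u \<odot>\<^bsub>M\<^esub> x = \<zero>\<^bsub>M\<^esub>"
          using a acts_single[OF M _ x] unfolding apex_def by blast
      qed simp_all
      then show ?thesis
        unfolding w using d that r.q_closed'[of a] by (simp add: m.smult_l_distr m.smult_closed)
    qed
    then show "r.supported M" using a acts_e unfolding apex_def r.supported_def one_B by blast
  qed
qed

context
  fixes M :: "('m \<Rightarrow> 'k, 'v) module"
  assumes simple: "simple_module alg M"
begin

interpretation left_module alg M by (rule simple_moduleD(1)[OF simple])

text \<open>A nonzero value of \<open>t\<close> generates \<open>M\<close>, so the algebra moves it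
  to a vector that \<open>s\<close> does not kill. If no composite s u t acted, this vector would be
  killed after all. So the ideal of nonacting morphisms is prime.\<close>

lemma acts_between:
  assumes s: "s \<in> Mor C" "acts s M" and t: "t \<in> Mor C" "acts t M"
  obtains u where "u \<in> Mor C" "Dom C s = Cod C u" "Dom C u = Cod C t" "acts (Comp C s (Comp C u t)) M"
proof (rule ccontr)
  assume no: "\<not> thesis"
  note obt = that
  obtain c v where v: "v \<in> carrier M" "single c t \<odot>\<^bsub>M\<^esub> v \<noteq> \<zero>\<^bsub>M\<^esub>" using t unfolding acts_def by blast
  obtain d w where w: "w \<in> carrier M" "single d s \<odot>\<^bsub>M\<^esub> w \<noteq> \<zero>\<^bsub>M\<^esub>" using s unfolding acts_def by blast
  let ?v = "single c t \<odot>\<^bsub>M\<^esub> v"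
  have v': "?v \<in> carrier M" using v t by (simp add: smult_closed single_closed)
  obtain a where a: "a \<in> carrier alg" "a \<odot>\<^bsub>M\<^esub> ?v = w"
    using simple_moduleD(3)[OF simple v' v(2) w(1)] by blast
  have "single d s \<odot>\<^bsub>M\<^esub> (a \<odot>\<^bsub>M\<^esub> ?v) = \<zero>\<^bsub>M\<^esub>"
  proof (rule smult_alg_induct[OF left_module_axioms v' a(1)])
    fix u assume u: "u \<in> Mor C"
    have "single d s \<odot>\<^bsub>M\<^esub> (single (a u) u \<odot>\<^bsub>M\<^esub> ?v) =
        (single d s \<otimes>\<^bsub>alg\<^esub> (single (a u) u \<otimes>\<^bsub>alg\<^esub> single c t)) \<odot>\<^bsub>M\<^esub> v"
      using s t u v(1) by (simp add: smult_assoc single_closed smult_closed)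
    also have "\<dots> = \<zero>\<^bsub>M\<^esub>"
    proof (cases "Dom C s = Cod C u \<and> Dom C u = Cod C t")
      case True
      then have "\<not> acts (Comp C s (Comp C u t)) M" using no obt u by blast
      then show ?thesis
        using True s t u v(1) acts_single[OF left_module_axioms] by (simp add: single_mult)
    next
      case False
      have "single d s \<otimes>\<^bsub>alg\<^esub> \<zero>\<^bsub>alg\<^esub> = \<zero>\<^bsub>alg\<^esub>" using s by (simp add: single_closed)
      then have "single d s \<otimes>\<^bsub>alg\<^esub> (single (a u) u \<otimes>\<^bsub>alg\<^esub> single c t) = \<zero>\<^bsub>alg\<^esub>"
        using False s t u by (auto simp: single_mult)
      then show ?thesis using v(1) by simp
    qed
    finally show "single d s \<odot>\<^bsub>M\<^esub> (single (a u) u \<odot>\<^bsub>M\<^esub> ?v) = \<zero>\<^bsub>M\<^esub>" .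
  qed (use s in \<open>simp_all add: smult_r_distr single_closed\<close>)
  then show False using a w by simp
qed

text \<open>Among the \<open>p \<in> C s\<close> that act nontrivially choose one with the smallest right ideal \<open>p C\<close>. Some \<open>p u s\<close> acts
  nontrivially as well, so \<open>p \<in> p u s C\<close> by minimality. Hence the semigroup of all \<open>q \<in> C s C\<close> with \<open>p q = p\<close> is
  not empty, and its idempotents act nontrivially.\<close>

lemma acts_idempotent:
  assumes s: "s \<in> Mor C" "acts s M"
  obtains f a b where "idempotent_endo C f" "acts f M" "a \<in> Mor C" "b \<in> Mor C" "Dom C a = Cod C s"
    "Dom C s = Cod C b" "f = Comp C a (Comp C s b)"
proof -
  define R where "R p = {Comp C p x | x. x \<in> Mor C \<and> Dom C p = Cod C x}" for p
  have R_sub: "R p \<subseteq> Mor C" if "p \<in> Mor C" for p using that by (auto simp: R_def)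
  define good where "good p \<longleftrightarrow> acts p M \<and> (\<exists>c\<in>Mor C. Dom C c = Cod C s \<and> p = Comp C c s)" for p
  have "good s" using s unfolding good_def by (auto intro!: bexI[of _ "Ident C (Cod C s)"])
  then obtain p where p: "good p" and min: "\<And>p'. good p' \<Longrightarrow> card (R p) \<le> card (R p')"
    using ex_has_least_nat[of good s "\<lambda>p. card (R p)"] by blast
  obtain c where c: "c \<in> Mor C" "Dom C c = Cod C s" "p = Comp C c s" and acts_p: "acts p M"
    using p unfolding good_def by blast
  have p_Mor: "p \<in> Mor C" "Dom C p = Dom C s" using c s by simp_all
  obtain u where u: "u \<in> Mor C" "Dom C p = Cod C u" "Dom C u = Cod C s" "acts (Comp C p (Comp C u s)) M"
    using acts_between[OF p_Mor(1) acts_p s] .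
  let ?p = "Comp C p (Comp C u s)"
  have us: "Comp C u s \<in> Mor C" "Dom C (Comp C u s) = Dom C s" "Cod C (Comp C u s) = Dom C s"
    using u s p_Mor by simp_all
  have "?p = Comp C (Comp C p u) s" using u s p_Mor by (simp add: Comp_assoc)
  then have "good ?p"
    unfolding good_def using u s p_Mor by (intro conjI bexI[of _ "Comp C p u"]) auto
  have "R ?p \<subseteq> R p"
  proof
    fix y assume "y \<in> R ?p"
    then obtain x where "x \<in> Mor C" "Cod C x = Dom C s" "y = Comp C ?p x"
      unfolding R_def using us p_Mor by auto
    then have "y = Comp C p (Comp C (Comp C u s) x)" "Comp C (Comp C u s) x \<in> Mor C"
      "Cod C (Comp C (Comp C u s) x) = Dom C p"
      using us p_Mor Comp_assoc[of p "Comp C u s" x] by simp_all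
    then show "y \<in> R p" unfolding R_def by force
  qed
  moreover have "finite (R p)" using finite_subset[OF R_sub[OF p_Mor(1)] finite_Mor] .
  ultimately have "R ?p = R p"
    using min[OF \<open>good ?p\<close>] by (metis card_seteq)
  moreover have "p \<in> R p"
    unfolding R_def using p_Mor(1) by (auto intro!: exI[of _ "Ident C (Dom C p)"])
  ultimately have "p \<in> R ?p" by simp
  then obtain y where y: "y \<in> Mor C" "Cod C y = Dom C s" "p = Comp C ?p y"
    unfolding R_def using us p_Mor by auto
  have Dom_y: "Dom C y = Dom C s"
    using y us p_Mor Dom_Comp[of ?p y] by simp
  define Q where "Q = {q \<in> Mor C. Dom C q = Dom C s \<and> Cod C q = Dom C s \<and> Comp C p q = p \<and>
    (\<exists>a\<in>Mor C. \<exists>b\<in>Mor C. Dom C a = Cod C s \<and> Dom C s = Cod C b \<and> q = Comp C a (Comp C s b))}"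
  have "Comp C u (Comp C s y) \<in> Q"
  proof -
    have "Comp C ?p y = Comp C p (Comp C u (Comp C s y))"
      using u s y(1,2) p_Mor by (simp add: Comp_assoc)
    then have eq: "Comp C p (Comp C u (Comp C s y)) = p" using y(3) by simp
    have "\<exists>a\<in>Mor C. \<exists>b\<in>Mor C. Dom C a = Cod C s \<and> Dom C s = Cod C b \<and>
        Comp C u (Comp C s y) = Comp C a (Comp C s b)"
      using u(1,3) y(1,2) by (intro bexI[of _ u] bexI[of _ y] conjI refl) auto
    then show ?thesis
      unfolding Q_def using eq u(1-3) s(1) y(1,2) p_Mor(2) Dom_y by simp
  qed
  then have "Q \<noteq> {}" by blast
  moreover have "finite Q" using finite_Mor by (simp add: Q_def)
  moreover have "Comp C q r \<in> Q" if q: "q \<in> Q" and r: "r \<in> Q" for q r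
  proof -
    obtain a b where ab: "a \<in> Mor C" "b \<in> Mor C" "Dom C a = Cod C s" "Dom C s = Cod C b" "q = Comp C a (Comp C s b)"
      using q unfolding Q_def by blast
    have qr: "q \<in> Mor C" "r \<in> Mor C" "Dom C q = Dom C s" "Cod C q = Dom C s" "Dom C r = Dom C s"
      "Cod C r = Dom C s" "Comp C p q = p" "Comp C p r = p"
      using q r by (auto simp: Q_def)
    have b: "Dom C b = Dom C s" using ab s qr(3) by simp
    have "Comp C q r = Comp C a (Comp C s (Comp C b r))"
      using ab(1-4) s qr(2,6) b unfolding ab(5) by (simp add: Comp_assoc)
    moreover have "Comp C p (Comp C q r) = p"
      using qr p_Mor Comp_assoc[of p q r] by simp
    ultimately have eq: "Comp C q r = Comp C a (Comp C s (Comp C b r))" "Comp C p (Comp C q r) = p" .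
    have "\<exists>a\<in>Mor C. \<exists>b\<in>Mor C. Dom C a = Cod C s \<and> Dom C s = Cod C b \<and> Comp C q r = Comp C a (Comp C s b)"
      by (rule bexI[of _ a], rule bexI[of _ "Comp C b r"]) (use eq(1) ab(1-4) qr(2,6) b in simp_all)
    then show ?thesis
      unfolding Q_def using qr(1-6) eq(2) by simp
  qed
  ultimately obtain f where f: "f \<in> Q" "Comp C f f = f"
    using finite_semigroup_idempotent[of Q "Comp C"] by (auto simp: Q_def Comp_assoc)
  have f': "f \<in> Mor C" "Dom C f = Dom C s" "Cod C f = Dom C s" "Comp C p f = p" using f by (auto simp: Q_def)
  have "acts (Comp C p f) M" using f' acts_p by simp
  then have "acts f M"
    by (rule acts_Comp(2)[OF left_module_axioms, rotated 3]) (use f' p_Mor in auto)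
  moreover have "idempotent_endo C f" using f f' by (intro idempotent_endoI) auto
  ultimately show ?thesis using that f(1) unfolding Q_def by blast
qed

text \<open>A nontrivially acting idempotent \<open>e\<close> with the smallest two-sided ideal \<open>C e C\<close> is an apex.\<close>

lemma apex_exists: "\<exists>e. idempotent_endo C e \<and> apex e M"
proof -
  define J where "J e = {Comp C a (Comp C e b) | a b. a \<in> Mor C \<and> b \<in> Mor C \<and> Dom C a = Cod C e \<and> Dom C e = Cod C b}" for e
  have "\<exists>s\<in>Mor C. acts s M"
    using acts_exists[OF left_module_axioms] simple_moduleD(2)[OF simple] by blast
  then obtain e0 where "idempotent_endo C e0 \<and> acts e0 M"
    using acts_idempotent by metis
  then obtain e where e: "idempotent_endo C e" "acts e M"
    and min: "\<And>f. idempotent_endo C f \<Longrightarrow> acts f M \<Longrightarrow> card (J e) \<le> card (J f)"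
    using ex_has_least_nat[of "\<lambda>e. idempotent_endo C e \<and> acts e M" e0 "\<lambda>e. card (J e)"] by blast
  have e': "e \<in> Mor C" "Cod C e = Dom C e" "Comp C e e = e" using e by auto
  have "x \<in> idem_group C e" if x: "x \<in> corner_monoid C e" "acts x M" for x
  proof -
    note xr = corner_monoidD[OF x(1)]
    \<comment> \<open>An acting \<open>x\<close> has an acting idempotent \<open>f\<close> as a
      multiple. Minimality of the ideal of \<open>e\<close> then recovers \<open>e\<close> from
      \<open>f\<close>, hence from \<open>x\<close>, and in the finite corner monoid this forces
      \<open>x\<close> to be a unit.\<close>
    obtain f a b where f: "idempotent_endo C f" "acts f M" "a \<in> Mor C" "b \<in> Mor C" "Dom C a = Dom C e"
      "Cod C b = Dom C e" "f = Comp C a (Comp C x b)"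
      using acts_idempotent[OF xr(1) x(2)] xr by metis
    have fd: "Dom C f = Dom C b" "Cod C f = Cod C a" using f(3-6) xr unfolding f(7) by simp_all
    have expand: "Comp C c (Comp C f d) = Comp C (Comp C c a) (Comp C x (Comp C b d))"
      if "c \<in> Mor C" "d \<in> Mor C" "Dom C c = Cod C f" "Dom C f = Cod C d" for c d
      using that f(3-6) xr fd unfolding f(7) by (simp add: Comp_assoc)
    have "J f \<subseteq> J e"
    proof
      fix y assume "y \<in> J f"
      then obtain c d where cd: "c \<in> Mor C" "d \<in> Mor C" "Dom C c = Cod C f" "Dom C f = Cod C d"
        "y = Comp C c (Comp C f d)" unfolding J_def by blast
      have bd: "Comp C b d \<in> Mor C" "Cod C (Comp C b d) = Dom C e" using cd f(4,6) fd by simp_all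
      have ca: "Comp C c a \<in> Mor C" "Dom C (Comp C c a) = Dom C e" using cd f(3,5) fd by simp_all
      have "y = Comp C (Comp C c a) (Comp C e (Comp C x (Comp C b d)))"
        using expand[OF cd(1-4)] cd(5) corner_assoc(1)[OF e(1) x(1) bd(1)] bd(2) by simp
      then show "y \<in> J e"
        unfolding J_def using bd ca xr e' by force
    qed
    moreover have "finite (J e)"
      by (rule finite_subset[OF _ finite_Mor]) (use e' in \<open>auto simp: J_def\<close>)
    ultimately have "J f = J e" using min[OF f(1,2)] by (metis card_seteq)
    moreover have "e \<in> J e" unfolding J_def using e' by force
    ultimately obtain c d where cd: "c \<in> Mor C" "d \<in> Mor C" "Dom C c = Cod C f" "Dom C f = Cod C d"
      "e = Comp C c (Comp C f d)" unfolding J_def by blast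
    let ?l = "Comp C c a" and ?r = "Comp C b d"
    have l: "?l \<in> Mor C" "Dom C ?l = Dom C e" and r: "?r \<in> Mor C" "Cod C ?r = Dom C e"
      using cd(1-4) f(3-6) fd by simp_all
    have elr: "e = Comp C ?l (Comp C x ?r)" using expand[OF cd(1-4)] cd(5) by simp
    have l': "Cod C ?l = Dom C e"
      using arg_cong[OF elr, of "Cod C"] l r xr e' by simp
    have r': "Dom C ?r = Dom C e"
      using arg_cong[OF elr, of "Dom C"] l r xr by simp
    \<comment> \<open>Compressing by \<open>e\<close> on both sides puts the outer factors into the
      corner monoid. The product is unchanged because \<open>x\<close> absorbs \<open>e\<close> and
      the product is already \<open>e\<close>.\<close>
    let ?l' = "Comp C (Comp C e ?l) e" and ?r' = "Comp C (Comp C e ?r) e"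
    have lc: "?l' \<in> corner_monoid C e" and rc: "?r' \<in> corner_monoid C e"
      using l l' r r' e' corner_monoid_eq[OF e(1)] unfolding Hom_def by blast+
    have "Comp C ?l' (Comp C x ?r') = Comp C (Comp C e (Comp C ?l (Comp C x ?r))) e"
      using l l' r r' xr e' corner_assoc[OF e(1) x(1)] by (simp add: Comp_assoc)
    then have "Comp C ?l' (Comp C x ?r') = e" using elr e' by simp
    then have "Comp C x ?r' \<in> idem_group C e"
      using idem_group_of_product(2)[OF e(1) lc corner_monoid_Comp[OF e(1) x(1) rc]] e(1) by simp
    then show ?thesis using idem_group_of_product(1)[OF e(1) x(1) rc] by simp
  qed
  then show ?thesis using e unfolding apex_def by blast
qed

text \<open>By \<open>acts_between\<close> there is an acting \<open>s\<close> from \<open>e\<close>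
  to \<open>f\<close>, and morphisms \<open>t\<close>, \<open>t'\<close> back such that t s and s t'
  act. Being acting elements of the corner monoids of two apexes, these composites are
  units.\<close>

lemma apex_unique:
  assumes e: "idempotent_endo C e" and f: "idempotent_endo C f" and apex: "apex e M" "apex f M"
  shows "idem_iso C e f"
proof -
  have e': "e \<in> Mor C" "Cod C e = Dom C e" and f': "f \<in> Mor C" "Cod C f = Dom C f" using e f by auto
  have acts_e: "acts e M" and acts_f: "acts f M" using apex unfolding apex_def by auto
  obtain u where u: "u \<in> Mor C" "Dom C f = Cod C u" "Dom C u = Cod C e" "acts (Comp C f (Comp C u e)) M"
    using acts_between[OF f'(1) acts_f e'(1) acts_e] .
  define s where "s = Comp C f (Comp C u e)"
  have s: "s \<in> Mor C" "Dom C s = Dom C e" "Cod C s = Dom C f" "Comp C f s = s" "Comp C s e = s" "acts s M"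
    unfolding s_def using u e f e' f' by (simp_all add: Comp_assoc)
  obtain w where w: "w \<in> Mor C" "Dom C e = Cod C w" "Dom C w = Cod C s" "acts (Comp C e (Comp C w s)) M"
    using acts_between[OF e'(1) acts_e s(1,6)] .
  obtain w' where w': "w' \<in> Mor C" "Dom C s = Cod C w'" "Dom C w' = Cod C f" "acts (Comp C s (Comp C w' f)) M"
    using acts_between[OF s(1,6) f'(1) acts_f] .
  define t where "t = Comp C e (Comp C w f)"
  define t' where "t' = Comp C e (Comp C w' f)"
  have t: "t \<in> Mor C" "Dom C t = Dom C f" "Cod C t = Dom C e" "Comp C e t = t" "Comp C t f = t"
    unfolding t_def using w s e f e' f' by (simp_all add: Comp_assoc)
  have t': "t' \<in> Mor C" "Dom C t' = Dom C f" "Cod C t' = Dom C e" "Comp C e t' = t'" "Comp C t' f = t'"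
    unfolding t'_def using w' s e f e' f' by (simp_all add: Comp_assoc)
  have "Comp C t s = Comp C e (Comp C w s)"
    unfolding t_def using w s f' e' by (simp add: Comp_assoc)
  then have "acts (Comp C t s) M" using w by simp
  moreover have "Comp C t s \<in> corner_monoid C e"
    using t s e' Comp_assoc[of e t s] Comp_assoc[of t s e] by (simp add: corner_monoid_def)
  ultimately have ts: "Comp C t s \<in> idem_group C e" using apex unfolding apex_def by blast
  have "Comp C s t' = Comp C (Comp C s e) (Comp C w' f)"
    unfolding t'_def using w' s(1-3) f' e' by (simp add: Comp_assoc)
  then have "acts (Comp C s t') M" using w' s by simp
  moreover have "Comp C s t' \<in> corner_monoid C f"
    using t' s f' Comp_assoc[of f s t'] Comp_assoc[of s t' f] by (simp add: corner_monoid_def)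
  ultimately have st: "Comp C s t' \<in> idem_group C f" using apex unfolding apex_def by blast
  show ?thesis
    using idem_iso_of_units[OF e f s(1-5) t t' ts st] .
qed

end

end

section \<open>Transporter and orbit categories\<close>

lemma comp_monoid_simps [simp]:
  "carrier (comp_monoid C P u) = P" "x \<otimes>\<^bsub>comp_monoid C P u\<^esub> y = Comp C x y" "\<one>\<^bsub>comp_monoid C P u\<^esub> = u"
  by (simp_all add: comp_monoid_def)

lemma unit_of_eq:
  assumes "group (comp_monoid C P u)"
  shows "unit_of C P = u"
  unfolding unit_of_def
proof (rule the_equality)
  show "group (comp_monoid C P u)" by (rule assms)
  fix v assume v: "group (comp_monoid C P v)"
  have "u \<in> P" "v \<in> P"
    using monoid.one_closed[OF group.is_monoid[OF assms]] monoid.one_closed[OF group.is_monoid[OF v]] by simp_all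
  then show "v = u"
    using monoid.l_one[OF group.is_monoid[OF v], of u] monoid.r_one[OF group.is_monoid[OF assms], of v] by simp
qed

context category
begin

lemma p_subgroupD:
  assumes P: "p_subgroup p C V P"
  shows "group (comp_monoid C P (unit_of C P))"
    and "x \<in> P \<Longrightarrow> x \<in> Mor C" "x \<in> P \<Longrightarrow> Dom C x = V" "x \<in> P \<Longrightarrow> Cod C x = V"
    and "unit_of C P \<in> P"
    and "x \<in> P \<Longrightarrow> y \<in> P \<Longrightarrow> Comp C x y \<in> P"
    and "x \<in> P \<Longrightarrow> Comp C (unit_of C P) x = x" "x \<in> P \<Longrightarrow> Comp C x (unit_of C P) = x"
    and "x \<in> P \<Longrightarrow> \<exists>y\<in>P. Comp C y x = unit_of C P \<and> Comp C x y = unit_of C P"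
    and "idempotent_endo C (unit_of C P)" "Dom C (unit_of C P) = V" "P \<subseteq> idem_group C (unit_of C P)"
proof -
  obtain u where u: "group (comp_monoid C P u)" using P unfolding p_subgroup_def by blast
  have eq: "unit_of C P = u" by (rule unit_of_eq[OF u])
  interpret group "comp_monoid C P u" by (rule u)
  show "group (comp_monoid C P (unit_of C P))" using u eq by simp
  show 1: "x \<in> Mor C" "Dom C x = V" "Cod C x = V" if "x \<in> P" for x
    using P that by (auto simp: p_subgroup_def Hom_def)
  show 2: "unit_of C P \<in> P" using one_closed eq by simp
  show "Comp C x y \<in> P" if "x \<in> P" "y \<in> P" for x y using m_closed[of x y] that by simp
  show 3: "Comp C (unit_of C P) x = x" "Comp C x (unit_of C P) = x" if "x \<in> P" for x
    using l_one[of x] r_one[of x] that eq by simp_all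
  show 4: "\<exists>y\<in>P. Comp C y x = unit_of C P \<and> Comp C x y = unit_of C P" if "x \<in> P" for x
    using l_inv[of x] r_inv[of x] inv_closed[of x] that eq by auto
  show 5: "idempotent_endo C (unit_of C P)"
    using 1[OF 2] 3[OF 2] by (intro idempotent_endoI) auto
  show 6: "Dom C (unit_of C P) = V" by (rule 1(2)[OF 2])
  have "x \<in> corner_monoid C (unit_of C P)" if "x \<in> P" for x
    using 1[OF that] 3[OF that] 6 by (simp add: corner_monoid_def)
  then show "P \<subseteq> idem_group C (unit_of C P)"
    using 4 unfolding idem_group_iff[OF 5] subset_iff by meson
qed

text \<open>The order of the image is the index of the kernel, hence divides a power of
  \<open>p\<close>. As \<open>h\<close> is only multiplicative on \<open>P\<close>, the unit of the
  image is \<open>h (unit_of C P)\<close>, which may be any idempotent.\<close>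

lemma p_subgroup_image:
  assumes p: "Factorial_Ring.prime p" and P: "p_subgroup p C V P"
    and h: "\<And>x. x \<in> P \<Longrightarrow> h x \<in> Hom C W W"
    and h_mult: "\<And>x y. x \<in> P \<Longrightarrow> y \<in> P \<Longrightarrow> h (Comp C x y) = Comp C (h x) (h y)"
  shows "p_subgroup p C W (h ` P)" "unit_of C (h ` P) = h (unit_of C P)"
proof -
  let ?G = "comp_monoid C P (unit_of C P)" and ?H = "comp_monoid C (h ` P) (h (unit_of C P))"
  interpret G: group ?G by (rule p_subgroupD(1)[OF P])
  have hom: "h \<in> hom ?G ?H" using h_mult by (auto simp: hom_def)
  have H: "group ?H"
    using G.hom_imp_img_group[OF hom] by (simp add: comp_monoid_def)
  then interpret H: group ?H .
  interpret gh: group_hom ?G ?H h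
    by (simp add: group_hom_def group_hom_axioms_def hom G.group_axioms H)
  show "unit_of C (h ` P) = h (unit_of C P)" by (rule unit_of_eq[OF H])
  let ?K = "kernel ?G ?H h"
  have "bij_betw (\<lambda>N. the_elem (h ` N)) (rcosets\<^bsub>?G\<^esub> ?K) (h ` P)"
    using gh.FactGroup_iso_set by (auto simp: iso_def FactGroup_def)
  then have "card (h ` P) = card (rcosets\<^bsub>?G\<^esub> ?K)" by (simp add: bij_betw_same_card)
  moreover have "card (rcosets\<^bsub>?G\<^esub> ?K) * card ?K = card P"
    using G.lagrange[OF gh.subgroup_kernel] by (simp add: Coset.order_def)
  ultimately have "card (h ` P) dvd card P" by (metis dvd_triv_left)
  then have "\<exists>n. card (h ` P) = p ^ n"
    using P divides_primepow_nat[OF p] unfolding p_subgroup_def by auto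
  then show "p_subgroup p C W (h ` P)"
    unfolding p_subgroup_def using h H by blast
qed

lemma transporter_Mor_iff:
  "(s, (V, P), (W, Q)) \<in> Mor (transporter_cat p C) \<longleftrightarrow>
    p_subgroup p C V P \<and> p_subgroup p C W Q \<and> s \<in> Mor C \<and> Dom C s = V \<and> Cod C s = W \<and>
    Comp C s (unit_of C P) = s \<and> Comp C (unit_of C Q) s = s \<and> (\<forall>x\<in>P. \<exists>y\<in>Q. Comp C s x = Comp C y s)"
proof -
  have "V \<in> Obj C" if "p_subgroup p C V P" for V P
    using Dom_closed p_subgroupD(2,3,5)[OF that] by metis
  then show ?thesis
    unfolding transporter_cat_def Hom_def by (auto simp: image_subset_iff image_iff)
qed

lemma transporter_Obj_iff: "(V, P) \<in> Obj (transporter_cat p C) \<longleftrightarrow> p_subgroup p C V P"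
proof -
  have "V \<in> Obj C" if "p_subgroup p C V P"
    using Dom_closed p_subgroupD(2,3,5)[OF that] by metis
  then show ?thesis by (auto simp: transporter_cat_def)
qed

context
  fixes p s V P W Q
  assumes m: "(s, (V, P), (W, Q)) \<in> Mor (transporter_cat p C)"
begin

lemma transporterD:
  "p_subgroup p C V P" "p_subgroup p C W Q" "s \<in> Mor C" "Dom C s = V" "Cod C s = W"
  "Comp C s (unit_of C P) = s" "Comp C (unit_of C Q) s = s" "x \<in> P \<Longrightarrow> \<exists>y\<in>Q. Comp C s x = Comp C y s"
  using m unfolding transporter_Mor_iff by blast+

text \<open>Since s P lies in Q s, the right action of \<open>P\<close> is absorbed by the left
  action of \<open>Q\<close>.\<close>

lemma orbit_eq: "orbit C P Q s = (\<lambda>y. Comp C y s) ` Q"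
proof
  note d = transporterD and P = p_subgroupD[OF transporterD(1)] and Q = p_subgroupD[OF transporterD(2)]
  show "orbit C P Q s \<subseteq> (\<lambda>y. Comp C y s) ` Q"
  proof
    fix z assume "z \<in> orbit C P Q s"
    then obtain x y where xy: "x \<in> P" "y \<in> Q" "z = Comp C (Comp C y s) x" unfolding orbit_def by blast
    obtain y' where y': "y' \<in> Q" "Comp C s x = Comp C y' s" using d(8)[OF xy(1)] by blast
    have "z = Comp C y (Comp C s x)"
      using xy(3) d(3-5) P(2-4)[OF xy(1)] Q(2-4)[OF xy(2)] by (simp add: Comp_assoc)
    also have "\<dots> = Comp C (Comp C y y') s"
      unfolding y'(2) using d(3-5) Q(2-4)[OF y'(1)] Q(2-4)[OF xy(2)] by (simp add: Comp_assoc)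
    finally show "z \<in> (\<lambda>y. Comp C y s) ` Q" using Q(6)[OF xy(2) y'(1)] by blast
  qed
  show "(\<lambda>y. Comp C y s) ` Q \<subseteq> orbit C P Q s"
  proof
    fix z assume "z \<in> (\<lambda>y. Comp C y s) ` Q"
    then obtain y where y: "y \<in> Q" "z = Comp C y s" by blast
    have "z = Comp C (Comp C y s) (unit_of C P)"
      using y(2) d(3-6) P(2-4)[OF P(5)] Q(2-4)[OF y(1)] by (simp add: Comp_assoc)
    then show "z \<in> orbit C P Q s" unfolding orbit_def using y P(5) by blast
  qed
qed

lemma orbit_self: "s \<in> orbit C P Q s"
  unfolding orbit_eq using transporterD(7) p_subgroupD(5)[OF transporterD(2)] by (metis imageI)

lemma orbit_of_translate:
  assumes y: "y \<in> Q"
  shows "(Comp C y s, (V, P), (W, Q)) \<in> Mor (transporter_cat p C)"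
    and "orbit C P Q (Comp C y s) = orbit C P Q s"
proof -
  note d = transporterD and P = p_subgroupD[OF transporterD(1)] and Q = p_subgroupD[OF transporterD(2)]
  obtain i where i: "i \<in> Q" "Comp C i y = unit_of C Q" "Comp C y i = unit_of C Q" using Q(9)[OF y] by blast
  note yr = Q(2-4)[OF y] and ir = Q(2-4)[OF i(1)] and ur = Q(2-4)[OF Q(5)]
  have *: "\<exists>z\<in>Q. Comp C (Comp C y s) x = Comp C z (Comp C y s)" if x: "x \<in> P" for x
  proof -
    obtain y' where y': "y' \<in> Q" "Comp C s x = Comp C y' s" using d(8)[OF x] by blast
    note yr' = Q(2-4)[OF y'(1)]
    \<comment> \<open>The witness comes from y s x = y y' s = (y y' i) (y s), where \<open>i\<close>
      is the inverse of \<open>y\<close> in \<open>Q\<close>.\<close>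
    have z: "Comp C (Comp C y y') i \<in> Q" using Q(6) y y'(1) i(1) by blast
    have "Comp C (Comp C (Comp C y y') i) (Comp C y s) = Comp C (Comp C y y') (Comp C (Comp C i y) s)"
      using d(3-5) yr yr' ir by (simp add: Comp_assoc)
    also have "\<dots> = Comp C (Comp C y y') s" unfolding i(2) d(7) ..
    also have "\<dots> = Comp C y (Comp C s x)" unfolding y'(2) using d(3-5) yr yr' by (simp add: Comp_assoc)
    also have "\<dots> = Comp C (Comp C y s) x" using d(3-5) yr P(2-4)[OF x] by (simp add: Comp_assoc)
    finally show ?thesis using z by metis
  qed
  show m': "(Comp C y s, (V, P), (W, Q)) \<in> Mor (transporter_cat p C)"
    unfolding transporter_Mor_iff
  proof (intro conjI)
    show "Comp C (Comp C y s) (unit_of C P) = Comp C y s"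
      using d(3-6) P(2-4)[OF P(5)] yr by (simp add: Comp_assoc)
    show "Comp C (unit_of C Q) (Comp C y s) = Comp C y s"
      using d(3-6) ur yr Q(7)[OF y] by (simp flip: Comp_assoc)
  qed (use * d yr in auto)
  have "orbit C P Q (Comp C y s) = (\<lambda>z. Comp C z (Comp C y s)) ` Q"
    by (rule category.orbit_eq[OF category_axioms m'])
  also have "\<dots> = (\<lambda>z. Comp C z s) ` Q"
  proof
    show "(\<lambda>z. Comp C z (Comp C y s)) ` Q \<subseteq> (\<lambda>z. Comp C z s) ` Q"
    proof
      fix w assume "w \<in> (\<lambda>z. Comp C z (Comp C y s)) ` Q"
      then obtain z where z: "z \<in> Q" "w = Comp C z (Comp C y s)" by blast
      then have "w = Comp C (Comp C z y) s" using d(3-5) yr Q(2-4)[OF z(1)] by (simp add: Comp_assoc)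
      then show "w \<in> (\<lambda>z. Comp C z s) ` Q" using Q(6)[OF z(1) y] by blast
    qed
    show "(\<lambda>z. Comp C z s) ` Q \<subseteq> (\<lambda>z. Comp C z (Comp C y s)) ` Q"
    proof
      fix w assume "w \<in> (\<lambda>z. Comp C z s) ` Q"
      then obtain z where z: "z \<in> Q" "w = Comp C z s" by blast
      have "Comp C (Comp C z i) (Comp C y s) = Comp C z (Comp C (Comp C i y) s)"
        using d(3-5) yr ir Q(2-4)[OF z(1)] by (simp add: Comp_assoc)
      then have "w = Comp C (Comp C z i) (Comp C y s)" unfolding i(2) d(7) z(2) ..
      then show "w \<in> (\<lambda>z. Comp C z (Comp C y s)) ` Q" using Q(6)[OF z(1) i(1)] by blast
    qed
  qed
  finally show "orbit C P Q (Comp C y s) = orbit C P Q s" unfolding orbit_eq .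
qed

end

text \<open>Elements of \<open>Q\<close> move past \<open>t\<close> into \<open>R\<close>, so the
  elementwise product of R t and Q s is R t s. This is why composition of orbits is well
  defined.\<close>

lemma transporter_Comp:
  assumes t: "(t, (W, Q), (Z, R)) \<in> Mor (transporter_cat p C)" and s: "(s, (V, P), (W, Q)) \<in> Mor (transporter_cat p C)"
  shows "(Comp C t s, (V, P), (Z, R)) \<in> Mor (transporter_cat p C)"
    and "{Comp C t' s' | t' s'. t' \<in> orbit C Q R t \<and> s' \<in> orbit C P Q s} = orbit C P R (Comp C t s)"
proof -
  note dt = transporterD[OF t] and ds = transporterD[OF s]
  note P = p_subgroupD[OF ds(1)] and Q = p_subgroupD[OF ds(2)] and R = p_subgroupD[OF dt(2)]
  have *: "\<exists>z\<in>R. Comp C (Comp C t s) x = Comp C z (Comp C t s)" if x: "x \<in> P" for x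
  proof -
    obtain y where y: "y \<in> Q" "Comp C s x = Comp C y s" using ds(8)[OF x] by blast
    obtain z where z: "z \<in> R" "Comp C t y = Comp C z t" using dt(8)[OF y(1)] by blast
    have "Comp C (Comp C t s) x = Comp C t (Comp C s x)"
      using dt(3-5) ds(3-5) P(2-4)[OF x] by (simp add: Comp_assoc)
    also have "\<dots> = Comp C (Comp C t y) s"
      unfolding y(2) using dt(3-5) ds(3-5) Q(2-4)[OF y(1)] by (simp add: Comp_assoc)
    also have "\<dots> = Comp C z (Comp C t s)"
      unfolding z(2) using dt(3-5) ds(3-5) R(2-4)[OF z(1)] by (simp add: Comp_assoc)
    finally show ?thesis using z(1) by blast
  qed
  show m: "(Comp C t s, (V, P), (Z, R)) \<in> Mor (transporter_cat p C)"
    unfolding transporter_Mor_iff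
  proof (intro conjI)
    show "Comp C (Comp C t s) (unit_of C P) = Comp C t s"
      using dt(3-6) ds(3-6) P(2-4)[OF P(5)] by (simp add: Comp_assoc)
    show "Comp C (unit_of C R) (Comp C t s) = Comp C t s"
      using dt(3-5,7) ds(3-5) R(2-4)[OF R(5)] by (simp flip: Comp_assoc)
  qed (use * dt ds in auto)
  show "{Comp C t' s' | t' s'. t' \<in> orbit C Q R t \<and> s' \<in> orbit C P Q s} = orbit C P R (Comp C t s)"
    unfolding orbit_eq[OF m] orbit_eq[OF t] orbit_eq[OF s]
  proof
    show "{Comp C t' s' | t' s'. t' \<in> (\<lambda>y. Comp C y t) ` R \<and> s' \<in> (\<lambda>y. Comp C y s) ` Q} \<subseteq> (\<lambda>y. Comp C y (Comp C t s)) ` R"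
    proof clarify
      fix y z assume z: "z \<in> R" and y: "y \<in> Q"
      obtain w where w: "w \<in> R" "Comp C t y = Comp C w t" using dt(8)[OF y] by blast
      have "Comp C (Comp C z t) (Comp C y s) = Comp C z (Comp C (Comp C t y) s)"
        using dt(3-5) ds(3-5) Q(2-4)[OF y] R(2-4)[OF z] by (simp add: Comp_assoc)
      also have "\<dots> = Comp C (Comp C z w) (Comp C t s)"
        unfolding w(2) using dt(3-5) ds(3-5) R(2-4)[OF z] R(2-4)[OF w(1)] by (simp add: Comp_assoc)
      finally show "Comp C (Comp C z t) (Comp C y s) \<in> (\<lambda>y. Comp C y (Comp C t s)) ` R"
        using R(6)[OF z w(1)] by blast
    qed
    show "(\<lambda>y. Comp C y (Comp C t s)) ` R \<subseteq> {Comp C t' s' | t' s'. t' \<in> (\<lambda>y. Comp C y t) ` R \<and> s' \<in> (\<lambda>y. Comp C y s) ` Q}"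
    proof clarify
      fix z assume z: "z \<in> R"
      have "Comp C z (Comp C t s) = Comp C (Comp C z t) (Comp C (unit_of C Q) s)"
        unfolding ds(7) using dt(3-5) ds(3-5) R(2-4)[OF z] by (simp add: Comp_assoc)
      then show "\<exists>t' s'. Comp C z (Comp C t s) = Comp C t' s' \<and> t' \<in> (\<lambda>y. Comp C y t) ` R \<and> s' \<in> (\<lambda>y. Comp C y s) ` Q"
        using z Q(5) by blast
    qed
  qed
qed

lemma transporter_Ident:
  assumes P: "p_subgroup p C V P"
  shows "(unit_of C P, (V, P), (V, P)) \<in> Mor (transporter_cat p C)"
    and "orbit C P P (unit_of C P) = P"
proof -
  note P' = p_subgroupD[OF P]
  show m: "(unit_of C P, (V, P), (V, P)) \<in> Mor (transporter_cat p C)"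
    unfolding transporter_Mor_iff using P P'(2-5,7,8) by auto
  show "orbit C P P (unit_of C P) = P"
    unfolding orbit_eq[OF m] using P'(8) by simp
qed

end

lemma orbit_cat_simps [simp]:
  "Obj (orbit_cat p C) = Obj (transporter_cat p C)"
  "Mor (orbit_cat p C) = orbit_of C ` Mor (transporter_cat p C)"
  "Dom (orbit_cat p C) (S, a, b) = a" "Cod (orbit_cat p C) (S, a, b) = b"
  "Ident (orbit_cat p C) (V, P) = (orbit C P P (unit_of C P), (V, P), (V, P))"
  "Comp (orbit_cat p C) (T, b', c) (S, a, b) = ({Comp C t s | t s. t \<in> T \<and> s \<in> S}, a, c)"
  by (simp_all add: orbit_cat_def transporter_cat_def)

context category
begin

lemma orbit_MorE:
  assumes "F \<in> Mor (orbit_cat p C)"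
  obtains s V P W Q where "F = (orbit C P Q s, (V, P), (W, Q))"
    "(s, (V, P), (W, Q)) \<in> Mor (transporter_cat p C)"
  using assms by auto

lemma orbit_MorI:
  "(s, (V, P), (W, Q)) \<in> Mor (transporter_cat p C) \<Longrightarrow> (orbit C P Q s, (V, P), (W, Q)) \<in> Mor (orbit_cat p C)"
  by (force simp: image_iff)

lemma orbit_Comp:
  assumes "(t, (W, Q), (Z, R)) \<in> Mor (transporter_cat p C)" "(s, (V, P), (W, Q)) \<in> Mor (transporter_cat p C)"
  shows "Comp (orbit_cat p C) (orbit C Q R t, (W, Q), (Z, R)) (orbit C P Q s, (V, P), (W, Q)) =
    (orbit C P R (Comp C t s), (V, P), (Z, R))"
  using transporter_Comp(2)[OF assms] by simp

lemma category_orbit_cat: "category (orbit_cat p C)"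
proof
  let ?O = "orbit_cat p C"
  show "Dom ?O F \<in> Obj ?O" if F: "F \<in> Mor ?O" for F
    by (rule orbit_MorE[OF F]) (simp add: transporter_Obj_iff transporterD(1))
  show "Cod ?O F \<in> Obj ?O" if F: "F \<in> Mor ?O" for F
    by (rule orbit_MorE[OF F]) (simp add: transporter_Obj_iff transporterD(2))
  show "Ident ?O A \<in> Mor ?O" "Dom ?O (Ident ?O A) = A" "Cod ?O (Ident ?O A) = A" if A: "A \<in> Obj ?O" for A
  proof -
    obtain V P where [simp]: "A = (V, P)" by (cases A)
    have "p_subgroup p C V P" using A by (simp add: transporter_Obj_iff)
    then show "Ident ?O A \<in> Mor ?O" using orbit_MorI[OF transporter_Ident(1)] by (simp del: orbit_cat_simps(2))
    show "Dom ?O (Ident ?O A) = A" "Cod ?O (Ident ?O A) = A" by simp_all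
  qed
  show "Comp ?O G F \<in> Mor ?O" "Dom ?O (Comp ?O G F) = Dom ?O F" "Cod ?O (Comp ?O G F) = Cod ?O G"
    if G: "G \<in> Mor ?O" and F: "F \<in> Mor ?O" and GF: "Dom ?O G = Cod ?O F" for G F
  proof -
    obtain s V P W Q where F': "F = (orbit C P Q s, (V, P), (W, Q))" "(s, (V, P), (W, Q)) \<in> Mor (transporter_cat p C)"
      by (rule orbit_MorE[OF F])
    obtain t W' Q' Z R where G': "G = (orbit C Q' R t, (W', Q'), (Z, R))" "(t, (W', Q'), (Z, R)) \<in> Mor (transporter_cat p C)"
      by (rule orbit_MorE[OF G])
    have [simp]: "W' = W" "Q' = Q" using GF F' G' by simp_all
    have eq: "Comp ?O G F = (orbit C P R (Comp C t s), (V, P), (Z, R))"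
      using orbit_Comp[of t W Q Z R p s V P] F' G' by simp
    show "Comp ?O G F \<in> Mor ?O"
      unfolding eq by (rule orbit_MorI, rule transporter_Comp(1)) (use F' G' in auto)
    show "Dom ?O (Comp ?O G F) = Dom ?O F" "Cod ?O (Comp ?O G F) = Cod ?O G"
      unfolding eq using F' G' by simp_all
  qed
  show "Comp ?O F (Ident ?O (Dom ?O F)) = F" "Comp ?O (Ident ?O (Cod ?O F)) F = F" if F: "F \<in> Mor ?O" for F
  proof -
    obtain s V P W Q where F': "F = (orbit C P Q s, (V, P), (W, Q))" "(s, (V, P), (W, Q)) \<in> Mor (transporter_cat p C)"
      by (rule orbit_MorE[OF F])
    note d = transporterD[OF F'(2)]
    show "Comp ?O F (Ident ?O (Dom ?O F)) = F"
      using orbit_Comp[OF F'(2) transporter_Ident(1)[OF d(1)]] d(6) F'(1) by simp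
    show "Comp ?O (Ident ?O (Cod ?O F)) F = F"
      using orbit_Comp[OF transporter_Ident(1)[OF d(2)] F'(2)] d(7) F'(1) by simp
  qed
  show "Comp ?O (Comp ?O H G) F = Comp ?O H (Comp ?O G F)"
    if H: "H \<in> Mor ?O" and G: "G \<in> Mor ?O" and F: "F \<in> Mor ?O" and HG: "Dom ?O H = Cod ?O G" and GF: "Dom ?O G = Cod ?O F"
    for H G F
  proof -
    obtain s V P W Q where F': "F = (orbit C P Q s, (V, P), (W, Q))" "(s, (V, P), (W, Q)) \<in> Mor (transporter_cat p C)"
      by (rule orbit_MorE[OF F])
    obtain t W' Q' Z R where G': "G = (orbit C Q' R t, (W', Q'), (Z, R))" "(t, (W', Q'), (Z, R)) \<in> Mor (transporter_cat p C)"
      by (rule orbit_MorE[OF G])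
    obtain u Z' R' Y S where H': "H = (orbit C R' S u, (Z', R'), (Y, S))" "(u, (Z', R'), (Y, S)) \<in> Mor (transporter_cat p C)"
      by (rule orbit_MorE[OF H])
    have eq: "W' = W" "Q' = Q" "Z' = Z" "R' = R" using GF HG F'(1) G'(1) H'(1) by simp_all
    note ms = F'(2) G'(2)[unfolded eq] H'(2)[unfolded eq]
    note d = transporterD(3-5)[OF ms(1)] transporterD(3-5)[OF ms(2)] transporterD(3-5)[OF ms(3)]
    show ?thesis
      unfolding F'(1) G'(1) H'(1) eq orbit_Comp[OF ms(3,2)] orbit_Comp[OF ms(2,1)]
        orbit_Comp[OF transporter_Comp(1)[OF ms(3,2)] ms(1)] orbit_Comp[OF ms(3) transporter_Comp(1)[OF ms(2,1)]]
      using d by (simp add: Comp_assoc)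
  qed
qed

end

context fin_category
begin

lemma fin_category_orbit_cat: "fin_category (orbit_cat p C)"
proof -
  have "Obj C \<subseteq> Dom C ` Mor C" by (auto simp: image_iff) (metis Dom_Ident Ident_Mor)
  then have Obj: "finite (Obj C)" using finite_Mor finite_surj by blast
  let ?A = "Obj C \<times> Pow (Mor C)"
  have "Mor (orbit_cat p C) \<subseteq> Pow (Mor C) \<times> ?A \<times> ?A"
  proof
    fix F assume "F \<in> Mor (orbit_cat p C)"
    then obtain s V P W Q where F: "F = (orbit C P Q s, (V, P), (W, Q))"
      and m: "(s, (V, P), (W, Q)) \<in> Mor (transporter_cat p C)"
      by (rule orbit_MorE)
    note d = transporterD[OF m]
    note P = p_subgroupD[OF d(1)] and Q = p_subgroupD[OF d(2)]
    have "V \<in> Obj C" "W \<in> Obj C" using Dom_closed[OF P(2)[OF P(5)]] Dom_closed[OF Q(2)[OF Q(5)]] P(11) Q(11) by auto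
    moreover have "orbit C P Q s \<subseteq> Mor C" unfolding orbit_eq[OF m] using d(3,5) Q(2,3) by auto
    ultimately show "F \<in> Pow (Mor C) \<times> ?A \<times> ?A" unfolding F using P(2) Q(2) by auto
  qed
  then have "finite (Mor (orbit_cat p C))"
    by (rule finite_subset) (use Obj finite_Mor in auto)
  then show ?thesis
    using category_orbit_cat by (simp add: fin_category_def fin_category_axioms_def)
qed

end

section \<open>Idempotents of orbit categories\<close>

text \<open>The identity of (V, P) in the orbit category: the orbit of the unit of \<open>P\<close>
  under \<open>P\<close> is \<open>P\<close> itself.\<close>

abbreviation orbit_id :: "'o \<Rightarrow> 'm set \<Rightarrow> 'm set \<times> ('o \<times> 'm set) \<times> ('o \<times> 'm set)" where
  "orbit_id V P \<equiv> (P, (V, P), (V, P))"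

context category
begin

lemma Ident_orbit_cat:
  assumes "p_subgroup p C V P"
  shows "Ident (orbit_cat p C) (V, P) = orbit_id V P"
  using transporter_Ident(2)[OF assms] by simp

lemma idempotent_endo_orbit_id:
  assumes P: "p_subgroup p C V P"
  shows "idempotent_endo (orbit_cat p C) (orbit_id V P)"
  using category.idempotent_endo_Ident[OF category_orbit_cat, of "(V, P)"] P
  unfolding Ident_orbit_cat[OF P, symmetric] by (simp add: transporter_Obj_iff)

lemma idem_iso_via_orbit_id:
  assumes m: "(s, (V, P), (W, Q)) \<in> Mor (transporter_cat p C)" and m': "(t, (W, Q), (V, P)) \<in> Mor (transporter_cat p C)"
    and E: "idempotent_endo (orbit_cat p C) E" "Dom (orbit_cat p C) E = (V, P)"
    and se: "Comp (orbit_cat p C) (orbit C P Q s, (V, P), (W, Q)) E = (orbit C P Q s, (V, P), (W, Q))"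
    and et: "Comp (orbit_cat p C) E (orbit C Q P t, (W, Q), (V, P)) = (orbit C Q P t, (W, Q), (V, P))"
    and ts: "(orbit C P P (Comp C t s), (V, P), (V, P)) = E" and st: "Comp C s t = unit_of C Q"
  shows "idem_iso_via (orbit_cat p C) E (orbit_id W Q) (orbit C P Q s, (V, P), (W, Q)) (orbit C Q P t, (W, Q), (V, P))"
proof -
  let ?O = "orbit_cat p C"
  have Q: "p_subgroup p C W Q" using transporterD(2)[OF m] .
  interpret O: category ?O by (rule category_orbit_cat)
  show ?thesis
    unfolding O.idem_iso_via_iff[OF E(1) idempotent_endo_orbit_id[OF Q]] E(2)
  proof (intro conjI)
    show "(orbit C P Q s, (V, P), (W, Q)) \<in> Mor ?O" by (rule orbit_MorI[OF m])
    show "(orbit C Q P t, (W, Q), (V, P)) \<in> Mor ?O" by (rule orbit_MorI[OF m'])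
    show "Comp ?O (orbit_id W Q) (orbit C P Q s, (V, P), (W, Q)) = (orbit C P Q s, (V, P), (W, Q))"
      using O.Ident_Comp[OF orbit_MorI[OF m]] unfolding Ident_orbit_cat[OF Q, symmetric] by simp
    show "Comp ?O (orbit C Q P t, (W, Q), (V, P)) (orbit_id W Q) = (orbit C Q P t, (W, Q), (V, P))"
      using O.Comp_Ident[OF orbit_MorI[OF m']] unfolding Ident_orbit_cat[OF Q, symmetric] by simp
    show "Comp ?O (orbit C Q P t, (W, Q), (V, P)) (orbit C P Q s, (V, P), (W, Q)) = E"
      unfolding orbit_Comp[OF m' m] by (rule ts)
    show "Comp ?O (orbit C P Q s, (V, P), (W, Q)) (orbit C Q P t, (W, Q), (V, P)) = orbit_id W Q"
      unfolding orbit_Comp[OF m m'] st transporter_Ident(2)[OF Q] ..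
  qed (use se et in simp_all)
qed

text \<open>On representatives, being mutually inverse only means that t s lies in \<open>P\<close>
  and s t in \<open>Q\<close>. This suffices later on, because the elements of \<open>P\<close> are
  units at \<open>unit_of C P\<close>.\<close>

lemma orbit_id_isoE:
  assumes P: "p_subgroup p C V P" and Q: "p_subgroup p C W Q"
    and iso: "idem_iso_via (orbit_cat p C) (orbit_id V P) (orbit_id W Q) S T"
  obtains s t where "S = (orbit C P Q s, (V, P), (W, Q))" "T = (orbit C Q P t, (W, Q), (V, P))"
    "(s, (V, P), (W, Q)) \<in> Mor (transporter_cat p C)" "(t, (W, Q), (V, P)) \<in> Mor (transporter_cat p C)"
    "Comp C t s \<in> P" "Comp C s t \<in> Q"
proof -
  let ?O = "orbit_cat p C"
  note r = category.iso_rules[OF category_orbit_cat idempotent_endo_orbit_id[OF P] idempotent_endo_orbit_id[OF Q] iso]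
  obtain s A A' B B' where "S = (orbit C A' B' s, (A, A'), (B, B'))" "(s, (A, A'), (B, B')) \<in> Mor (transporter_cat p C)"
    by (rule orbit_MorE[OF r(1)])
  then have s: "S = (orbit C P Q s, (V, P), (W, Q))" "(s, (V, P), (W, Q)) \<in> Mor (transporter_cat p C)"
    using r(2,3) by simp_all
  obtain t A A' B B' where "T = (orbit C A' B' t, (A, A'), (B, B'))" "(t, (A, A'), (B, B')) \<in> Mor (transporter_cat p C)"
    by (rule orbit_MorE[OF r(6)])
  then have t: "T = (orbit C Q P t, (W, Q), (V, P))" "(t, (W, Q), (V, P)) \<in> Mor (transporter_cat p C)"
    using r(7,8) by simp_all
  have "orbit C P P (Comp C t s) = P" "orbit C Q Q (Comp C s t) = Q"
    using r(11,12) orbit_Comp[OF t(2) s(2)] orbit_Comp[OF s(2) t(2)] unfolding s(1) t(1) by simp_all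
  then have "Comp C t s \<in> P" "Comp C s t \<in> Q"
    using orbit_self[OF transporter_Comp(1)[OF t(2) s(2)]] orbit_self[OF transporter_Comp(1)[OF s(2) t(2)]] by simp_all
  then show ?thesis using that s t by blast
qed

text \<open>The composites of the representatives lie in \<open>P\<close> and \<open>Q\<close>,
  hence are units at the two idempotents, so \<open>idem_iso_of_units\<close> applies. This
  separates the weights that belong to different representatives \<open>e\<close>.\<close>

lemma idem_iso_if_orbit_id_iso:
  assumes P: "p_subgroup p C V P" and Q: "p_subgroup p C W Q"
    and iso: "idem_iso (orbit_cat p C) (orbit_id V P) (orbit_id W Q)"
  shows "idem_iso C (unit_of C P) (unit_of C Q)"
proof -
  obtain S T where ST: "idem_iso_via (orbit_cat p C) (orbit_id V P) (orbit_id W Q) S T"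
    using iso unfolding idem_iso_def by blast
  obtain s t where s: "(s, (V, P), (W, Q)) \<in> Mor (transporter_cat p C)" and t: "(t, (W, Q), (V, P)) \<in> Mor (transporter_cat p C)"
    and ts: "Comp C t s \<in> P" and st: "Comp C s t \<in> Q"
    by (rule orbit_id_isoE[OF P Q ST])
  note s' = transporterD[OF s] and t' = transporterD[OF t]
  note P' = p_subgroupD[OF P] and Q' = p_subgroupD[OF Q]
  show ?thesis
    by (rule idem_iso_of_units[OF P'(10) Q'(10), of s t t]) (use s' t' P'(11,12) Q'(11,12) ts st in auto)
qed

end

context fin_category
begin

text \<open>If \<open>E\<close> is the orbit \<open>P s\<close> then \<open>P s\<close> is a semigroup, hence contains an idempotent \<open>f\<close>. Since
  \<open>f P \<subseteq> P f\<close>, left multiplication by \<open>f\<close> is multiplicative on \<open>P\<close>, and \<open>E\<close> is isomorphic to the identity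
  of the \<open>p\<close>-subgroup \<open>f P\<close>.\<close>

lemma orbit_idempotent_iso_id:
  assumes p: "Factorial_Ring.prime p" and E: "idempotent_endo (orbit_cat p C) E"
  obtains V Q where "p_subgroup p C V Q" "idem_iso (orbit_cat p C) E (orbit_id V Q)"
proof -
  let ?O = "orbit_cat p C"
  note E' = category.idempotent_endoD[OF category_orbit_cat E]
  obtain s V P W P' where s0: "E = (orbit C P P' s, (V, P), (W, P'))" "(s, (V, P), (W, P')) \<in> Mor (transporter_cat p C)"
    by (rule orbit_MorE[OF E'(1)])
  then have s: "E = (orbit C P P s, (V, P), (V, P))" "(s, (V, P), (V, P)) \<in> Mor (transporter_cat p C)"
    using E'(2) by simp_all
  note d = transporterD[OF s(2)]
  note P = p_subgroupD[OF d(1)]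
  let ?S = "orbit C P P s"
  have closed: "{Comp C t s' | t s'. t \<in> ?S \<and> s' \<in> ?S} = ?S" using E'(3) s(1) by simp
  have S_Mor: "x \<in> Mor C \<and> Dom C x = V \<and> Cod C x = V" if "x \<in> ?S" for x
    using that d(3-5) P(2-4) unfolding orbit_eq[OF s(2)] by auto
  then have "finite ?S" using finite_subset[OF _ finite_Mor] by blast
  moreover have "?S \<noteq> {}" using orbit_self[OF s(2)] by blast
  moreover have "Comp C x y \<in> ?S" if "x \<in> ?S" "y \<in> ?S" for x y using closed that by blast
  ultimately obtain f where f: "f \<in> ?S" "Comp C f f = f"
    using finite_semigroup_idempotent[of ?S "Comp C"] S_Mor by (auto simp: Comp_assoc)
  obtain y where y: "y \<in> P" "f = Comp C y s" using f(1) unfolding orbit_eq[OF s(2)] by blast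
  have m: "(f, (V, P), (V, P)) \<in> Mor (transporter_cat p C)" and orbit_f: "orbit C P P f = ?S"
    using orbit_of_translate[OF s(2) y(1)] unfolding y(2) by auto
  note d = transporterD[OF m]
  have fP: "\<exists>y\<in>P. Comp C f x = Comp C y f" if "x \<in> P" for x using d(8)[OF that] .
  \<comment> \<open>As f x = z f for some \<open>z\<close> in \<open>P\<close>, a further factor
    \<open>f\<close> on the right is absorbed. This is what makes left multiplication by
    \<open>f\<close> multiplicative on \<open>P\<close>.\<close>
  have fxf: "Comp C (Comp C f x) f = Comp C f x" if x: "x \<in> P" for x
  proof -
    obtain z where z: "z \<in> P" "Comp C f x = Comp C z f" using fP[OF x] by blast
    have "Comp C (Comp C z f) f = Comp C z (Comp C f f)"
      using d(3-5) P(2-4)[OF z(1)] by (intro Comp_assoc) simp_all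
    then show ?thesis unfolding z(2) f(2) .
  qed
  let ?Q = "Comp C f ` P"
  have hom: "Comp C f (Comp C x z) = Comp C (Comp C f x) (Comp C f z)" if "x \<in> P" "z \<in> P" for x z
  proof -
    have "Comp C (Comp C f x) (Comp C f z) = Comp C (Comp C (Comp C f x) f) z"
      using d(3-5) P(2-4)[OF that(1)] P(2-4)[OF that(2)] by (simp add: Comp_assoc)
    then show ?thesis
      unfolding fxf[OF that(1)] using d(3-5) P(2-4)[OF that(1)] P(2-4)[OF that(2)] by (simp add: Comp_assoc)
  qed
  have h_Hom: "Comp C f x \<in> Hom C V V" if "x \<in> P" for x
    using d(3-5) P(2-4)[OF that] by (simp add: Hom_def)
  have Q: "p_subgroup p C V ?Q" and unit_Q: "unit_of C ?Q = f"
    using p_subgroup_image[OF p d(1) h_Hom hom] d(6) by auto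
  \<comment> \<open>The same \<open>f\<close> represents the isomorphism and its inverse. Both
    composites are f f = f, which represents \<open>E\<close> at (V, P) and is the unit of
    \<open>?Q\<close>.\<close>
  have m1: "(f, (V, P), (V, ?Q)) \<in> Mor (transporter_cat p C)"
    unfolding transporter_Mor_iff unit_Q
  proof (intro conjI ballI)
    show "\<exists>y\<in>?Q. Comp C f x = Comp C y f" if "x \<in> P" for x
      using that fxf[OF that] by (intro bexI[of _ "Comp C f x"]) auto
  qed (use d(1,3-6) Q f(2) in auto)
  have m2: "(f, (V, ?Q), (V, P)) \<in> Mor (transporter_cat p C)"
    unfolding transporter_Mor_iff unit_Q
  proof (intro conjI ballI)
    show "\<exists>y\<in>P. Comp C f z = Comp C y f" if "z \<in> ?Q" for z
    proof -
      obtain x where x: "x \<in> P" "z = Comp C f x" using \<open>z \<in> ?Q\<close> by blast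
      have "Comp C f z = Comp C (Comp C f f) x"
        unfolding x(2) using d(3-5) P(2-4)[OF x(1)] by (intro Comp_assoc[symmetric]) simp_all
      then show ?thesis using fP[OF x(1)] f(2) by simp
    qed
  qed (use d(1,3-7) Q f(2) in auto)
  have E_eq: "E = (orbit C P P f, (V, P), (V, P))" using s(1) orbit_f by simp
  have "idem_iso_via ?O E (orbit_id V ?Q) (orbit C P ?Q f, (V, P), (V, ?Q)) (orbit C ?Q P f, (V, ?Q), (V, P))"
  proof (rule idem_iso_via_orbit_id[OF m1 m2 E])
    show "Dom ?O E = (V, P)" using s(1) by simp
    show "Comp ?O (orbit C P ?Q f, (V, P), (V, ?Q)) E = (orbit C P ?Q f, (V, P), (V, ?Q))"
      unfolding E_eq orbit_Comp[OF m1 m] f(2) ..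
    show "Comp ?O E (orbit C ?Q P f, (V, ?Q), (V, P)) = (orbit C ?Q P f, (V, ?Q), (V, P))"
      unfolding E_eq orbit_Comp[OF m m2] f(2) ..
    show "(orbit C P P (Comp C f f), (V, P), (V, P)) = E" unfolding f(2) E_eq ..
    show "Comp C f f = unit_of C ?Q" unfolding f(2) unit_Q ..
  qed
  then show ?thesis using that[OF Q] unfolding idem_iso_def by blast
qed

text \<open>The new subgroup is the conjugate s Q t, and \<open>s\<close>, \<open>t\<close>
  intertwine it with \<open>Q\<close>. This moves a \<open>p\<close>-subgroup to any idempotent
  isomorphic to its unit, in particular to the chosen representative.\<close>

lemma orbit_id_iso_conj:
  assumes p: "Factorial_Ring.prime p" and Q: "p_subgroup p C V Q"
    and e: "idempotent_endo C e" and iso: "idem_iso C (unit_of C Q) e"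
  obtains Q' where "p_subgroup p C (Dom C e) Q'" "unit_of C Q' = e"
    "idem_iso (orbit_cat p C) (orbit_id V Q) (orbit_id (Dom C e) Q')"
proof -
  note Q' = p_subgroupD[OF Q]
  let ?u = "unit_of C Q" and ?O = "orbit_cat p C" and ?W = "Dom C e"
  obtain s t where st: "idem_iso_via C ?u e s t" using iso unfolding idem_iso_def by blast
  note r = iso_rules[OF Q'(10) e st]
  have Dom_u: "Dom C ?u = V" by (rule Q'(11))
  define h where "h x = Comp C (Comp C s x) t" for x
  have corner: "x \<in> corner_monoid C ?u" if "x \<in> Q" for x
    using Q'(12) that idem_group_corner[OF Q'(10)] by blast
  have h_Hom: "h x \<in> Hom C ?W ?W" if "x \<in> Q" for x
    using corner_monoidD[OF conj_corner(1)[OF Q'(10) e st corner[OF that]]] unfolding h_def Hom_def by simp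
  have h_mult: "h (Comp C x y) = Comp C (h x) (h y)" if "x \<in> Q" "y \<in> Q" for x y
    unfolding h_def using conj_mult[OF Q'(10) e st corner[OF that(1)] corner[OF that(2)]] by simp
  have hQ: "p_subgroup p C ?W (h ` Q)" and unit: "unit_of C (h ` Q) = e"
    using p_subgroup_image[OF p Q h_Hom h_mult] conj_unit[OF Q'(10) e st] by (auto simp: h_def)
  have m1: "(s, (V, Q), (?W, h ` Q)) \<in> Mor (transporter_cat p C)"
    unfolding transporter_Mor_iff unit
  proof (intro conjI ballI)
    show "\<exists>y\<in>h ` Q. Comp C s x = Comp C y s" if x: "x \<in> Q" for x
    proof (rule bexI)
      have "Comp C (h x) s = Comp C (Comp C s x) (Comp C t s)"
        unfolding h_def using r Q'(2-4)[OF x] Dom_u by (intro Comp_assoc) simp_all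
      also have "\<dots> = Comp C s (Comp C x ?u)"
        using r Q'(2-4)[OF x] Q'(2-4)[OF Q'(5)] Dom_u by (simp add: Comp_assoc)
      finally show "Comp C s x = Comp C (h x) s" using Q'(8)[OF x] by simp
    qed (use x in blast)
  qed (use r Dom_u Q hQ in auto)
  have m2: "(t, (?W, h ` Q), (V, Q)) \<in> Mor (transporter_cat p C)"
    unfolding transporter_Mor_iff unit
  proof (intro conjI ballI)
    show "\<exists>y\<in>Q. Comp C t z = Comp C y t" if "z \<in> h ` Q" for z
    proof -
      obtain x where x: "x \<in> Q" "z = h x" using \<open>z \<in> h ` Q\<close> by blast
      have "Comp C t z = Comp C (Comp C (Comp C t s) x) t"
        unfolding x(2) h_def using r(1-3,6-8) Q'(2-4)[OF x(1)] Dom_u by (simp add: Comp_assoc)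
      then have "Comp C t z = Comp C x t" unfolding r(11) using Q'(7)[OF x(1)] by simp
      then show ?thesis using x(1) by blast
    qed
  qed (use r Dom_u Q hQ in auto)
  interpret O: category ?O by (rule category_orbit_cat)
  have "idem_iso_via ?O (orbit_id V Q) (orbit_id ?W (h ` Q)) (orbit C Q (h ` Q) s, (V, Q), (?W, h ` Q))
      (orbit C (h ` Q) Q t, (?W, h ` Q), (V, Q))"
  proof (rule idem_iso_via_orbit_id[OF m1 m2 idempotent_endo_orbit_id[OF Q]])
    show "Comp ?O (orbit C Q (h ` Q) s, (V, Q), (?W, h ` Q)) (orbit_id V Q) = (orbit C Q (h ` Q) s, (V, Q), (?W, h ` Q))"
      using O.Comp_Ident[OF orbit_MorI[OF m1]] unfolding Ident_orbit_cat[OF Q, symmetric] by simp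
    show "Comp ?O (orbit_id V Q) (orbit C (h ` Q) Q t, (?W, h ` Q), (V, Q)) = (orbit C (h ` Q) Q t, (?W, h ` Q), (V, Q))"
      using O.Ident_Comp[OF orbit_MorI[OF m2]] unfolding Ident_orbit_cat[OF Q, symmetric] by simp
    show "(orbit C Q Q (Comp C t s), (V, Q), (V, Q)) = orbit_id V Q"
      unfolding r(11) transporter_Ident(2)[OF Q] ..
  qed (simp_all add: r(12) unit)
  then show ?thesis using that[OF hQ unit] unfolding idem_iso_def by blast
qed

end

subsection \<open>Orbit categories of the groups of idempotents\<close>

text \<open>G_e consists of the self-isomorphisms of \<open>e\<close>, so comparing isomorphisms of
  idempotents in two categories also compares these groups.\<close>

lemma idem_group_iff_iso:
  assumes "category C" "idempotent_endo C e"
  shows "x \<in> idem_group C e \<longleftrightarrow> (\<exists>y. idem_iso_via C e e x y)"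
  unfolding category.idem_group_iff[OF assms] category.idem_iso_via_iff[OF assms assms(2)] corner_monoid_def
  by blast

text \<open>\<open>idem_group_cat\<close> alters only objects, morphisms and identities. Whatever is
  formed from composition, domain and codomain alone stays literally the same.\<close>

lemma orbit_idem_group_cat_simps [simp]:
  "orbit (idem_group_cat C e) = orbit C" "unit_of (idem_group_cat C e) = unit_of C"
  "comp_monoid (idem_group_cat C e) = comp_monoid C"
  "Dom (orbit_cat p (idem_group_cat C e)) = Dom (orbit_cat p C)"
  "Cod (orbit_cat p (idem_group_cat C e)) = Cod (orbit_cat p C)"
  "Comp (orbit_cat p (idem_group_cat C e)) = Comp (orbit_cat p C)"
proof -
  show 1: "comp_monoid (idem_group_cat C e) = comp_monoid C" by (simp add: fun_eq_iff comp_monoid_def)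
  show "orbit (idem_group_cat C e) = orbit C" by (simp add: fun_eq_iff orbit_def)
  show "unit_of (idem_group_cat C e) = unit_of C" by (simp add: fun_eq_iff unit_of_def 1)
qed (simp_all add: orbit_cat_def)

context category
begin

context
  fixes e
  assumes e: "idempotent_endo C e"
begin

text \<open>A group has only one idempotent, so a subgroup of G_e has unit \<open>e\<close>.
  Conversely, every element of \<open>P\<close> is a unit at \<open>unit_of C P\<close>.\<close>

lemma p_subgroup_idem_group_cat_iff:
  "p_subgroup p (idem_group_cat C e) V P \<longleftrightarrow> p_subgroup p C V P \<and> unit_of C P = e"
proof
  assume P: "p_subgroup p (idem_group_cat C e) V P"
  have P_sub: "P \<subseteq> idem_group C e" using P by (auto simp: p_subgroup_def Hom_def)
  then have "P \<subseteq> Hom C V V"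
    using P category_idem_group_subset[OF category_axioms e] by (auto simp: p_subgroup_def Hom_def)
  then have P': "p_subgroup p C V P" using P by (simp add: p_subgroup_def)
  have "unit_of C P \<in> idem_group C e" using p_subgroupD(5)[OF P'] P_sub by blast
  then have "unit_of C P = e"
    using idem_group_idempotent[OF e] idempotent_endoD(3)[OF p_subgroupD(10)[OF P']] by blast
  then show "p_subgroup p C V P \<and> unit_of C P = e" using P' by blast
next
  assume "p_subgroup p C V P \<and> unit_of C P = e"
  then show "p_subgroup p (idem_group_cat C e) V P"
    using p_subgroupD(12)[of p V P] by (auto simp: p_subgroup_def Hom_def)
qed

lemma transporter_idem_group_cat_iff:
  "(s, (V, P), (W, Q)) \<in> Mor (transporter_cat p (idem_group_cat C e)) \<longleftrightarrow>
    (s, (V, P), (W, Q)) \<in> Mor (transporter_cat p C) \<and> unit_of C P = e \<and> unit_of C Q = e \<and> s \<in> idem_group C e"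
  unfolding transporter_Mor_iff category.transporter_Mor_iff[OF category_idem_group_cat[OF e]]
    p_subgroup_idem_group_cat_iff
  using category_idem_group_subset[OF category_axioms e] by auto

lemma orbit_idem_group_MorE:
  assumes "F \<in> Mor (orbit_cat p (idem_group_cat C e))"
  obtains s V P W Q where "F = (orbit C P Q s, (V, P), (W, Q))"
    "(s, (V, P), (W, Q)) \<in> Mor (transporter_cat p C)" "unit_of C P = e" "unit_of C Q = e" "s \<in> idem_group C e"
  by (rule category.orbit_MorE[OF category_idem_group_cat[OF e] assms])
    (simp add: transporter_idem_group_cat_iff)

lemma orbit_idem_group_Mor_subset:
  "Mor (orbit_cat p (idem_group_cat C e)) \<subseteq> Mor (orbit_cat p C)"
proof
  fix F assume "F \<in> Mor (orbit_cat p (idem_group_cat C e))"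
  then show "F \<in> Mor (orbit_cat p C)"
    by (rule orbit_idem_group_MorE) (use orbit_MorI in blast)
qed

lemma orbit_idem_group_MorI:
  assumes "(s, (V, P), (W, Q)) \<in> Mor (transporter_cat p C)" "unit_of C P = e" "unit_of C Q = e" "s \<in> idem_group C e"
  shows "(orbit C P Q s, (V, P), (W, Q)) \<in> Mor (orbit_cat p (idem_group_cat C e))"
  using category.orbit_MorI[OF category_idem_group_cat[OF e], of s V P W Q p] assms
  by (simp add: transporter_idem_group_cat_iff del: orbit_cat_simps(2))

text \<open>In the orbit category of a group every idempotent is an identity: if s s lies in P s,
  cancelling \<open>s\<close> in G_e puts \<open>s\<close> into \<open>P\<close>, so its orbit is
  \<open>P\<close>.\<close>

lemma idempotent_endo_orbit_idem_group_iff: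
  "idempotent_endo (orbit_cat p (idem_group_cat C e)) E \<longleftrightarrow>
    (\<exists>V P. p_subgroup p C V P \<and> unit_of C P = e \<and> E = orbit_id V P)"
proof
  let ?O = "orbit_cat p (idem_group_cat C e)"
  assume E: "idempotent_endo ?O E"
  note E' = category.idempotent_endoD[OF category.category_orbit_cat[OF category_idem_group_cat[OF e]] E]
  obtain s V P W Q where "E = (orbit C P Q s, (V, P), (W, Q))"
    "(s, (V, P), (W, Q)) \<in> Mor (transporter_cat p C)" "unit_of C P = e" "unit_of C Q = e" and s: "s \<in> idem_group C e"
    by (rule orbit_idem_group_MorE[OF E'(1)])
  then have E_eq: "E = (orbit C P P s, (V, P), (V, P))" and m: "(s, (V, P), (V, P)) \<in> Mor (transporter_cat p C)"
    and unit: "unit_of C P = e"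
    using E'(2) by simp_all
  note P = transporterD(1)[OF m]
  have "orbit C P P (Comp C s s) = orbit C P P s"
    using E'(3) orbit_Comp[OF m m] unfolding E_eq by simp
  then have "Comp C s s \<in> orbit C P P s"
    using orbit_self[OF transporter_Comp(1)[OF m m]] by simp
  then obtain y where y: "y \<in> P" "Comp C s s = Comp C y s" unfolding orbit_eq[OF m] by blast
  obtain i where i: "i \<in> idem_group C e" "Comp C s i = e"
    using idem_group_inverse[OF e s] by metis
  have yc: "y \<in> corner_monoid C e"
    using y(1) p_subgroupD(12)[OF P, unfolded unit] by (intro idem_group_corner[OF e]) blast
  note sc = idem_group_corner[OF e s] and ic = idem_group_corner[OF e i(1)]
  have "Comp C (Comp C s s) i = s" "Comp C (Comp C y s) i = y"
    unfolding corner_monoid_assoc[OF sc sc ic] corner_monoid_assoc[OF yc sc ic] i(2)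
    using corner_monoidD(5)[OF sc] corner_monoidD(5)[OF yc] .
  then have "s = y" unfolding y(2) by (rule trans[OF sym])
  then have "s \<in> P" using y(1) by simp
  from orbit_of_translate(2)[OF transporter_Ident(1)[OF P] this] have "orbit C P P s = P"
    unfolding transporter_Ident(2)[OF P] transporterD(6)[OF m] .
  then show "\<exists>V P. p_subgroup p C V P \<and> unit_of C P = e \<and> E = orbit_id V P"
    using P unit E_eq by blast
next
  assume "\<exists>V P. p_subgroup p C V P \<and> unit_of C P = e \<and> E = orbit_id V P"
  then obtain V P where P: "p_subgroup p (idem_group_cat C e) V P" and E: "E = orbit_id V P"
    unfolding p_subgroup_idem_group_cat_iff by blast
  show "idempotent_endo (orbit_cat p (idem_group_cat C e)) E"
    unfolding E by (rule category.idempotent_endo_orbit_id[OF category_idem_group_cat[OF e] P])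
qed

text \<open>Representatives of an isomorphism in the large orbit category lie in the corner monoid
  of \<open>e\<close>, and their composites lie in \<open>P\<close> and \<open>Q\<close>, that is,
  in G_e. By \<open>idem_groupI\<close> they are units themselves, so the isomorphism already lives
  over G_e.\<close>

lemma idem_iso_via_orbit_idem_group_iff:
  assumes E: "idempotent_endo (orbit_cat p (idem_group_cat C e)) E"
    and F: "idempotent_endo (orbit_cat p (idem_group_cat C e)) F"
  shows "idem_iso_via (orbit_cat p (idem_group_cat C e)) E F S T \<longleftrightarrow> idem_iso_via (orbit_cat p C) E F S T"
proof -
  let ?O = "orbit_cat p C" and ?G = "orbit_cat p (idem_group_cat C e)"
  obtain V P where P: "p_subgroup p C V P" "unit_of C P = e" "E = orbit_id V P"
    using E unfolding idempotent_endo_orbit_idem_group_iff by blast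
  obtain W Q where Q: "p_subgroup p C W Q" "unit_of C Q = e" "F = orbit_id W Q"
    using F unfolding idempotent_endo_orbit_idem_group_iff by blast
  have EO: "idempotent_endo ?O E" and FO: "idempotent_endo ?O F"
    using idempotent_endo_orbit_id P Q by auto
  have "S \<in> Mor ?G \<and> T \<in> Mor ?G" if iso: "idem_iso_via ?O E F S T"
  proof -
    obtain s t where st: "S = (orbit C P Q s, (V, P), (W, Q))" "T = (orbit C Q P t, (W, Q), (V, P))"
      and s: "(s, (V, P), (W, Q)) \<in> Mor (transporter_cat p C)" and t: "(t, (W, Q), (V, P)) \<in> Mor (transporter_cat p C)"
      and ts_P: "Comp C t s \<in> P" and st_Q: "Comp C s t \<in> Q"
      by (rule orbit_id_isoE[OF P(1) Q(1) iso[unfolded P(3) Q(3)]])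
    have VW: "V = Dom C e" "W = Dom C e"
      using p_subgroupD(11)[OF P(1)] p_subgroupD(11)[OF Q(1)] P(2) Q(2) by auto
    have c: "s \<in> corner_monoid C e" "t \<in> corner_monoid C e"
      using transporterD(3-7)[OF s] transporterD(3-7)[OF t] VW P(2) Q(2) unfolding corner_monoid_def by auto
    have "Comp C t s \<in> idem_group C e" "Comp C s t \<in> idem_group C e"
      using ts_P st_Q p_subgroupD(12)[OF P(1)] p_subgroupD(12)[OF Q(1)] P(2) Q(2) by auto
    then have "s \<in> idem_group C e" "t \<in> idem_group C e"
      using idem_groupI[OF e c(1,2) _ c(2)] idem_groupI[OF e c(2,1) _ c(1)] by auto
    then show ?thesis
      using orbit_idem_group_MorI s t P(2) Q(2) st by blast
  qed
  then show ?thesis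
    unfolding category.idem_iso_via_iff[OF category_orbit_cat EO FO]
      category.idem_iso_via_iff[OF category.category_orbit_cat[OF category_idem_group_cat[OF e]] E F]
      orbit_idem_group_cat_simps
    using orbit_idem_group_Mor_subset by blast
qed

text \<open>Because these are equalities and not just isomorphisms, weights at \<open>E\<close> in
  the two orbit categories are modules over the same algebra.\<close>

lemma idem_group_orbit_idem_group:
  assumes E: "idempotent_endo (orbit_cat p (idem_group_cat C e)) E"
  shows "idem_group (orbit_cat p (idem_group_cat C e)) E = idem_group (orbit_cat p C) E"
    and "idem_group_cat (orbit_cat p (idem_group_cat C e)) E = idem_group_cat (orbit_cat p C) E"
proof -
  have "idempotent_endo (orbit_cat p C) E"
    using E idempotent_endo_orbit_id unfolding idempotent_endo_orbit_idem_group_iff by blast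
  then show 1: "idem_group (orbit_cat p (idem_group_cat C e)) E = idem_group (orbit_cat p C) E"
    unfolding set_eq_iff using idem_iso_via_orbit_idem_group_iff[OF E E]
      idem_group_iff_iso[OF category.category_orbit_cat[OF category_idem_group_cat[OF e]] E]
      idem_group_iff_iso[OF category_orbit_cat] by blast
  show "idem_group_cat (orbit_cat p (idem_group_cat C e)) E = idem_group_cat (orbit_cat p C) E"
    by (rule category.equality) (simp_all add: 1)
qed

end

end

section \<open>Weights and the Galois action\<close>

context twisted_category
begin

text \<open>Replaces the inverse function in the definition by transport in the opposite direction.
  The two agree only on the carrier of the algebra, so the pulled back modules are isomorphic rather
  than equal.\<close>

lemma weight_iso_iff:
  assumes e: "idempotent_endo C e" and f: "idempotent_endo C f"
  shows "weight_iso C \<alpha> (e, T) (f, T') \<longleftrightarrow> (\<exists>s t. idem_iso_via C e f s t \<and>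
    mod_iso (idem_group_algebra C \<alpha> f) (pull_scalars (transport C \<alpha> f t s) T) T')"
proof -
  have "mod_iso (idem_group_algebra C \<alpha> f)
      (pull_scalars (inv_into (carrier (idem_group_algebra C \<alpha> e)) (transport C \<alpha> e s t)) T) T' \<longleftrightarrow>
    mod_iso (idem_group_algebra C \<alpha> f) (pull_scalars (transport C \<alpha> f t s) T) T'"
    if st: "idem_iso_via C e f s t" for s t
    using mod_iso_trans[OF pull_scalars_cong[of "idem_group_algebra C \<alpha> f"], of _ "transport C \<alpha> f t s" T]
      mod_iso_trans[OF pull_scalars_cong[of "idem_group_algebra C \<alpha> f"], of "transport C \<alpha> f t s" _ T]
      inv_into_transport[OF e f st] by metis
  then show ?thesis unfolding weight_iso_def by auto
qed

lemma weightsD: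
  assumes "(e, T) \<in> weights C \<alpha>"
  shows "idempotent_endo C e" "simple_module (idem_group_algebra C \<alpha> e) T"
    "projective_module (idem_group_algebra C \<alpha> e) T" "left_module (idem_group_algebra C \<alpha> e) T"
  using assms simple_moduleD(1) by (auto simp: weights_def)

text \<open>Moves a weight along an isomorphism of idempotents. It is needed to replace any weight
  by an isomorphic one at the identity of a \<open>p\<close>-subgroup of a chosen G_e.\<close>

lemma weight_transport:
  assumes w: "(e, T) \<in> weights C \<alpha>" and f: "idempotent_endo C f" and st: "idem_iso_via C e f s t"
  shows "(f, pull_scalars (transport C \<alpha> f t s) T) \<in> weights C \<alpha>"
    and "weight_iso C \<alpha> (e, T) (f, pull_scalars (transport C \<alpha> f t s) T)"
proof -
  note w' = weightsD[OF w]
  note iso = transport_ring_iso[OF f w'(1) idem_iso_via_sym[OF w'(1) f st]]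
  show "(f, pull_scalars (transport C \<alpha> f t s) T) \<in> weights C \<alpha>"
    using f simple_module_pull_scalars[OF ring_idem_group_algebra[OF f] iso w'(2)]
      projective_module_pull_scalars[OF ring_idem_group_algebra[OF w'(1)] ring_idem_group_algebra[OF f] iso w'(3)]
    by (simp add: weights_def)
  show "weight_iso C \<alpha> (e, T) (f, pull_scalars (transport C \<alpha> f t s) T)"
    unfolding weight_iso_iff[OF w'(1) f] using st mod_iso_refl by blast
qed

lemma equiv_weight_iso: "equiv (weights C \<alpha>) (rel_on (weight_iso C \<alpha>) (weights C \<alpha>))"
proof (rule equiv_rel_onI)
  fix x assume x: "x \<in> weights C \<alpha>"
  obtain e T where [simp]: "x = (e, T)" by (cases x)
  have e: "idempotent_endo C e" using weightsD x by simp
  have "mod_iso (idem_group_algebra C \<alpha> e) (pull_scalars (transport C \<alpha> e e e) T) (pull_scalars (\<lambda>a. a) T)"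
    by (rule pull_scalars_cong) (simp add: transport_id[OF e])
  then show "weight_iso C \<alpha> x x"
    using idem_iso_via_refl[OF e] by (auto simp: weight_iso_iff[OF e e] pull_scalars_id)
next
  fix x y assume x: "x \<in> weights C \<alpha>" and y: "y \<in> weights C \<alpha>" and xy: "weight_iso C \<alpha> x y"
  obtain e T f T' where [simp]: "x = (e, T)" "y = (f, T')" by (cases x, cases y)
  note x' = weightsD[OF x[simplified]] and y' = weightsD[OF y[simplified]]
  note e = x'(1) and f = y'(1)
  let ?A = "idem_group_algebra C \<alpha> e" and ?B = "idem_group_algebra C \<alpha> f"
  obtain s t where st: "idem_iso_via C e f s t" and iso: "mod_iso ?B (pull_scalars (transport C \<alpha> f t s) T) T'"
    using xy weight_iso_iff[OF e f] by auto
  note ts = idem_iso_via_sym[OF e f st]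
  have "left_module ?B (pull_scalars (transport C \<alpha> f t s) T)"
    by (rule left_module_pull_scalars[OF ring_idem_group_algebra[OF f] transport_ring_iso[OF f e ts] x'(4)])
  from mod_iso_sym[OF this iso] have "mod_iso ?B T' (pull_scalars (transport C \<alpha> f t s) T)" .
  then have "mod_iso ?A (pull_scalars (transport C \<alpha> e s t) T')
      (pull_scalars (transport C \<alpha> f t s \<circ> transport C \<alpha> e s t) T)"
    unfolding pull_scalars_pull_scalars[symmetric]
    by (rule mod_iso_pull_scalars) (rule transport_closed[OF e f st])
  moreover have "mod_iso ?A (pull_scalars (transport C \<alpha> f t s \<circ> transport C \<alpha> e s t) T) (pull_scalars (\<lambda>a. a) T)"
    by (rule pull_scalars_cong) (simp add: transport_inverse[OF e f st])
  ultimately have "mod_iso ?A (pull_scalars (transport C \<alpha> e s t) T') T"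
    unfolding pull_scalars_id by (rule mod_iso_trans)
  then show "weight_iso C \<alpha> y x" using ts by (auto simp: weight_iso_iff[OF f e])
next
  fix x y z assume x: "x \<in> weights C \<alpha>" and y: "y \<in> weights C \<alpha>" and z: "z \<in> weights C \<alpha>"
    and xy: "weight_iso C \<alpha> x y" and yz: "weight_iso C \<alpha> y z"
  obtain e T f T' g T'' where [simp]: "x = (e, T)" "y = (f, T')" "z = (g, T'')" by (cases x, cases y, cases z)
  note x' = weightsD[OF x[simplified]] and y' = weightsD[OF y[simplified]] and z' = weightsD[OF z[simplified]]
  note e = x'(1) and f = y'(1) and g = z'(1)
  obtain s t where st: "idem_iso_via C e f s t"
    and iso: "mod_iso (idem_group_algebra C \<alpha> f) (pull_scalars (transport C \<alpha> f t s) T) T'"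
    using xy weight_iso_iff[OF e f] by auto
  obtain s' t' where st': "idem_iso_via C f g s' t'"
    and iso': "mod_iso (idem_group_algebra C \<alpha> g) (pull_scalars (transport C \<alpha> g t' s') T') T''"
    using yz weight_iso_iff[OF f g] by auto
  note ts = idem_iso_via_sym[OF e f st] and ts' = idem_iso_via_sym[OF f g st']
  have "mod_iso (idem_group_algebra C \<alpha> g) (pull_scalars (transport C \<alpha> g t' s') (pull_scalars (transport C \<alpha> f t s) T))
      (pull_scalars (transport C \<alpha> g t' s') T')"
    using iso by (rule mod_iso_pull_scalars) (rule transport_closed[OF g f ts'])
  from mod_iso_trans[OF this iso']
  have "mod_iso (idem_group_algebra C \<alpha> g) (pull_scalars (transport C \<alpha> f t s \<circ> transport C \<alpha> g t' s') T) T''"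
    unfolding pull_scalars_pull_scalars .
  moreover have "transport C \<alpha> f t s \<circ> transport C \<alpha> g t' s' = transport C \<alpha> g (Comp C t t') (Comp C s' s)"
    by (simp add: fun_eq_iff transport_trans[OF g f e ts' ts])
  ultimately show "weight_iso C \<alpha> x z"
    using idem_iso_via_trans[OF e f g st st'] by (auto simp: weight_iso_iff[OF e g])
qed

lemma weight_iso_imp_idem_iso: "weight_iso C \<alpha> x y \<Longrightarrow> idem_iso C (fst x) (fst y)"
  by (auto simp: weight_iso_def idem_iso_def split: prod.splits)

lemma acts_mod_hom:
  assumes M: "left_module alg M" and N: "left_module alg N" and iso: "mod_iso alg M N" and s: "s \<in> Mor C"
    and act: "acts s M"
  shows "acts s N"
proof -
  interpret m: left_module alg M by (rule M)
  obtain h where h: "h \<in> mod_hom alg M N" "bij_betw h (carrier M) (carrier N)"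
    using iso unfolding mod_iso_def by blast
  obtain c v where v: "v \<in> carrier M" "single c s \<odot>\<^bsub>M\<^esub> v \<noteq> \<zero>\<^bsub>M\<^esub>" using act unfolding acts_def by blast
  have "h (single c s \<odot>\<^bsub>M\<^esub> v) \<noteq> h \<zero>\<^bsub>M\<^esub>"
    using v h(2) m.smult_closed[OF single_closed[OF s] v(1)] unfolding bij_betw_def inj_on_def by blast
  then have "single c s \<odot>\<^bsub>N\<^esub> h v \<noteq> \<zero>\<^bsub>N\<^esub>"
    using mod_homD(3)[OF h(1) single_closed[OF s] v(1)] mod_hom_zero[OF h(1) M N] by simp
  then show ?thesis unfolding acts_def using mod_homD(1)[OF h(1) v(1)] by blast
qed

lemma acts_mod_iso:
  assumes M: "left_module alg M" and N: "left_module alg N" and iso: "mod_iso alg M N" and s: "s \<in> Mor C"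
  shows "acts s M \<longleftrightarrow> acts s N"
  using acts_mod_hom[OF M N iso s] acts_mod_hom[OF N M mod_iso_sym[OF M iso] s] by blast

lemma apex_mod_iso:
  assumes "left_module alg M" "left_module alg N" "mod_iso alg M N" "idempotent_endo C e"
  shows "apex e M \<longleftrightarrow> apex e N"
  using acts_mod_iso[OF assms(1-3)] corner_monoidD(1)[of _ e] idempotent_endoD(1)[OF assms(4)]
  unfolding apex_def by blast

text \<open>Reads coefficients along an enumeration of the finitely many morphisms. It is the
  encoding by which cyclic quotients of the algebra are placed on the type
  \<open>nat \<Rightarrow> 'k\<close>.\<close>

lemma alg_embedding: "\<exists>enc :: ('m \<Rightarrow> 'k) \<Rightarrow> (nat \<Rightarrow> 'k). inj_on enc (carrier alg)"
proof -
  obtain f where f: "bij_betw f {0..<card (Mor C)} (Mor C)"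
    using ex_bij_betw_nat_finite[OF finite_Mor] by blast
  have "inj_on (\<lambda>a i. a (f i)) (carrier alg)"
  proof (rule inj_onI)
    fix a b assume ab: "a \<in> carrier alg" "b \<in> carrier alg" and eq: "(\<lambda>i. a (f i)) = (\<lambda>i. b (f i))"
    show "a = b"
    proof
      fix u
      show "a u = b u"
      proof (cases "u \<in> Mor C")
        case True
        then obtain i where "u = f i" using f unfolding bij_betw_def by blast
        then show ?thesis using fun_cong[OF eq, of i] by simp
      next
        case False
        then show ?thesis using ab by (simp add: carrier_alg)
      qed
    qed
  qed
  then show ?thesis by blast
qed

end

section \<open>Galois automorphisms and twisted modules\<close>

lemma galois_groupD:
  fixes \<sigma> :: "'k::field \<Rightarrow> 'k"
  assumes "\<sigma> \<in> galois_group"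
  shows "bij \<sigma>" "\<sigma> (x + y) = \<sigma> x + \<sigma> y" "\<sigma> (x * y) = \<sigma> x * \<sigma> y" "\<sigma> 1 = 1" "\<sigma> 0 = 0"
    "x \<in> prime_field \<Longrightarrow> \<sigma> x = x" "\<sigma> (inverse x) = inverse (\<sigma> x)"
    "\<sigma> (sum f A) = (\<Sum>i\<in>A. \<sigma> (f i))"
proof -
  note defs = galois_group_def ring_iso_def ring_hom_def ring_of_type_algebra_def
  show "bij \<sigma>" "x \<in> prime_field \<Longrightarrow> \<sigma> x = x" using assms by (simp_all add: defs)
  show 1: "\<sigma> (x + y) = \<sigma> x + \<sigma> y" for x y using assms by (simp add: defs)
  show 2: "\<sigma> (x * y) = \<sigma> x * \<sigma> y" for x y using assms by (simp add: defs)
  show 3: "\<sigma> 1 = 1" using assms by (simp add: defs)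
  show 4: "\<sigma> 0 = 0" using 1[of 0 0] by (metis add_0 add_cancel_right_right)
  show "\<sigma> (inverse x) = inverse (\<sigma> x)"
  proof (cases "x = 0")
    case False
    then have "\<sigma> x * \<sigma> (inverse x) = 1" using 2[of x "inverse x"] 3 by simp
    then show ?thesis by (simp add: inverse_unique)
  qed (simp add: 4)
  show "\<sigma> (sum f A) = (\<Sum>i\<in>A. \<sigma> (f i))"
    using sum_comp_morphism[of \<sigma> f A] 1 4 by (simp add: o_def)
qed

lemma inv_galois_group:
  fixes \<sigma> :: "'k::field \<Rightarrow> 'k"
  assumes \<sigma>: "\<sigma> \<in> galois_group"
  shows "inv_into UNIV \<sigma> \<in> galois_group"
proof -
  note g = galois_groupD[OF \<sigma>]
  have inj: "inj \<sigma>" and surj: "surj \<sigma>" using g(1) by (auto simp: bij_def)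
  have "inv_into UNIV \<sigma> \<in> ring_iso ring_of_type_algebra ring_of_type_algebra"
  proof (rule ring_iso_memI)
    show "bij_betw (inv_into UNIV \<sigma>) (carrier ring_of_type_algebra) (carrier ring_of_type_algebra)"
      using bij_imp_bij_inv[OF g(1)] by (simp add: ring_of_type_algebra_def)
    show "inv_into UNIV \<sigma> (x \<otimes>\<^bsub>ring_of_type_algebra\<^esub> y) = inv_into UNIV \<sigma> x \<otimes>\<^bsub>ring_of_type_algebra\<^esub> inv_into UNIV \<sigma> y" for x y
      using inj surj g(3) by (simp add: ring_of_type_algebra_def inv_f_eq surj_f_inv_f)
    show "inv_into UNIV \<sigma> (x \<oplus>\<^bsub>ring_of_type_algebra\<^esub> y) = inv_into UNIV \<sigma> x \<oplus>\<^bsub>ring_of_type_algebra\<^esub> inv_into UNIV \<sigma> y" for x y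
      using inj surj g(2) by (simp add: ring_of_type_algebra_def inv_f_eq surj_f_inv_f)
    show "inv_into UNIV \<sigma> \<one>\<^bsub>ring_of_type_algebra\<^esub> = \<one>\<^bsub>ring_of_type_algebra\<^esub>"
      using inj g(4) by (simp add: ring_of_type_algebra_def inv_f_eq)
  qed (simp add: ring_of_type_algebra_def)
  then show ?thesis
    using inj g(6) by (simp add: galois_group_def inv_f_eq)
qed

lemma galois_module_inverse:
  assumes \<sigma>: "\<sigma> \<in> galois_group"
  shows "galois_module (inv_into UNIV \<sigma>) (galois_module \<sigma> M) = M" "galois_module \<sigma> (galois_module (inv_into UNIV \<sigma>) M) = M"
proof -
  note b = galois_groupD(1)[OF \<sigma>]
  have "inv_into UNIV (inv_into UNIV \<sigma>) = \<sigma>" by (rule inv_inv_eq[OF b])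
  moreover have "inv_into UNIV \<sigma> \<circ> \<sigma> = id" "\<sigma> \<circ> inv_into UNIV \<sigma> = id" using b by (auto simp: bij_def surj_iff inj_iff)
  ultimately show "galois_module (inv_into UNIV \<sigma>) (galois_module \<sigma> M) = M" "galois_module \<sigma> (galois_module (inv_into UNIV \<sigma>) M) = M"
    by (simp_all add: galois_module_def pull_scalars_pull_scalars o_def[of "\<lambda>a. _ \<circ> a"] pull_scalars_id
        flip: comp_assoc)
qed

locale twisted_galois_category = twisted_category C \<alpha>
  for C :: "('o, 'm) category" and \<alpha> :: "'m \<Rightarrow> 'm \<Rightarrow> 'k::field" +
  assumes prime_cocycle: "t \<in> Mor C \<Longrightarrow> s \<in> Mor C \<Longrightarrow> Dom C t = Cod C s \<Longrightarrow> \<alpha> t s \<in> prime_field"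
begin

lemma twisted_galois_category_idem_group_cat:
  assumes e: "idempotent_endo C e"
  shows "twisted_galois_category (idem_group_cat C e) \<alpha>"
  using twisted_category_idem_group_cat[OF e] prime_cocycle category_idem_group_subset[OF category_axioms e]
  by (auto simp: twisted_galois_category_def twisted_galois_category_axioms_def)

text \<open>The structure constants are zero or values of \<open>\<alpha>\<close>, so they lie in
  the prime field and are fixed by \<open>\<tau>\<close>. Hence applying \<open>\<tau>\<close> to
  the coefficients respects products.\<close>

lemma galois_ring_iso:
  assumes \<tau>: "\<tau> \<in> galois_group"
  shows "(\<lambda>a. \<tau> \<circ> a) \<in> ring_iso alg alg"
proof -
  note g = galois_groupD[OF \<tau>]
  show ?thesis
  proof (rule ring_iso_memI)
    show closed: "\<tau> \<circ> a \<in> carrier alg" if "a \<in> carrier alg" for a using that g(5) by (simp add: carrier_alg)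
    show "\<tau> \<circ> (a \<otimes>\<^bsub>alg\<^esub> b) = (\<tau> \<circ> a) \<otimes>\<^bsub>alg\<^esub> (\<tau> \<circ> b)" for a b
    proof
      fix u
      have "\<tau> (structure_const t s u) = structure_const t s u" if "t \<in> Mor C" "s \<in> Mor C" for t s
        using that g(5,6) prime_cocycle by (simp add: structure_const_def)
      then show "(\<tau> \<circ> (a \<otimes>\<^bsub>alg\<^esub> b)) u = ((\<tau> \<circ> a) \<otimes>\<^bsub>alg\<^esub> (\<tau> \<circ> b)) u"
        unfolding o_apply mult_alg g(8) g(3) by (intro sum.cong refl) simp
    qed
    show "\<tau> \<circ> (a \<oplus>\<^bsub>alg\<^esub> b) = (\<tau> \<circ> a) \<oplus>\<^bsub>alg\<^esub> (\<tau> \<circ> b)" for a b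
      by (simp add: fun_eq_iff add_alg g(2))
    show "\<tau> \<circ> \<one>\<^bsub>alg\<^esub> = \<one>\<^bsub>alg\<^esub>"
      using g(5-7) prime_cocycle by (auto simp: fun_eq_iff one_alg)
    have inv: "inv_into UNIV \<tau> (\<tau> x) = x" "\<tau> (inv_into UNIV \<tau> x) = x" for x using g(1) by (auto simp: bij_def surj_f_inv_f)
    have inv0: "inv_into UNIV \<tau> 0 = 0" using inv(1)[of 0] g(5) by simp
    show "bij_betw ((\<circ>) \<tau>) (carrier alg) (carrier alg)"
      by (rule bij_betw_byWitness[of _ "(\<circ>) (inv_into UNIV \<tau>)"]) (auto simp: fun_eq_iff inv carrier_alg g(5) inv0)
  qed
qed

lemma galois_idem_elt:
  assumes "\<tau> \<in> galois_group" "idempotent_endo C e"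
  shows "\<tau> \<circ> idem_elt e = idem_elt e"
  using galois_groupD(5-7)[OF assms(1)] prime_cocycle[of e e] assms(2)
  by (auto simp: fun_eq_iff idem_elt_def single_def)

text \<open>The twist only changes the coefficient of a basis element, and it does so bijectively.
  Consequently the Galois action preserves the apex.\<close>

lemma acts_galois_module:
  assumes \<sigma>: "\<sigma> \<in> galois_group"
  shows "acts s (galois_module \<sigma> M) \<longleftrightarrow> acts s M"
proof -
  note g = galois_groupD[OF inv_galois_group[OF \<sigma>]]
  have "inv_into UNIV \<sigma> \<circ> single c s = single (inv_into UNIV \<sigma> c) s" for c using g(5) by (auto simp: single_def)
  moreover have "surj (inv_into UNIV \<sigma>)" using g(1) by (simp add: bij_def)
  ultimately show ?thesis unfolding acts_def galois_module_def pull_scalars_simps by (metis surjD)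
qed

lemma acts_by_isos_simple_modules:
  "acts_by_isos galois_group galois_module (mod_iso alg) {M. simple_module alg M}"
  unfolding acts_by_isos_def
proof (intro ballI)
  fix \<sigma> :: "'k \<Rightarrow> 'k" assume \<sigma>: "\<sigma> \<in> galois_group"
  have iso: "(\<lambda>a. inv_into UNIV \<sigma> \<circ> a) \<in> ring_iso alg alg"
    by (rule galois_ring_iso[OF inv_galois_group[OF \<sigma>]])
  have "galois_module \<sigma> M \<in> {M. simple_module alg M}" if "M \<in> {M. simple_module alg M}" for M
    using that simple_module_pull_scalars[OF ring_alg iso, of M] by (simp add: galois_module_def)
  moreover have "mod_iso alg (galois_module \<sigma> M) (galois_module \<sigma> N)" if "mod_iso alg M N" for M N
    unfolding galois_module_def using that ring_isoD(1)[OF iso] by (rule mod_iso_pull_scalars)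
  ultimately show "\<exists>\<tau>\<in>galois_group. (\<forall>x\<in>{M. simple_module alg M}. galois_module \<sigma> x \<in> {M. simple_module alg M} \<and>
      galois_module \<tau> (galois_module \<sigma> x) = x \<and> galois_module \<sigma> (galois_module \<tau> x) = x) \<and>
    (\<forall>x\<in>{M. simple_module alg M}. \<forall>y\<in>{M. simple_module alg M}.
      mod_iso alg x y \<longrightarrow> mod_iso alg (galois_module \<sigma> x) (galois_module \<sigma> y))"
    using galois_module_inverse[OF \<sigma>] inv_galois_group[OF \<sigma>] by blast
qed

lemma acts_by_isos_apex_modules:
  "acts_by_isos galois_group galois_module (mod_iso alg) {M. simple_module alg M \<and> apex e M}"
proof (rule acts_by_isos_subset[OF acts_by_isos_simple_modules])
  fix \<sigma> :: "'k \<Rightarrow> 'k" and M :: "('m, 'k) tw_module"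
  assume \<sigma>: "\<sigma> \<in> galois_group" and M: "M \<in> {M. simple_module alg M \<and> apex e M}"
  then have "simple_module alg (galois_module \<sigma> M)"
    using acts_by_isos_simple_modules unfolding acts_by_isos_def by blast
  then show "galois_module \<sigma> M \<in> {M. simple_module alg M \<and> apex e M}"
    using M acts_galois_module[OF \<sigma>] by (simp add: apex_def)
qed blast

text \<open>The transport coefficients are products of values of \<open>\<alpha>\<close> and their
  inverses, all fixed by \<open>\<tau>\<close>. So the Galois action commutes with moving modules
  between isomorphic idempotents.\<close>

lemma transport_galois:
  assumes e: "idempotent_endo C e" and f: "idempotent_endo C f" and st: "idem_iso_via C e f s t"
    and \<tau>: "\<tau> \<in> galois_group"
  shows "transport C \<alpha> e s t (\<tau> \<circ> a) = \<tau> \<circ> transport C \<alpha> e s t a"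
proof
  fix y
  note g = galois_groupD[OF \<tau>] and r = iso_rules[OF e f st]
  have "\<tau> (transport_coeff C \<alpha> e s t x) = transport_coeff C \<alpha> e s t x" if "x \<in> idem_group C e" for x
  proof -
    note xr = corner_monoidD[OF idem_group_corner[OF e that]]
    have "\<alpha> x t \<in> prime_field" "\<alpha> s (Comp C x t) \<in> prime_field" "\<alpha> e e \<in> prime_field" "\<alpha> t s \<in> prime_field"
      using xr r e by (simp_all add: prime_cocycle)
    then show ?thesis by (simp add: transport_coeff_def g(3,6,7))
  qed
  then show "transport C \<alpha> e s t (\<tau> \<circ> a) y = (\<tau> \<circ> transport C \<alpha> e s t a) y"
    using conj_idem_group[OF f e idem_iso_via_sym[OF e f st], of y]
    by (simp add: transport_apply[OF e f st] g(3,5))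
qed

lemma acts_by_isos_weights:
  "acts_by_isos galois_group (\<lambda>\<sigma> (e, T). (e, galois_module \<sigma> T)) (weight_iso C \<alpha>) (weights C \<alpha>)"
  unfolding acts_by_isos_def
proof (intro ballI)
  fix \<sigma> :: "'k \<Rightarrow> 'k" assume \<sigma>: "\<sigma> \<in> galois_group"
  let ?act = "\<lambda>\<sigma> (e :: 'm, T :: ('m, 'k) tw_module). (e, galois_module \<sigma> T)"
  note \<tau> = inv_galois_group[OF \<sigma>]
  have iso: "(\<lambda>a. inv_into UNIV \<sigma> \<circ> a) \<in> ring_iso (idem_group_algebra C \<alpha> e) (idem_group_algebra C \<alpha> e)"
    if "idempotent_endo C e" for e
    by (rule twisted_galois_category.galois_ring_iso[OF twisted_galois_category_idem_group_cat[OF that] \<tau>])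
  have "(e, galois_module \<sigma> T) \<in> weights C \<alpha>" if w: "(e, T) \<in> weights C \<alpha>" for e T
  proof -
    note w' = weightsD[OF w] and rg = ring_idem_group_algebra[OF weightsD(1)[OF w]]
    show ?thesis
      using w'(1) simple_module_pull_scalars[OF rg iso[OF w'(1)] w'(2)]
        projective_module_pull_scalars[OF rg rg iso[OF w'(1)] w'(3)]
      by (simp add: weights_def galois_module_def)
  qed
  moreover have "weight_iso C \<alpha> (e, galois_module \<sigma> T) (f, galois_module \<sigma> T')"
    if w: "(e, T) \<in> weights C \<alpha>" "(f, T') \<in> weights C \<alpha>" and wi: "weight_iso C \<alpha> (e, T) (f, T')" for e T f T'
  proof -
    note e = weightsD(1)[OF w(1)] and f = weightsD(1)[OF w(2)]
    obtain s t where st: "idem_iso_via C e f s t"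
      and h: "mod_iso (idem_group_algebra C \<alpha> f) (pull_scalars (transport C \<alpha> f t s) T) T'"
      using wi weight_iso_iff[OF e f] by auto
    have "mod_iso (idem_group_algebra C \<alpha> f) (pull_scalars (\<lambda>a. inv_into UNIV \<sigma> \<circ> a) (pull_scalars (transport C \<alpha> f t s) T))
        (galois_module \<sigma> T')"
      unfolding galois_module_def using h ring_isoD(1)[OF iso[OF f]] by (rule mod_iso_pull_scalars)
    moreover have "pull_scalars (\<lambda>a. inv_into UNIV \<sigma> \<circ> a) (pull_scalars (transport C \<alpha> f t s) T) =
        pull_scalars (transport C \<alpha> f t s) (galois_module \<sigma> T)"
      unfolding galois_module_def pull_scalars_pull_scalars
      by (rule arg_cong[of _ _ "\<lambda>\<psi>. pull_scalars \<psi> T"])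
        (simp add: fun_eq_iff transport_galois[OF f e idem_iso_via_sym[OF e f st] \<tau>])
    ultimately show ?thesis using st weight_iso_iff[OF e f] by auto
  qed
  ultimately have "(\<forall>x\<in>weights C \<alpha>. ?act \<sigma> x \<in> weights C \<alpha> \<and> ?act (inv_into UNIV \<sigma>) (?act \<sigma> x) = x \<and> ?act \<sigma> (?act (inv_into UNIV \<sigma>) x) = x) \<and>
    (\<forall>x\<in>weights C \<alpha>. \<forall>y\<in>weights C \<alpha>. weight_iso C \<alpha> x y \<longrightarrow> weight_iso C \<alpha> (?act \<sigma> x) (?act \<sigma> y))"
    using galois_module_inverse[OF \<sigma>] by (auto simp: split_beta)
  then show "\<exists>\<tau>\<in>galois_group. (\<forall>x\<in>weights C \<alpha>. ?act \<sigma> x \<in> weights C \<alpha> \<and> ?act \<tau> (?act \<sigma> x) = x \<and> ?act \<sigma> (?act \<tau> x) = x) \<and>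
    (\<forall>x\<in>weights C \<alpha>. \<forall>y\<in>weights C \<alpha>. weight_iso C \<alpha> x y \<longrightarrow> weight_iso C \<alpha> (?act \<sigma> x) (?act \<sigma> y))"
    using \<tau> by blast
qed

lemma equiv_simple_modules:
  assumes "V \<subseteq> {M. simple_module alg M}"
  shows "equiv V (rel_on (mod_iso alg) V)"
proof (rule equiv_rel_onI)
  show "mod_iso alg y x" if "x \<in> V" "y \<in> V" "mod_iso alg x y" for x y
    using mod_iso_sym[OF simple_moduleD(1) that(3)] assms that(1) by blast
qed (auto intro: mod_iso_refl mod_iso_trans)

lemma corner_equivariant_bijection:
  fixes e
  assumes e: "idempotent_endo C e"
  shows "\<exists>F. equivariant_bijection galois_group galois_simple galois_simple
    (iso_classes (mod_iso alg) {M. simple_module alg M \<and> apex e M})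
    (simple_classes (idem_group_algebra C \<alpha> e)) F"
proof -
  let ?B = "idem_group_algebra C \<alpha> e"
  interpret r: ring_corner alg ?B "idem_proj e" by (rule ring_corner_idem_group_algebra[OF e])
  interpret G: twisted_galois_category "idem_group_cat C e" \<alpha>
    by (rule twisted_galois_category_idem_group_cat[OF e])
  have supp: "r.supported M" if "simple_module alg M" "apex e M" for M :: "('m, 'k) tw_module"
    using supported_iff_apex[OF e simple_moduleD(1)[OF that(1)]] that(2) by blast
  obtain enc :: "('m \<Rightarrow> 'k) \<Rightarrow> (nat \<Rightarrow> 'k)" where enc: "inj_on enc (carrier alg)"
    using alg_embedding by blast
  have "\<exists>F. equivariant_bijection galois_group (\<lambda>\<sigma> c. galois_module \<sigma> ` c) (\<lambda>\<sigma> c. galois_module \<sigma> ` c)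
    (iso_classes (mod_iso alg) {M :: ('m, 'k) tw_module. simple_module alg M \<and> apex e M})
    (iso_classes (mod_iso ?B) {M. simple_module ?B M}) F"
  proof (rule iso_classes_equivariant_bijection[where f = r.corner])
    show "equiv {M :: ('m, 'k) tw_module. simple_module alg M \<and> apex e M}
        (rel_on (mod_iso alg) {M. simple_module alg M \<and> apex e M})"
      by (rule equiv_simple_modules) blast
    show "equiv {M :: ('m, 'k) tw_module. simple_module ?B M} (rel_on (mod_iso ?B) {M. simple_module ?B M})"
      by (rule G.equiv_simple_modules) blast
    show "r.corner M \<in> {M. simple_module ?B M}" if "M \<in> {M. simple_module alg M \<and> apex e M}" for M :: "('m, 'k) tw_module"
      using that r.simple_corner supp by blast
    show "mod_iso ?B (r.corner M) (r.corner N) \<longleftrightarrow> mod_iso alg M N"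
      if "M \<in> {M. simple_module alg M \<and> apex e M}" "N \<in> {M. simple_module alg M \<and> apex e M}"
      for M N :: "('m, 'k) tw_module"
      using that r.mod_iso_corner[of M N] r.mod_iso_if_corner_iso[of M N] supp simple_moduleD(1) by blast
    show "\<exists>M\<in>{M :: ('m, 'k) tw_module. simple_module alg M \<and> apex e M}. mod_iso ?B (r.corner M) T"
      if "T \<in> {M. simple_module ?B M}" for T :: "('m, 'k) tw_module"
    proof -
      obtain M :: "('m, 'k) tw_module" where M: "simple_module alg M" "r.supported M" "mod_iso ?B (r.corner M) T"
        using r.simple_module_with_corner[OF enc, of T] \<open>T \<in> {M. simple_module ?B M}\<close> by blast
      then show ?thesis using supported_iff_apex[OF e simple_moduleD(1)[OF M(1)]] by blast
    qed
    show "mod_iso ?B (r.corner (galois_module \<sigma> M)) (galois_module \<sigma> (r.corner M))"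
      if \<sigma>: "\<sigma> \<in> galois_group" for \<sigma> and M :: "('m, 'k) tw_module"
    proof -
      \<comment> \<open>Since the twist fixes the unit of \<open>?B\<close>, the fixed points of
        \<open>e\<close> are the same before and after twisting. The two modules are therefore
        equal.\<close>
      have "inv_into UNIV \<sigma> \<circ> \<one>\<^bsub>?B\<^esub> = \<one>\<^bsub>?B\<^esub>"
        using galois_idem_elt[OF inv_galois_group[OF \<sigma>] e] by (simp only: one_idem_group_algebra)
      then have "r.corner (galois_module \<sigma> M) = galois_module \<sigma> (r.corner M)"
        by (simp add: r.corner_def galois_module_def pull_scalars_def)
      then show ?thesis using mod_iso_refl by metis
    qed
  qed (rule acts_by_isos_apex_modules, rule G.acts_by_isos_simple_modules)
  then show ?thesis unfolding simple_classes_def galois_simple_def[abs_def] .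
qed

end

section \<open>The bijection for the whole category\<close>

lemma (in category) idempotent_representatives:
  obtains I where "\<forall>i\<in>I. idempotent_endo C i"
    and "\<forall>e. idempotent_endo C e \<longrightarrow> (\<exists>i\<in>I. idem_iso C e i)"
    and "\<forall>i\<in>I. \<forall>j\<in>I. idem_iso C i j \<longrightarrow> i = j"
proof -
  define rep where "rep e = (SOME i. idempotent_endo C i \<and> idem_iso C e i)" for e
  have rep: "idempotent_endo C (rep e)" "idem_iso C e (rep e)" if "idempotent_endo C e" for e
    using someI[of "\<lambda>i. idempotent_endo C i \<and> idem_iso C e i" e] that idem_iso_refl
    unfolding rep_def by blast+
  \<comment> \<open>Isomorphic idempotents satisfy the same predicate under \<open>SOME\<close>, so
    the same representative is chosen for both.\<close>
  have rep_eq: "rep e = rep f" if e: "idempotent_endo C e" and f: "idempotent_endo C f" and ef: "idem_iso C e f" for e f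
  proof -
    have "(idempotent_endo C i \<and> idem_iso C e i) = (idempotent_endo C i \<and> idem_iso C f i)" for i
      using idem_iso_trans[OF e f _ ef] idem_iso_trans[OF f e _ idem_iso_sym[OF e f ef]] by blast
    then show ?thesis unfolding rep_def by simp
  qed
  have "rep e = rep f" if e: "idempotent_endo C e" and f: "idempotent_endo C f" and ef: "idem_iso C (rep e) (rep f)" for e f
  proof -
    have "idem_iso C e (rep f)" using idem_iso_trans[OF e rep(1)[OF e] rep(1)[OF f] rep(2)[OF e] ef] .
    then show ?thesis
      using rep_eq[OF e f] idem_iso_trans[OF e rep(1)[OF f] f _ idem_iso_sym[OF f rep(1)[OF f] rep(2)[OF f]]] by blast
  qed
  then show ?thesis
    by (intro that[of "rep ` {e. idempotent_endo C e}"]) (use rep in blast)+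
qed

section \<open>Restriction of the cocycle to the original category\<close>

context category
begin

lemma p_subgroup_Ident:
  assumes V: "V \<in> Obj C"
  shows "p_subgroup p C V {Ident C V}" "unit_of C {Ident C V} = Ident C V"
proof -
  have "Comp C (Ident C V) (Ident C V) = Ident C V" using idempotent_endoD(3)[OF idempotent_endo_Ident[OF V]] .
  then have "group (comp_monoid C {Ident C V} (Ident C V))"
    by (intro groupI) auto
  moreover have "card {Ident C V} = p ^ 0" by simp
  ultimately show "p_subgroup p C V {Ident C V}"
    unfolding p_subgroup_def using V by (auto simp: Hom_def simp del: power_0)
  show "unit_of C {Ident C V} = Ident C V" by (rule unit_of_eq) fact
qed

lemma transporter_Ident_Ident:
  assumes "s \<in> Mor C"
  shows "(s, (Dom C s, {Ident C (Dom C s)}), (Cod C s, {Ident C (Cod C s)})) \<in> Mor (transporter_cat p C)"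
  unfolding transporter_Mor_iff using assms p_subgroup_Ident by simp

lemma to_orbit_functor:
  shows "s \<in> Mor C \<Longrightarrow> to_orbit C s \<in> Mor (orbit_cat p C)"
    and "t \<in> Mor C \<Longrightarrow> s \<in> Mor C \<Longrightarrow> Dom C t = Cod C s \<Longrightarrow>
      Dom (orbit_cat p C) (to_orbit C t) = Cod (orbit_cat p C) (to_orbit C s)"
    and "t \<in> Mor C \<Longrightarrow> s \<in> Mor C \<Longrightarrow> Dom C t = Cod C s \<Longrightarrow>
      Comp (orbit_cat p C) (to_orbit C t) (to_orbit C s) = to_orbit C (Comp C t s)"
proof -
  show "to_orbit C s \<in> Mor (orbit_cat p C)" if "s \<in> Mor C"
    using transporter_Ident_Ident[OF that] by (simp add: to_orbit_def del: orbit_of.simps)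
  assume ts: "t \<in> Mor C" "s \<in> Mor C" "Dom C t = Cod C s"
  then show "Dom (orbit_cat p C) (to_orbit C t) = Cod (orbit_cat p C) (to_orbit C s)"
    by (simp add: to_orbit_def)
  show "Comp (orbit_cat p C) (to_orbit C t) (to_orbit C s) = to_orbit C (Comp C t s)"
    using orbit_Comp[of t "Cod C s" "{Ident C (Cod C s)}" _ _ p s] transporter_Ident_Ident[OF ts(1), of p]
      transporter_Ident_Ident[OF ts(2), of p] ts
    unfolding to_orbit_def orbit_of.simps by simp
qed

lemma restrict_cocycle_to_orbit:
  assumes \<alpha>: "\<alpha> \<in> cocycles2 (orbit_cat p C) H"
  shows "restrict_cocycle (to_orbit C) \<alpha> \<in> cocycles2 C H"
proof -
  note F = to_orbit_functor[where p = p]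
  have \<alpha>1: "\<alpha> t s \<in> H" if "t \<in> Mor (orbit_cat p C)" "s \<in> Mor (orbit_cat p C)"
    "Dom (orbit_cat p C) t = Cod (orbit_cat p C) s" for t s
    using \<alpha> that unfolding cocycles2_def by blast
  have \<alpha>2: "\<alpha> u (Comp (orbit_cat p C) t s) * \<alpha> t s = \<alpha> (Comp (orbit_cat p C) u t) s * \<alpha> u t"
    if "u \<in> Mor (orbit_cat p C)" "t \<in> Mor (orbit_cat p C)" "s \<in> Mor (orbit_cat p C)"
    "Dom (orbit_cat p C) t = Cod (orbit_cat p C) s" "Dom (orbit_cat p C) u = Cod (orbit_cat p C) t" for u t s
    using \<alpha> that unfolding cocycles2_def by blast
  show ?thesis
    unfolding cocycles2_def restrict_cocycle_def
  proof (intro CollectI conjI ballI impI)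
    fix t s assume "t \<in> Mor C" "s \<in> Mor C" "Dom C t = Cod C s"
    then show "\<alpha> (to_orbit C t) (to_orbit C s) \<in> H" by (intro \<alpha>1 F)
  next
    fix u t s assume u: "u \<in> Mor C" and t: "t \<in> Mor C" and s: "s \<in> Mor C"
      and ts: "Dom C t = Cod C s" and ut: "Dom C u = Cod C t"
    show "\<alpha> (to_orbit C u) (to_orbit C (Comp C t s)) * \<alpha> (to_orbit C t) (to_orbit C s) =
        \<alpha> (to_orbit C (Comp C u t)) (to_orbit C s) * \<alpha> (to_orbit C u) (to_orbit C t)"
      using \<alpha>2[OF F(1)[OF u] F(1)[OF t] F(1)[OF s] F(2)[OF t s ts] F(2)[OF u t ut]]
      unfolding F(3)[OF t s ts] F(3)[OF u t ut] .
  qed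
qed

end

lemma twisted_galois_categoryI:
  assumes "fin_category D" "\<alpha> \<in> cocycles2 D (prime_field - {0})"
  shows "twisted_galois_category D \<alpha>"
proof -
  have "\<alpha> \<in> cocycles2 D (-{0})" "\<And>t s. t \<in> Mor D \<Longrightarrow> s \<in> Mor D \<Longrightarrow> Dom D t = Cod D s \<Longrightarrow> \<alpha> t s \<in> prime_field"
    using assms(2) unfolding cocycles2_def by auto
  then show ?thesis
    using assms(1) by (simp add: twisted_galois_category_def twisted_galois_category_axioms_def
        twisted_category_def twisted_category_axioms_def)
qed

theorem theorem1p6:
  fixes p :: nat
    and C :: "('o, 'm) category"
    and \<alpha> :: "'m set \<times> ('o \<times> 'm set) \<times> ('o \<times> 'm set)
             \<Rightarrow> 'm set \<times> ('o \<times> 'm set) \<times> ('o \<times> 'm set) \<Rightarrow> 'k::field"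
  assumes "Factorial_Ring.prime p"
    and "CHAR('k) = p"
    and "algebraic_closure (ring_of_type_algebra :: 'k ring) prime_field"
    and "finite_category C"
    and "\<alpha> \<in> cocycles2 (orbit_cat p C) (prime_field - {0})"
    and "\<And>e. idempotent_endo C e \<Longrightarrow>
           \<exists>F. equivariant_bijection (galois_group :: ('k \<Rightarrow> 'k) set) galois_simple galois_weight
                 (simple_classes (idem_group_algebra C (restrict_cocycle (to_orbit C) \<alpha>) e))
                 (weight_classes (orbit_cat p (idem_group_cat C e)) \<alpha>) F"
  shows "\<exists>F. equivariant_bijection (galois_group :: ('k \<Rightarrow> 'k) set) galois_simple galois_weight
               (simple_classes (twisted_algebra C (restrict_cocycle (to_orbit C) \<alpha>)))
               (weight_classes (orbit_cat p C) \<alpha>) F"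
proof -
  let ?O = "orbit_cat p C" and ?\<beta> = "restrict_cocycle (to_orbit C) \<alpha>"
  let ?A = "twisted_algebra C ?\<beta>" and ?G = "galois_group :: ('k \<Rightarrow> 'k) set"
  let ?wact = "\<lambda>\<sigma> (e :: 'm set \<times> ('o \<times> 'm set) \<times> ('o \<times> 'm set), T). (e, galois_module \<sigma> T)"
  interpret fin_category C
    using assms(4) by (simp add: finite_category_def fin_category_def fin_category_axioms_def)
  interpret O: twisted_galois_category ?O \<alpha>
    by (rule twisted_galois_categoryI[OF fin_category_orbit_cat assms(5)])
  interpret C: twisted_galois_category C ?\<beta>
    by (rule twisted_galois_categoryI[OF fin_category_axioms restrict_cocycle_to_orbit[OF assms(5)]])
  obtain I where I_all: "\<forall>i\<in>I. idempotent_endo C i"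
    "\<forall>e. idempotent_endo C e \<longrightarrow> (\<exists>i\<in>I. idem_iso C e i)"
    "\<forall>i\<in>I. \<forall>j\<in>I. idem_iso C i j \<longrightarrow> i = j"
    by (rule idempotent_representatives)
  have I: "idempotent_endo C i" if "i \<in> I" for i using I_all(1) that by blast
  have I_ex: "\<exists>i\<in>I. idem_iso C e i" if "idempotent_endo C e" for e using I_all(2) that by blast
  have I_eq: "i = j" if "i \<in> I" "j \<in> I" "idem_iso C i j" for i j using I_all(3) that by blast
  \<comment> \<open>Both sides are cut up by the same index set: simple modules by their apex,
    weights by the unit of a \<open>p\<close>-subgroup to whose identity their idempotent is
    isomorphic. \<open>W i\<close> is closed under isomorphism of weights, so it is larger than the
    set of weights over the orbit category of the group at \<open>i\<close>, but has the same
    isomorphism classes.\<close>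
  define V where "V i = {M :: ('m, 'k) tw_module. simple_module ?A M \<and> C.apex i M}" for i
  define W where "W i = {w \<in> weights ?O \<alpha>. \<exists>U P. p_subgroup p C U P \<and> unit_of C P = i \<and> idem_iso ?O (fst w) (orbit_id U P)}" for i

  have V_union: "{M. simple_module ?A M} = (\<Union>i\<in>I. V i)"
  proof -
    have "\<exists>i\<in>I. C.apex i M" if M: "simple_module ?A M" for M :: "('m, 'k) tw_module"
    proof -
      obtain e where e: "idempotent_endo C e" "C.apex e M" using C.apex_exists[OF M] by blast
      obtain i s t where i: "i \<in> I" "idem_iso_via C e i s t" using I_ex[OF e(1)] unfolding idem_iso_def by blast
      show ?thesis using C.apex_idem_iso[OF simple_moduleD(1)[OF M] e(1) I[OF i(1)] i(2) e(2)] i(1) by blast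
    qed
    then show ?thesis unfolding V_def by blast
  qed
  have V_eq: "i = j" if "i \<in> I" "j \<in> I" "M \<in> V i" "N \<in> V j" "mod_iso ?A M N" for i j M N
  proof -
    have M: "simple_module ?A M" "C.apex i M" and N: "simple_module ?A N" "C.apex j N" using that by (auto simp: V_def)
    have "C.apex i N"
      using C.apex_mod_iso[OF simple_moduleD(1)[OF M(1)] simple_moduleD(1)[OF N(1)] that(5) I[OF that(1)]] M(2) by blast
    then show ?thesis using I_eq that(1,2) C.apex_unique[OF N(1) I[OF that(1)] I[OF that(2)]] N(2) by blast
  qed
  have W_union: "weights ?O \<alpha> = (\<Union>i\<in>I. W i)"
  proof -
    have "\<exists>i\<in>I. \<exists>U P. p_subgroup p C U P \<and> unit_of C P = i \<and> idem_iso ?O E (orbit_id U P)"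
      if "(E, T) \<in> weights ?O \<alpha>" for E T
    proof -
      have E: "idempotent_endo ?O E" using O.weightsD(1)[OF that] .
      \<comment> \<open>\<open>E\<close> is first replaced by the identity of a
        \<open>p\<close>-subgroup \<open>Q\<close>. Then \<open>Q\<close> is conjugated so that its
        unit becomes the representative \<open>i\<close>.\<close>
      obtain U Q where Q: "p_subgroup p C U Q" "idem_iso ?O E (orbit_id U Q)"
        by (rule orbit_idempotent_iso_id[OF assms(1) E])
      obtain i where i: "i \<in> I" "idem_iso C (unit_of C Q) i" using I_ex[OF p_subgroupD(10)[OF Q(1)]] by blast
      obtain Q' where Q': "p_subgroup p C (Dom C i) Q'" "unit_of C Q' = i" "idem_iso ?O (orbit_id U Q) (orbit_id (Dom C i) Q')"
        by (rule orbit_id_iso_conj[OF assms(1) Q(1) I[OF i(1)] i(2)])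
      show ?thesis
        using O.idem_iso_trans[OF E idempotent_endo_orbit_id[OF Q(1)] idempotent_endo_orbit_id[OF Q'(1)] Q(2) Q'(3)]
          Q'(1,2) i(1) by blast
    qed
    then show ?thesis unfolding W_def by fastforce
  qed
  have W_eq: "i = j" if i: "i \<in> I" and j: "j \<in> I" and x: "x \<in> W i" and y: "y \<in> W j" and xy: "weight_iso ?O \<alpha> x y" for i j x y
  proof -
    have ids: "idempotent_endo ?O (fst x)" "idempotent_endo ?O (fst y)"
      using O.weightsD(1)[of "fst x" "snd x"] O.weightsD(1)[of "fst y" "snd y"] x y by (simp_all add: W_def)
    obtain U P where P: "p_subgroup p C U P" "unit_of C P = i" "idem_iso ?O (fst x) (orbit_id U P)"
      using x unfolding W_def by blast
    obtain U' Q where Q: "p_subgroup p C U' Q" "unit_of C Q = j" "idem_iso ?O (fst y) (orbit_id U' Q)"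
      using y unfolding W_def by blast
    note idP = idempotent_endo_orbit_id[OF P(1)] and idQ = idempotent_endo_orbit_id[OF Q(1)]
    have "idem_iso ?O (fst x) (orbit_id U' Q)"
      using O.idem_iso_trans[OF ids idQ O.weight_iso_imp_idem_iso[OF xy] Q(3)] .
    then have "idem_iso ?O (orbit_id U P) (orbit_id U' Q)"
      using O.idem_iso_trans[OF idP ids(1) idQ O.idem_iso_sym[OF ids(1) idP P(3)]] by blast
    then show ?thesis
      using idem_iso_if_orbit_id_iso[OF P(1) Q(1)] I_eq[OF i j] P(2) Q(2) by blast
  qed
  have W_sub: "W i \<subseteq> weights ?O \<alpha>" for i by (auto simp: W_def)
  have equiv_W: "equiv (W i) (rel_on (weight_iso ?O \<alpha>) (W i))" for i
  proof (rule equiv_rel_onI)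
    note E = O.equiv_weight_iso
    show "weight_iso ?O \<alpha> x x" if "x \<in> W i" for x
      using equiv_class_self[OF E] W_sub that by blast
    show "weight_iso ?O \<alpha> y x" if "x \<in> W i" "y \<in> W i" "weight_iso ?O \<alpha> x y" for x y
      using E W_sub that unfolding equiv_def sym_def by blast
    show "weight_iso ?O \<alpha> x z" if "x \<in> W i" "y \<in> W i" "z \<in> W i" "weight_iso ?O \<alpha> x y" "weight_iso ?O \<alpha> y z" for x y z
      using E W_sub that unfolding equiv_def trans_def by blast
  qed
  have act_W: "acts_by_isos ?G ?wact (weight_iso ?O \<alpha>) (W i)" for i
  proof (rule acts_by_isos_subset[OF O.acts_by_isos_weights W_sub])
    fix \<sigma> :: "'k \<Rightarrow> 'k" and x assume \<sigma>: "\<sigma> \<in> ?G" and x: "x \<in> W i"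
    have "?wact \<sigma> x \<in> weights ?O \<alpha>"
      using O.acts_by_isos_weights \<sigma> x W_sub unfolding acts_by_isos_def by blast
    then show "?wact \<sigma> x \<in> W i" using x by (cases x) (simp add: W_def)
  qed

  \<comment> \<open>The bijection of a piece is the composite of three: simple modules with apex
    \<open>i\<close> to simple modules of the group algebra, the given bijection, and the inclusion
    of the weights over the group at \<open>i\<close> into those of the whole orbit
    category.\<close>
  have piece: "\<exists>F. equivariant_bijection ?G galois_simple galois_weight
      (iso_classes (mod_iso ?A) (V i)) (iso_classes (weight_iso ?O \<alpha>) (W i)) F" if "i \<in> I" for i
  proof -
    note i = I[OF that]
    let ?Oi = "orbit_cat p (idem_group_cat C i)"
    have fin_i: "fin_category ?Oi"
      by (rule fin_category.fin_category_orbit_cat[OF fin_category_idem_group_cat[OF i]])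
    have "\<alpha> \<in> cocycles2 ?Oi (prime_field - {0})"
      using assms(5) orbit_idem_group_Mor_subset[OF i, of p]
      unfolding cocycles2_def orbit_idem_group_cat_simps by blast
    then interpret Oi: twisted_galois_category ?Oi \<alpha>
      by (rule twisted_galois_categoryI[OF fin_i])
    have alg_eq: "idem_group_algebra ?Oi \<alpha> E = idem_group_algebra ?O \<alpha> E" if "idempotent_endo ?Oi E" for E
      using idem_group_orbit_idem_group(2)[OF i that] by simp
    have idem_Oi: "idempotent_endo ?O E" if "idempotent_endo ?Oi E" for E
      using that idempotent_endo_orbit_id unfolding idempotent_endo_orbit_idem_group_iff[OF i] by blast
    have weights_sub: "x \<in> W i" if x: "x \<in> weights ?Oi \<alpha>" for x
    proof -
      obtain E T where xET: "x = (E, T)" by (cases x)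
      have E: "idempotent_endo ?Oi E" using Oi.weightsD(1) x xET by blast
      have "x \<in> weights ?O \<alpha>"
        using x idem_Oi[OF E] unfolding xET weights_def by (simp add: alg_eq[OF E])
      moreover have "\<exists>U P. p_subgroup p C U P \<and> unit_of C P = i \<and> E = orbit_id U P"
        using E unfolding idempotent_endo_orbit_idem_group_iff[OF i] .
      ultimately show ?thesis
        unfolding W_def xET using O.idem_iso_refl[OF idem_Oi[OF E]] by auto
    qed
    have weight_iso_eq: "weight_iso ?O \<alpha> x y \<longleftrightarrow> weight_iso ?Oi \<alpha> x y"
      if x: "x \<in> weights ?Oi \<alpha>" and y: "y \<in> weights ?Oi \<alpha>" for x y
    proof -
      obtain E T E' T' where xy: "x = (E, T)" "y = (E', T')" by (cases x, cases y)
      have E: "idempotent_endo ?Oi E" and E': "idempotent_endo ?Oi E'" using Oi.weightsD(1) x y xy by blast+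
      \<comment> \<open>Besides \<open>\<alpha>\<close>, transport sees only the composition and the
        group at \<open>E\<close>, and these are shared by the two orbit categories.\<close>
      have "transport ?Oi \<alpha> E s t = transport ?O \<alpha> E s t" for s t
        by (simp add: fun_eq_iff transport_def transport_coeff_def idem_group_orbit_idem_group(1)[OF i E])
      then show ?thesis
        unfolding xy weight_iso_def
        by (simp add: alg_eq[OF E] alg_eq[OF E'] idem_iso_via_orbit_idem_group_iff[OF i E E'])
    qed
    have weights_surj: "\<exists>x\<in>weights ?Oi \<alpha>. weight_iso ?O \<alpha> x y" if y: "y \<in> W i" for y
    proof -
      obtain E T where yET: "y = (E, T)" by (cases y)
      obtain U P where P: "p_subgroup p C U P" "unit_of C P = i" "idem_iso ?O E (orbit_id U P)"
        using y unfolding W_def yET by auto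
      have w: "(E, T) \<in> weights ?O \<alpha>" using y W_sub yET by blast
      have id: "idempotent_endo ?Oi (orbit_id U P)"
        using P(1,2) unfolding idempotent_endo_orbit_idem_group_iff[OF i] by blast
      obtain s t where st: "idem_iso_via ?O E (orbit_id U P) s t" using P(3) unfolding idem_iso_def by blast
      \<comment> \<open>A weight in \<open>W i\<close> is moved along the isomorphism of its
        idempotent with \<open>orbit_id U P\<close>, which is an idempotent over the group at
        \<open>i\<close>.\<close>
      let ?x = "(orbit_id U P, pull_scalars (transport ?O \<alpha> (orbit_id U P) t s) T)"
      have x: "?x \<in> weights ?O \<alpha>" and iso: "weight_iso ?O \<alpha> (E, T) ?x"
        using O.weight_transport[OF w idem_Oi[OF id] st] by auto
      have "?x \<in> weights ?Oi \<alpha>"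
        using x id unfolding weights_def by (simp add: alg_eq[OF id])
      moreover have "weight_iso ?O \<alpha> ?x y"
        using O.equiv_weight_iso x w iso unfolding equiv_def sym_def yET by blast
      ultimately show ?thesis by blast
    qed
    \<comment> \<open>On representatives this is the inclusion, hence the identity function below.
      The classes grow when passing to \<open>W i\<close>, but they correspond bijectively.\<close>
    have "\<exists>F. equivariant_bijection ?G (\<lambda>\<sigma> c. ?wact \<sigma> ` c) (\<lambda>\<sigma> c. ?wact \<sigma> ` c)
        (iso_classes (weight_iso ?Oi \<alpha>) (weights ?Oi \<alpha>)) (iso_classes (weight_iso ?O \<alpha>) (W i)) F"
    proof (rule iso_classes_equivariant_bijection[where f = "\<lambda>x. x", OF Oi.equiv_weight_iso equiv_W Oi.acts_by_isos_weights act_W])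
      fix \<sigma> :: "'k \<Rightarrow> 'k" and x assume "\<sigma> \<in> ?G" "x \<in> weights ?Oi \<alpha>"
      then have "?wact \<sigma> x \<in> W i"
        using Oi.acts_by_isos_weights weights_sub unfolding acts_by_isos_def by blast
      then show "weight_iso ?O \<alpha> (?wact \<sigma> x) (?wact \<sigma> x)"
        using equiv_class_self[OF equiv_W] by blast
    qed (use weights_sub weight_iso_eq weights_surj in blast)+
    then obtain F3 where F3: "equivariant_bijection ?G galois_weight galois_weight
        (weight_classes ?Oi \<alpha>) (iso_classes (weight_iso ?O \<alpha>) (W i)) F3"
      unfolding weight_classes_def galois_weight_def[abs_def] by blast
    obtain F2 where F2: "equivariant_bijection ?G galois_simple galois_weight
        (simple_classes (idem_group_algebra C ?\<beta> i)) (weight_classes ?Oi \<alpha>) F2"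
      using assms(6)[OF i] by blast
    obtain F1 where F1: "equivariant_bijection ?G galois_simple galois_simple
        (iso_classes (mod_iso ?A) (V i)) (simple_classes (idem_group_algebra C ?\<beta> i)) F1"
      using C.corner_equivariant_bijection[OF i] unfolding V_def by blast
    show ?thesis
      using equivariant_bijection_comp[OF equivariant_bijection_comp[OF F1 F2] F3] by blast
  qed
  have refl_W: "weight_iso ?O \<alpha> x x" if "x \<in> W i" for i x
    using equiv_class_self[OF equiv_W that] by blast
  have V_cls: "iso_classes (mod_iso ?A) (\<Union>i\<in>I. V i) = (\<Union>i\<in>I. iso_classes (mod_iso ?A) (V i))"
    "disjoint_family_on (\<lambda>i. iso_classes (mod_iso ?A) (V i)) I"
    by (rule iso_classes_Union; use V_eq mod_iso_refl in blast)+
  have W_cls: "iso_classes (weight_iso ?O \<alpha>) (\<Union>i\<in>I. W i) = (\<Union>i\<in>I. iso_classes (weight_iso ?O \<alpha>) (W i))"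
    "disjoint_family_on (\<lambda>i. iso_classes (weight_iso ?O \<alpha>) (W i)) I"
    by (rule iso_classes_Union; use W_eq refl_W in blast)+
  \<comment> \<open>Gluing preserves equivariance only if conjugation stays within a piece, which
    holds as conjugate modules have the same apex.\<close>
  have act_V: "galois_simple \<sigma> c \<in> iso_classes (mod_iso ?A) (V i)"
    if "\<sigma> \<in> ?G" "c \<in> iso_classes (mod_iso ?A) (V i)" for i \<sigma> c
    unfolding galois_simple_def
  proof (rule acts_by_isos_iso_classes[OF _ _ that])
    show "equiv (V i) (rel_on (mod_iso ?A) (V i))"
      by (rule C.equiv_simple_modules) (auto simp: V_def)
    show "acts_by_isos ?G galois_module (mod_iso ?A) (V i)"
      unfolding V_def by (rule C.acts_by_isos_apex_modules)
  qed
  show ?thesis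
    unfolding simple_classes_def weight_classes_def V_union W_union V_cls(1) W_cls(1)
    by (rule equivariant_bijection_Union[OF piece V_cls(2) W_cls(2) act_V])
qed

end
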